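(* Consider the FSPG iterates $(\mathbf{w}^{(k)})$ with parameters $c>0$, $\beta>0$, $d\in(0,1)$ such that $\beta c\ge\frac{\lambda_{\max}(\bar{\mathbf{X}}^\top\bar{\mathbf{X}})}{2}$. Let $\rho\ge0$ be a weak convexity parameter of $P_{\lambda,\gamma}$ and assume there exists $K$ such that $\sigma^{(k+1)}\ge n\rho$ for all $k\ge K$. Then there exists a sequence $\boldsymbol{\kappa}^{(k+1)}\in\nabla\sum_{l=1}^L\tilde g_l(\mathbf{w}^{(k+1)},\mu^{(k+2)})+n\,\partial P_{\lambda,\gamma}(\mathbf{w}^{(k+1)})$ such that $$\|\boldsymbol{\kappa}^{(k+1)}\|\in o\big(k^{-\frac12+\frac d2}\big)\quad(k\to\infty).$$
   Context: Data: $L$ clients; client $l$ holds $y^{(l)}_1,\dots,y^{(l)}_{M_l}\in\mathbb{R}$ and $\bar{\mathbf{x}}^{(l)}_i=[(\mathbf{x}^{(l)}_i)^\top,1]^\top\in\mathbb{R}^{P+1}$; $n=\sum_l M_l$; $\bar{\mathbf{X}}\in\mathbb{R}^{(P+1)\times n}$ has all $\bar{\mathbf{x}}^{(l)}_i$ as columns; $\lambda_{\max}$ is the largest eigenvalue. Quantile level $\tau\in(0,1)$. Smoothing: $f(r,\mu)=|r|$ if $|r|\ge\mu$, $f(r,\mu)=\frac{r^2}{2\mu}+\frac{\mu}{2}$ if $|r|<\mu$; $\tilde g_l(\mathbf{w},\mu)=\frac12\sum_{i} f(y^{(l)}_i-(\bar{\mathbf{x}}^{(l)}_i)^\top\mathbf{w},\mu)+(\tau-\frac12)\sum_i(y^{(l)}_i-(\bar{\mathbf{x}}^{(l)}_i)^\top\mathbf{w})$;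 $\nabla$ is the gradient in $\mathbf{w}$. Penalty: $\lambda>0$, $P_{\lambda,\gamma}(\mathbf{w})=\sum_{p=1}^{P}g_{\lambda,\gamma}(w_p)$ with $g_{\lambda,\gamma}$ either MCP ($\gamma\ge1$): $\lambda|t|-\frac{t^2}{2\gamma}$ for $|t|\le\gamma\lambda$, $\frac{\gamma\lambda^2}{2}$ otherwise; or SCAD ($\gamma\ge2$): $\lambda|t|$ for $|t|\le\lambda$, $-\frac{t^2-2\gamma\lambda|t|+\lambda^2}{2(\gamma-1)}$ for $\lambda<|t|\le\gamma\lambda$, $\frac{(\gamma+1)\lambda^2}{2}$ for $|t|>\gamma\lambda$. $\partial$ denotes the (limiting/Fréchet) subdifferential, which for the weakly convex $P_{\lambda,\gamma}$ equals $\partial\big(P_{\lambda,\gamma}+\frac\rho2\|\cdot\|^2\big)(\mathbf{w})-\rho\mathbf{w}$ in the convex sense. A weak convexity parameter of $P_{\lambda,\gamma}$ is $\rho\ge0$ such that $\mathbf{w}\mapsto P_{\lambda,\gamma}(\mathbf{w})+\frac{\rho}{2}\|\mathbf{w}\|_2^2$ is convex. FSPG algorithm: choose $\mathbf{w}^{(0)}\in\mathbb{R}^{P+1}$, $c>0$, $\beta>0$, $d\in(0,1)$; set $\sigma^{(k)}=ck^d$ and $\mu^{(k)}=\beta/k^d$ for $k\ge1$; for $k=0,1,2,\dots$ let $\mathbf{w}^{(k+1)}$ be a minimizer over $\mathbf{w}\in\mathbb{R}^{P+1}$ of $\sum_{l=1}^L\langle\nabla\tilde g_l(\mathbf{w}^{(k)},\mu^{(k+1)}),\mathbf{w}-\mathbf{w}^{(k)}\rangle+nP_{\lambda,\gamma}(\mathbf{w})+\frac{\sigma^{(k+1)}}{2}\|\mathbf{w}-\mathbf{w}^{(k)}\|_2^2$.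 *)

theory Defs
  imports "HOL-Analysis.Analysis" "HOL-Library.Landau_Symbols"
begin

definition grad :: "('a::real_inner \<Rightarrow> real) \<Rightarrow> 'a \<Rightarrow> 'a" where
  "grad F x = (SOME G. GDERIV F x :> G)"

definition fsmooth :: "real \<Rightarrow> real \<Rightarrow> real" where
  "fsmooth r mu = (if \<bar>r\<bar> \<ge> mu then \<bar>r\<bar> else r^2 / (2*mu) + mu/2)"

definition gtilde ::
  "real \<Rightarrow> (nat \<Rightarrow> nat) \<Rightarrow> (nat \<Rightarrow> nat \<Rightarrow> real) \<Rightarrow> (nat \<Rightarrow> nat \<Rightarrow> real^'n)
     \<Rightarrow> nat \<Rightarrow> real^'n \<Rightarrow> real \<Rightarrow> real" where
  "gtilde tau M y xb l w mu =
     (1/2) * (\<Sum>i<M l. fsmooth (y l i - xb l i \<bullet> w) mu)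
     + (tau - 1/2) * (\<Sum>i<M l. y l i - xb l i \<bullet> w)"

definition mcp :: "real \<Rightarrow> real \<Rightarrow> real \<Rightarrow> real" where
  "mcp lam gam t = (if \<bar>t\<bar> \<le> gam * lam then lam * \<bar>t\<bar> - t^2 / (2*gam) else gam * lam^2 / 2)"

definition scad :: "real \<Rightarrow> real \<Rightarrow> real \<Rightarrow> real" where
  "scad lam gam t =
     (if \<bar>t\<bar> \<le> lam then lam * \<bar>t\<bar>
      else if \<bar>t\<bar> \<le> gam * lam then - (t^2 - 2*gam*lam*\<bar>t\<bar> + lam^2) / (2*(gam - 1))
      else (gam + 1) * lam^2 / 2)"

(* Penalty P(w) = sum over the P feature coordinates, i.e. all coordinates except
   the intercept coordinate i0 *)
definition penalty :: "(real \<Rightarrow> real) \<Rightarrow> 'n::finite \<Rightarrow> real^'n \<Rightarrow> real" where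
  "penalty g i0 w = (\<Sum>p\<in>UNIV - {i0}. g (w $ p))"

definition frechet_subdiff :: "('a::real_inner \<Rightarrow> real) \<Rightarrow> 'a \<Rightarrow> 'a set" where
  "frechet_subdiff F x = {v. \<forall>e>0. \<forall>\<^sub>F u in at x.
       F u \<ge> F x + v \<bullet> (u - x) - e * norm (u - x)}"

(* Largest eigenvalue of the Gram matrix  Xbar^T Xbar  whose rows/columns are indexed
   by the finite sample set S (columns of Xbar are the xb s, s in S) *)
definition lambda_max_gram :: "'s set \<Rightarrow> ('s \<Rightarrow> 'a::real_inner) \<Rightarrow> real" where
  "lambda_max_gram S xb = Max {e. \<exists>v::'s \<Rightarrow> real. (\<forall>s. s \<notin> S \<longrightarrow> v s = 0) \<and> (\<exists>s\<in>S. v s \<noteq> 0) \<and>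
        (\<forall>s\<in>S. (\<Sum>t\<in>S. (xb s \<bullet> xb t) * v t) = e * v s)}"

end

theory Submission
  imports Defs
begin

text \<open>Write \<open>F(w, mu)\<close> for the smoothed objective, \<open>\<Phi>\<^sub>k = F(w\<^sub>k, mu\<^sub>k)\<close>, and let \<open>p\<^sub>k\<close> be the length of
  the \<open>k\<close>-th step times its prox weight. Descent only gives that \<open>p\<^sub>k\<^sup>2 / k\<^sup>d\<close> is summable, which is too
  weak for a pointwise rate. What rules out recurring bursts of \<open>p\<^sub>k\<close> is that \<open>F(\<cdot>, mu)\<close> is piecewise
  quadratic: on each of its finitely many cells either the gradient is bounded away from \<open>0\<close>, or
  \<open>\<bar>F - v(mu)\<bar> \<le> C \<bar>\<nabla>F\<bar>\<^sup>2\<close> with \<open>C\<close> independent of \<open>mu\<close>, where the critical value \<open>v\<close> of the quadratic is a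
  rational function of \<open>mu\<close>. So \<open>\<Phi>\<close> decreases at a definite speed away from finitely many
  slowly moving levels, and the levels, being rational in \<open>mu\<close>, are pairwise either asymptotically equal
  or asymptotically separated at the scale \<open>k\<^sup>d\<^sup>-\<^sup>1\<close>. Hence \<open>\<Phi>\<close> settles at one level up to \<open>o(k\<^sup>d\<^sup>-\<^sup>1)\<close>.
  Since \<open>p\<^sub>k\<close> grows at most by a factor \<open>1 + O(k\<^sup>-\<^sup>d)\<close> per step, also \<open>p\<^sub>k\<^sup>2 = o(k\<^sup>d\<^sup>-\<^sup>1)\<close>, and the residual is
  bounded by \<open>p\<^sub>k + O(1/k)\<close>.\<close>

section \<open>Huber smoothing and the penalties\<close>

text \<open>Everything hinges on a balance of exponents. At distance of order \<open>k^(d-1)\<close>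
  from every level, the KL inequality makes the squared residual at least of that order, hence the
  descent at least of order \<open>k^(-d) * k^(d-1) = 1/k\<close>. This is not summable, so the
  situation cannot last; and it dominates the drift of the levels, which is of order
  \<open>k^(-1-d)\<close>, being at most a Lipschitz constant times the change of \<open>mu\<close>.
  The second obstacle is that summable descent controls the steps only on average: a factor 2
  between residual and step would permit exponential growth. The product
  \<open>sigma * mu = beta * c\<close> is therefore used sharply: it makes the explicit gradient
  step nonexpansive, so the residual exceeds \<open>p\<close> only through the change of
  \<open>mu\<close>, whose relative size is \<open>O(1/k)\<close>, and weak convexity accounts for
  the growth factor. The third obstacle is uniformity as \<open>mu\<close> tends to 0: the Hessians
  \<open>P / (2 * mu) - D\<close> of the cells may be indefinite and singular, and the lower bound
  on their nonzero part rests on \<open>P\<close> and \<open>D\<close> both being positive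
  semidefinite.\<close>

definition huber_slope :: "real \<Rightarrow> real \<Rightarrow> real" where
  "huber_slope r mu = max (-1) (min 1 (r / mu))"

lemma huber_slope_bounds: "\<bar>huber_slope r mu\<bar> \<le> 1"
  by (simp add: huber_slope_def)

lemma huber_slope_eq:
  assumes "mu > 0"
  shows "huber_slope r mu = (if r \<ge> mu then 1 else if r \<le> - mu then -1 else r / mu)"
  using assms by (auto simp: huber_slope_def max_def min_def field_simps)

text \<open>\<open>fsmooth r mu\<close> is the maximum over \<open>|t| <= 1\<close> of
  \<open>t * r - mu * t^2 / 2 + mu / 2\<close>, and the clipped quotient is the maximiser. For fixed
  \<open>t\<close> these functions are affine in \<open>r\<close> and nondecreasing in
  \<open>mu\<close>, so convexity, monotonicity in \<open>mu\<close> and domination of the absolute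
  value can be read off.\<close>

lemma fsmooth_eq_slope:
  assumes "mu > 0"
  shows "fsmooth r mu = huber_slope r mu * r - mu * (huber_slope r mu)\<^sup>2 / 2 + mu / 2"
  using assms by (auto simp: fsmooth_def huber_slope_eq power2_eq_square field_simps)

lemma fsmooth_dual_le:
  assumes "mu > 0" "\<bar>t\<bar> \<le> 1"
  shows "t * r - mu * t\<^sup>2 / 2 + mu / 2 \<le> fsmooth r mu"
proof (cases "\<bar>r\<bar> \<ge> mu")
  case True
  have "t * r \<le> \<bar>t\<bar> * \<bar>r\<bar>" by (metis abs_ge_self abs_mult)
  moreover have "mu * (1 - \<bar>t\<bar>) \<le> \<bar>r\<bar> * (1 - \<bar>t\<bar>)"
    using True assms by (intro mult_right_mono) auto
  then have "mu - mu * \<bar>t\<bar> \<le> \<bar>r\<bar> - \<bar>t\<bar> * \<bar>r\<bar>" by (simp add: algebra_simps)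
  moreover have "0 \<le> mu * (1 - \<bar>t\<bar>)\<^sup>2" using assms by simp
  then have "2 * (mu * \<bar>t\<bar>) \<le> mu + mu * t\<^sup>2" by (simp add: power2_diff algebra_simps)
  ultimately show ?thesis using True unfolding fsmooth_def by simp
next
  case False
  have "r\<^sup>2 / (2 * mu) + mu / 2 - (t * r - mu * t\<^sup>2 / 2 + mu / 2) = (r - mu * t)\<^sup>2 / (2 * mu)"
    using assms by (simp add: power2_eq_square field_simps)
  moreover have "(r - mu * t)\<^sup>2 / (2 * mu) \<ge> 0" using assms by simp
  ultimately have "t * r - mu * t\<^sup>2 / 2 + mu / 2 \<le> r\<^sup>2 / (2 * mu) + mu / 2" by linarith
  then show ?thesis using False by (simp add: fsmooth_def)
qed

text \<open>\<open>fsmooth s mu - mu / 2\<close> is the Moreau envelope of the absolute value, so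
  every candidate \<open>u\<close> for the proximal point yields an upper bound; the counterpart of
  \<open>fsmooth_dual_le\<close>.\<close>

lemma fsmooth_primal_le:
  assumes "mu > 0"
  shows "fsmooth s mu \<le> \<bar>u\<bar> + (s - u)\<^sup>2 / (2 * mu) + mu / 2"
proof (cases "\<bar>s\<bar> \<ge> mu")
  case True
  have "(s - u)\<^sup>2 / (2 * mu) + mu / 2 - \<bar>s - u\<bar> = (\<bar>s - u\<bar> - mu)\<^sup>2 / (2 * mu)"
    using assms by (auto simp: power2_eq_square abs_if field_simps)
  moreover have "(\<bar>s - u\<bar> - mu)\<^sup>2 / (2 * mu) \<ge> 0" using assms by simp
  ultimately show ?thesis using True by (auto simp: fsmooth_def)
next
  case False
  have "s * u \<le> \<bar>s\<bar> * \<bar>u\<bar>" by (metis abs_ge_self abs_mult)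
  also have "\<dots> \<le> mu * \<bar>u\<bar>" using False by (intro mult_right_mono) auto
  finally have "s * u \<le> mu * \<bar>u\<bar>" .
  moreover have "\<bar>u\<bar> + (s - u)\<^sup>2 / (2 * mu) - s\<^sup>2 / (2 * mu) = (2 * (mu * \<bar>u\<bar> - s * u) + u\<^sup>2) / (2 * mu)"
    using assms by (simp add: power2_eq_square field_simps)
  moreover have "(2 * (mu * \<bar>u\<bar> - s * u) + u\<^sup>2) / (2 * mu) \<ge> 0"
    using assms calculation(1) by (intro divide_nonneg_pos add_nonneg_nonneg) auto
  ultimately have "s\<^sup>2 / (2 * mu) \<le> \<bar>u\<bar> + (s - u)\<^sup>2 / (2 * mu)" by linarith
  then show ?thesis using False by (simp add: fsmooth_def)
qed

lemma fsmooth_lower: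
  assumes "mu > 0"
  shows "fsmooth r mu + huber_slope r mu * (s - r) \<le> fsmooth s mu"
  using fsmooth_dual_le[OF assms huber_slope_bounds, of r mu s] fsmooth_eq_slope[OF assms, of r]
  by (simp add: algebra_simps)

text \<open>The Moreau-envelope representation of the Huber function, evaluated at the proximal point
  of \<open>r\<close>, is a quadratic majorant.\<close>
lemma fsmooth_upper:
  assumes "mu > 0"
  shows "fsmooth s mu \<le> fsmooth r mu + huber_slope r mu * (s - r) + (s - r)\<^sup>2 / (2 * mu)"
proof -
  define u where "u = r - mu * huber_slope r mu"
  have "fsmooth r mu = \<bar>u\<bar> + (r - u)\<^sup>2 / (2 * mu) + mu / 2"
    using assms by (auto simp: u_def fsmooth_def huber_slope_eq power2_eq_square field_simps)
  moreover have "(s - u)\<^sup>2 / (2 * mu) = (r - u)\<^sup>2 / (2 * mu) + huber_slope r mu * (s - r) + (s - r)\<^sup>2 / (2 * mu)"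
    using assms by (simp add: u_def power2_eq_square field_simps)
  ultimately show ?thesis using fsmooth_primal_le[OF assms, of s u] by linarith
qed

lemma fsmooth_mono:
  assumes "0 < mu" "mu \<le> mu'"
  shows "fsmooth r mu \<le> fsmooth r mu'"
proof -
  have t: "(huber_slope r mu)\<^sup>2 \<le> 1"
    using huber_slope_bounds[of r mu] by (simp add: abs_square_le_1)
  have "mu * (1 - (huber_slope r mu)\<^sup>2) \<le> mu' * (1 - (huber_slope r mu)\<^sup>2)"
    using t assms by (intro mult_right_mono) auto
  then show ?thesis
    using fsmooth_dual_le[of mu' "huber_slope r mu" r] fsmooth_eq_slope[of mu r] assms huber_slope_bounds
    by (simp add: algebra_simps)
qed

lemma fsmooth_ge_abs: "mu > 0 \<Longrightarrow> \<bar>r\<bar> \<le> fsmooth r mu"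
  using fsmooth_dual_le[of mu 1 r] fsmooth_dual_le[of mu "-1" r] by auto

lemma huber_slope_mono:
  assumes "mu > 0" "r \<le> s"
  shows "huber_slope r mu \<le> huber_slope s mu"
proof -
  have "r / mu \<le> s / mu" using assms by (simp add: divide_right_mono)
  then show ?thesis by (auto simp: huber_slope_def max_def min_def)
qed

lemma huber_slope_lipschitz:
  assumes "mu > 0"
  shows "\<bar>huber_slope r mu - huber_slope s mu\<bar> \<le> \<bar>r - s\<bar> / mu"
proof -
  have "\<bar>r / mu - s / mu\<bar> = \<bar>r - s\<bar> / mu" using assms by (simp flip: diff_divide_distrib)
  then show ?thesis by (auto simp: huber_slope_def max_def min_def)
qed

text \<open>Firm monotonicity in one dimension; summed over samples it yields co-coercivity of the
  gradient of the smoothed loss.\<close>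
lemma huber_slope_coercive:
  assumes "mu > 0"
  shows "mu * (huber_slope r mu - huber_slope s mu)\<^sup>2 \<le> (huber_slope r mu - huber_slope s mu) * (r - s)"
proof -
  let ?D = "huber_slope r mu - huber_slope s mu"
  have "0 \<le> ?D * (r - s)"
    using huber_slope_mono[OF assms, of r s] huber_slope_mono[OF assms, of s r]
    by (cases "r \<le> s") (auto simp: mult_nonpos_nonpos)
  then have "?D * (r - s) = \<bar>?D\<bar> * \<bar>r - s\<bar>" by (metis abs_mult abs_of_nonneg)
  moreover have "\<bar>?D\<bar> * (mu * \<bar>?D\<bar>) \<le> \<bar>?D\<bar> * \<bar>r - s\<bar>"
    using huber_slope_lipschitz[OF assms, of r s] assms by (intro mult_left_mono) (auto simp: field_simps)
  moreover have "mu * ?D\<^sup>2 = \<bar>?D\<bar> * (mu * \<bar>?D\<bar>)"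
    by (metis abs_mult_self_eq mult.left_commute power2_eq_square)
  ultimately show ?thesis by linarith
qed

text \<open>Uniform in \<open>r\<close>: the two slopes differ most at \<open>|r| = mu'\<close>,
  where the bound is attained. For consecutive smoothing parameters the right-hand side is
  \<open>O(1/k)\<close>, however large the residuals are.\<close>

lemma huber_slope_diff_mu:
  assumes "0 < mu'" "mu' \<le> mu"
  shows "\<bar>huber_slope r mu' - huber_slope r mu\<bar> \<le> 1 - mu' / mu"
proof -
  have mu: "mu > 0" using assms by simp
  have A: "\<bar>huber_slope r mu' - huber_slope r mu\<bar> \<le> 1 - mu' / mu" if r: "r \<ge> 0" for r
  proof -
    consider "r \<ge> mu" | "mu' \<le> r" "r < mu" | "r < mu'" by linarith
    then show ?thesis
    proof cases
      case 1 then show ?thesis using assms mu by (simp add: huber_slope_eq)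
    next
      case 2
      have "mu' / mu \<le> r / mu" using 2 mu by (simp add: divide_right_mono)
      moreover have "r / mu \<le> 1" using 2 mu by simp
      ultimately show ?thesis using 2 r assms mu by (simp add: huber_slope_eq)
    next
      case 3
      have "r / mu' - r / mu = (r / mu') * (1 - mu' / mu)" using assms mu by (simp add: field_simps)
      also have "\<dots> \<le> 1 * (1 - mu' / mu)" using 3 assms mu by (intro mult_right_mono) auto
      finally have "r / mu' - r / mu \<le> 1 - mu' / mu" by simp
      moreover have "r / mu \<le> r / mu'" using assms mu r by (simp add: frac_le)
      ultimately show ?thesis using 3 r assms mu by (simp add: huber_slope_eq)
    qed
  qed
  have neg: "huber_slope r m = - huber_slope (- r) m" for r m
    by (auto simp: huber_slope_def max_def min_def)
  show ?thesis
  proof (cases "r \<ge> 0")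
    case False
    then show ?thesis using A[of "-r"] neg[of r mu] neg[of r mu'] by simp
  qed (use A in simp)
qed

text \<open>Gradients are obtained from a convexity inequality below and a quadratic majorant above
  instead of from the piecewise definition, so the breakpoints \<open>|r| = mu\<close> need no
  separate treatment.\<close>

lemma gderiv_of_quadratic_bound:
  fixes F :: "'a::real_inner \<Rightarrow> real"
  assumes "\<And>u. \<bar>F u - F x - v \<bullet> (u - x)\<bar> \<le> C * (norm (u - x))\<^sup>2"
  shows "GDERIV F x :> v"
  unfolding gderiv_def
proof (rule has_derivativeI)
  show "bounded_linear (\<lambda>h. h \<bullet> v)" by (rule bounded_linear_inner_left)
  have "((\<lambda>u. \<bar>C\<bar> * norm (u - x)) \<longlongrightarrow> 0) (at x)"
    by (rule tendsto_eq_intros | simp)+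
  moreover have "\<forall>\<^sub>F u in at x. norm ((F u - F x - (u - x) \<bullet> v) /\<^sub>R norm (u - x)) \<le> \<bar>C\<bar> * norm (u - x)"
    unfolding eventually_at_filter
  proof (intro eventuallyI impI)
    fix u assume "u \<noteq> x"
    then have n: "norm (u - x) > 0" by simp
    have "\<bar>F u - F x - (u - x) \<bullet> v\<bar> \<le> C * (norm (u - x))\<^sup>2"
      using assms[of u] by (simp add: inner_commute)
    also have "\<dots> \<le> \<bar>C\<bar> * (norm (u - x))\<^sup>2" by (intro mult_right_mono) auto
    finally have "\<bar>F u - F x - (u - x) \<bullet> v\<bar> \<le> \<bar>C\<bar> * norm (u - x) * norm (u - x)"
      by (simp add: power2_eq_square mult.assoc)
    then show "norm ((F u - F x - (u - x) \<bullet> v) /\<^sub>R norm (u - x)) \<le> \<bar>C\<bar> * norm (u - x)"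
      using n by (simp add: divide_inverse[symmetric] mult.commute[of "inverse _"] pos_divide_le_eq)
  qed
  ultimately show "((\<lambda>u. (F u - F x - (u - x) \<bullet> v) /\<^sub>R norm (u - x)) \<longlongrightarrow> 0) (at x)"
    by (rule Lim_null_comparison[rotated])
qed

lemma grad_eqI:
  assumes "GDERIV F x :> v"
  shows "grad F x = v"
proof -
  have "GDERIV F x :> grad F x" unfolding grad_def using assms by (rule someI)
  then have "(\<lambda>h. h \<bullet> grad F x) = (\<lambda>h. h \<bullet> v)"
    using assms unfolding gderiv_def by (rule has_derivative_unique)
  then have "(grad F x - v) \<bullet> (grad F x - v) = 0"
    by (metis inner_diff_right right_minus_eq)
  then show ?thesis by simp
qed

lemma fsmooth_has_real_derivative:
  assumes "mu > 0"
  shows "((\<lambda>r. fsmooth r mu) has_real_derivative huber_slope r mu) (at r)"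
proof -
  have "GDERIV (\<lambda>r. fsmooth r mu) r :> huber_slope r mu"
  proof (rule gderiv_of_quadratic_bound[where C = "1 / (2 * mu)"])
    fix s show "\<bar>fsmooth s mu - fsmooth r mu - huber_slope r mu \<bullet> (s - r)\<bar> \<le> 1 / (2 * mu) * (norm (s - r))\<^sup>2"
      using fsmooth_lower[OF assms, of r s] fsmooth_upper[OF assms, of s r] assms by simp
  qed
  then show ?thesis
    unfolding gderiv_def has_field_derivative_def by (simp add: mult.commute[of _ "huber_slope _ _"])
qed

text \<open>Away from \<open>0\<close> the penalties inherit their differentiability, also at the breakpoints, from the
  Huber function.\<close>

lemma scaled_fsmooth_eq:
  assumes "mu > 0"
  shows "mu * (fsmooth t mu - mu / 2) = (if \<bar>t\<bar> \<le> mu then t\<^sup>2 / 2 else mu * \<bar>t\<bar> - mu\<^sup>2 / 2)"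
proof -
  have "\<bar>t\<bar> * \<bar>t\<bar> = t * t" by simp
  then have "mu * \<bar>t\<bar> = t\<^sup>2" if "\<bar>t\<bar> = mu" using that by (simp add: power2_eq_square)
  then show ?thesis using assms by (cases "\<bar>t\<bar> = mu") (auto simp: fsmooth_def power2_eq_square field_simps)
qed

lemma scaled_huber_slope_eq:
  assumes "mu > 0"
  shows "mu * huber_slope t mu = (if \<bar>t\<bar> \<le> mu then t else mu * sgn t)"
proof -
  consider "t > mu" | "t < - mu" | "\<bar>t\<bar> \<le> mu" by linarith
  then show ?thesis by cases (use assms in \<open>auto simp: huber_slope_eq sgn_if abs_if split: if_splits\<close>)
qed

section \<open>MCP and SCAD as combinations of Huber functions and as finite families of
  quadratics\<close>

lemma mcp_eq_huber:
  assumes "lam > 0" "gam \<ge> 1"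
  shows "mcp lam gam t = lam * \<bar>t\<bar> - lam * (fsmooth t (gam * lam) - gam * lam / 2)"
proof -
  have "lam * (fsmooth t (gam * lam) - gam * lam / 2) = gam * lam * (fsmooth t (gam * lam) - gam * lam / 2) / gam"
    using assms by simp
  also have "\<dots> = (if \<bar>t\<bar> \<le> gam * lam then t\<^sup>2 / 2 else gam * lam * \<bar>t\<bar> - (gam * lam)\<^sup>2 / 2) / gam"
    using assms by (subst scaled_fsmooth_eq) auto
  finally show ?thesis using assms by (auto simp: mcp_def power2_eq_square field_simps)
qed

text \<open>One Huber function per breakpoint: below \<open>lam\<close> both equal
  \<open>t^2 / 2\<close> after scaling and cancel, beyond \<open>gam * lam\<close> their linear
  parts together cancel \<open>lam * |t|\<close>.\<close>

lemma scad_eq_huber: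
  assumes "lam > 0" "gam \<ge> 2"
  shows "scad lam gam t = lam * \<bar>t\<bar>
    - (gam * lam * (fsmooth t (gam * lam) - gam * lam / 2) - lam * (fsmooth t lam - lam / 2)) / (gam - 1)"
proof -
  have l: "lam \<le> gam * lam" using assms by simp
  have g: "gam - 1 > 0" using assms by simp
  consider "\<bar>t\<bar> \<le> lam" | "lam < \<bar>t\<bar>" "\<bar>t\<bar> \<le> gam * lam" | "\<bar>t\<bar> > gam * lam" by linarith
  then show ?thesis
  proof cases
    case 1
    then have e: "lam * (fsmooth t lam - lam / 2) = t\<^sup>2 / 2"
      using assms by (simp add: scaled_fsmooth_eq)
    have e': "gam * lam * (fsmooth t (gam * lam) - gam * lam / 2) = t\<^sup>2 / 2"
      using assms l 1 order_trans[OF 1 l] by (subst scaled_fsmooth_eq) auto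
    show ?thesis unfolding scad_def e e' using 1 by simp
  next
    case 2
    then have e: "lam * (fsmooth t lam - lam / 2) = lam * \<bar>t\<bar> - lam\<^sup>2 / 2"
      using assms by (simp add: scaled_fsmooth_eq)
    have "gam * lam * (fsmooth t (gam * lam) - gam * lam / 2) = \<bar>t\<bar>\<^sup>2 / 2"
      using assms l 2 by (subst scaled_fsmooth_eq) auto
    then show ?thesis using 2 e g unfolding scad_def
      by (simp add: divide_simps) (simp add: power2_eq_square algebra_simps)
  next
    case 3
    then have nl: "\<not> \<bar>t\<bar> \<le> lam" "\<not> \<bar>t\<bar> \<le> gam * lam" using l by linarith+
    then have e: "lam * (fsmooth t lam - lam / 2) = lam * \<bar>t\<bar> - lam\<^sup>2 / 2"
      using assms by (simp add: scaled_fsmooth_eq)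
    have "gam * lam * (fsmooth t (gam * lam) - gam * lam / 2) = gam * lam * \<bar>t\<bar> - (gam * lam)\<^sup>2 / 2"
      using assms 3 by (subst scaled_fsmooth_eq) auto
    then show ?thesis using nl e g unfolding scad_def
      by (simp add: divide_simps) (simp add: power2_eq_square algebra_simps)
  qed
qed

text \<open>The interface through which the later arguments see \<open>g\<close>, besides weak
  convexity. The triples stand for quadratics with curvature \<open>- q\<close>; the sign of
  \<open>q\<close> is what makes the form \<open>D\<close> of a cell positive semidefinite. The kink
  at 0 is left out, and \<open>g 0 = 0\<close> with \<open>g \<ge> 0\<close> makes 0 a subgradient
  there.\<close>

definition penalty_pieces :: "(real \<Rightarrow> real) \<Rightarrow> (real \<times> real \<times> real) set \<Rightarrow> bool" where
  "penalty_pieces g T \<longleftrightarrow> finite T \<and> (\<forall>(q, h, c)\<in>T. q \<ge> 0) \<and> g 0 = 0 \<and> (\<forall>t. g t \<ge> 0) \<and>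
     (\<forall>t. t \<noteq> 0 \<longrightarrow> (\<exists>(q, h, c)\<in>T. g t = c + h * t - q * t\<^sup>2 / 2 \<and>
                                 (g has_real_derivative h - q * t) (at t)))"

lemma abs_has_real_derivative:
  assumes "t \<noteq> 0"
  shows "(abs has_real_derivative sgn t) (at (t::real))"
proof (cases "t > 0")
  case True
  have "(abs has_real_derivative 1) (at t)"
    by (rule has_field_derivative_transform_within_open[where f = "\<lambda>x. x" and S = "{0<..}"])
      (use True in \<open>auto intro!: derivative_eq_intros\<close>)
  then show ?thesis using True by simp
next
  case False
  have "(abs has_real_derivative -1) (at t)"
    by (rule has_field_derivative_transform_within_open[where f = "\<lambda>x. - x" and S = "{..<0}"])
      (use False assms in \<open>auto intro!: derivative_eq_intros\<close>)
  then show ?thesis using False assms by simp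
qed

lemma mcp_pieces:
  assumes "lam > 0" "gam \<ge> 1"
  shows "\<exists>T. penalty_pieces (mcp lam gam) T"
proof -
  let ?T = "{(1/gam, lam, 0), (1/gam, -lam, 0), (0, 0, gam * lam\<^sup>2 / 2)}"
  have gl: "gam * lam > 0" using assms by simp
  have D: "(mcp lam gam has_real_derivative (lam * sgn t - lam * huber_slope t (gam * lam))) (at t)"
    if "t \<noteq> 0" for t
  proof -
    have e: "mcp lam gam = (\<lambda>t. lam * \<bar>t\<bar> - lam * (fsmooth t (gam * lam) - gam * lam / 2))"
      using mcp_eq_huber[OF assms] by auto
    show ?thesis unfolding e
      by (rule derivative_eq_intros abs_has_real_derivative[OF that] fsmooth_has_real_derivative gl refl | simp)+
  qed
  have nonneg: "mcp lam gam t \<ge> 0" for t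
  proof (cases "\<bar>t\<bar> \<le> gam * lam")
    case True
    have "\<bar>t\<bar> * \<bar>t\<bar> \<le> gam * lam * \<bar>t\<bar>" using True by (intro mult_right_mono) auto
    then have "t\<^sup>2 / (2 * gam) \<le> lam * \<bar>t\<bar> / 2"
      using assms by (simp add: power2_eq_square field_simps)
    moreover have "lam * \<bar>t\<bar> \<ge> 0" using assms by simp
    ultimately show ?thesis using True by (simp add: mcp_def)
  qed (use assms in \<open>simp add: mcp_def\<close>)
  have P: "\<exists>(q, h, c)\<in>?T. mcp lam gam t = c + h * t - q * t\<^sup>2 / 2 \<and>
      (mcp lam gam has_real_derivative h - q * t) (at t)" if t: "t \<noteq> 0" for t
  proof (cases "\<bar>t\<bar> \<le> gam * lam")
    case True
    then have "lam * huber_slope t (gam * lam) = t / gam"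
      using assms scaled_huber_slope_eq[OF gl, of t] by (simp add: field_simps)
    moreover have "mcp lam gam t = lam * sgn t * t - t\<^sup>2 / (2 * gam)"
      using True by (auto simp: mcp_def sgn_if)
    ultimately show ?thesis using D[OF t] t by (cases "t > 0") (auto simp: sgn_if mult.commute)
  next
    case False
    then have "lam * sgn t - lam * huber_slope t (gam * lam) = 0"
      using assms scaled_huber_slope_eq[OF gl, of t] by simp
    then show ?thesis using D[OF t] False by (auto simp: mcp_def)
  qed
  have "penalty_pieces (mcp lam gam) ?T"
    unfolding penalty_pieces_def using P nonneg assms by (auto simp: mcp_def)
  then show ?thesis by blast
qed

lemma scad_pieces:
  assumes "lam > 0" "gam \<ge> 2"
  shows "\<exists>T. penalty_pieces (scad lam gam) T"
proof -
  let ?G = "gam - 1"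
  let ?c = "- (lam\<^sup>2 / (2 * ?G))"
  let ?T = "{(0, lam, 0), (0, -lam, 0), (1/?G, gam*lam/?G, ?c), (1/?G, -(gam*lam/?G), ?c),
    (0, 0, (gam + 1) * lam\<^sup>2 / 2)}"
  have gl: "gam * lam > 0" and l: "lam \<le> gam * lam" and g: "?G > 0" using assms by auto
  have D: "(scad lam gam has_real_derivative (lam * sgn t -
      (gam * lam * huber_slope t (gam * lam) - lam * huber_slope t lam) / ?G)) (at t)"
    if "t \<noteq> 0" for t
  proof -
    have e: "scad lam gam = (\<lambda>t. lam * \<bar>t\<bar>
      - (gam * lam * (fsmooth t (gam * lam) - gam * lam / 2) - lam * (fsmooth t lam - lam / 2)) / (gam - 1))"
      using scad_eq_huber[OF assms] by auto
    show ?thesis unfolding e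
      by (rule derivative_eq_intros abs_has_real_derivative[OF that] fsmooth_has_real_derivative gl assms refl
          | use g in simp)+
  qed
  have lam_slope: "lam * huber_slope t lam = (if \<bar>t\<bar> \<le> lam then t else lam * sgn t)" for t
    using scaled_huber_slope_eq assms by simp
  have glam_slope: "gam * lam * huber_slope t (gam * lam) = (if \<bar>t\<bar> \<le> gam * lam then t else gam * lam * sgn t)" for t
    by (rule scaled_huber_slope_eq[OF gl])
  have mid: "scad lam gam t = ?c + gam * lam / ?G * \<bar>t\<bar> - 1 / ?G * t\<^sup>2 / 2"
    if "lam < \<bar>t\<bar>" "\<bar>t\<bar> \<le> gam * lam" for t
  proof -
    have "- (t\<^sup>2 - 2*gam*lam*\<bar>t\<bar> + lam\<^sup>2) / (2 * G) = - (lam\<^sup>2 / (2 * G)) + gam * lam / G * \<bar>t\<bar> - 1 / G * t\<^sup>2 / 2"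
      if "G > 0" for G :: real using that by (simp add: field_simps)
    from this[OF g] show ?thesis using that by (simp add: scad_def)
  qed
  have nonneg: "scad lam gam t \<ge> 0" for t
  proof -
    consider "\<bar>t\<bar> \<le> lam" | "lam < \<bar>t\<bar>" "\<bar>t\<bar> \<le> gam * lam" | "\<bar>t\<bar> > gam * lam" by linarith
    then show ?thesis
    proof cases
      case 2
      \<comment> \<open>This product bounds \<open>t^2\<close> by
        \<open>(gam + 1) * lam * |t| - gam * lam^2\<close>, which lies below
        \<open>2 * gam * lam * |t| - lam^2\<close> by exactly
        \<open>(gam - 1) * (lam * |t| + lam^2)\<close>.\<close>
      have "(gam * lam - \<bar>t\<bar>) * (\<bar>t\<bar> - lam) \<ge> 0" using 2 by simp
      moreover have "lam * \<bar>t\<bar> \<ge> lam * lam" using 2 assms by (intro mult_left_mono) auto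
      moreover have "gam * lam * \<bar>t\<bar> \<ge> gam * lam * lam" using 2 gl by (intro mult_left_mono) auto
      moreover have "(gam - 1) * (lam * \<bar>t\<bar> + lam * lam) \<ge> 0" using assms by simp
      ultimately have "t\<^sup>2 - 2*gam*lam*\<bar>t\<bar> + lam\<^sup>2 \<le> 0"
        by (simp add: power2_eq_square algebra_simps)
      then show ?thesis using 2 g by (simp add: scad_def divide_nonpos_pos)
    qed (use assms in \<open>auto simp: scad_def\<close>)
  qed
  have P: "\<exists>(q, h, c)\<in>?T. scad lam gam t = c + h * t - q * t\<^sup>2 / 2 \<and>
      (scad lam gam has_real_derivative h - q * t) (at t)" if t: "t \<noteq> 0" for t
  proof -
    consider "\<bar>t\<bar> \<le> lam" | "lam < \<bar>t\<bar>" "\<bar>t\<bar> \<le> gam * lam" | "\<bar>t\<bar> > gam * lam" by linarith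
    then show ?thesis
    proof cases
      case 1
      then have "scad lam gam t = lam * sgn t * t" by (auto simp: scad_def sgn_if)
      moreover have "(scad lam gam has_real_derivative lam * sgn t) (at t)"
        using D[OF t] lam_slope[of t] glam_slope[of t] 1 l by simp
      ultimately show ?thesis using t by (cases "t > 0") (auto simp: sgn_if)
    next
      case 2
      have "lam * s - (t - lam * s) / G = (G + 1) * lam / G * s - 1 / G * t" if "G > 0" for G s :: real
        using that by (simp add: field_simps)
      from this[OF g, of "sgn t"]
      have "lam * sgn t - (t - lam * sgn t) / ?G = gam * lam / ?G * sgn t - 1 / ?G * t" by simp
      then have "(scad lam gam has_real_derivative gam * lam / ?G * sgn t - 1 / ?G * t) (at t)"
        using D[OF t] lam_slope[of t] glam_slope[of t] 2 by simp
      then show ?thesis using t mid[OF 2] by (cases "t > 0") (auto simp: sgn_if)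
    next
      case 3
      have "lam * sgn t - (gam * lam * sgn t - lam * sgn t) / ?G = 0"
        using g by (simp add: field_simps)
      then have "(scad lam gam has_real_derivative 0) (at t)"
        using D[OF t] lam_slope[of t] glam_slope[of t] 3 l by simp
      then show ?thesis using 3 l by (auto simp: scad_def)
    qed
  qed
  have "penalty_pieces (scad lam gam) ?T"
    unfolding penalty_pieces_def using P nonneg assms g by (auto simp: scad_def)
  then show ?thesis by blast
qed

section \<open>The largest Gram eigenvalue\<close>

text \<open>A first-order condition free of derivatives, applied to the maximiser on the sphere and
  to the unpenalised intercept coordinate.\<close>

lemma nonneg_quadratic_linear_coeff:
  fixes a b :: real
  assumes "\<And>t. a * t\<^sup>2 + b * t \<ge> 0"
  shows "b = 0"
proof (rule ccontr)
  assume b: "b \<noteq> 0"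
  define c where "c = \<bar>a\<bar> + 1"
  have c: "c > 0" "a < c" by (auto simp: c_def)
  have "a * (- b / c)\<^sup>2 + b * (- b / c) = b\<^sup>2 / c * (a / c - 1)"
    using c by (simp add: power2_eq_square field_simps)
  moreover have "\<dots> < 0"
    using b c by (intro mult_pos_neg) auto
  ultimately show False using assms[of "- b / c"] by linarith
qed

text \<open>The maximiser of the dual form \<open>\<Sum>(b\<^sub>s \<bullet> u)\<^sup>2\<close> on the unit sphere is an eigenvector of
  \<open>X X\<^sup>T\<close>, and its coefficient vector \<open>(b\<^sub>s \<bullet> u)\<^sub>s\<close> is an eigenvector of the Gram matrix.\<close>
lemma lambda_max_gram_bound:
  fixes b :: "'s \<Rightarrow> 'a::euclidean_space"
  assumes S: "finite S" "S \<noteq> {}"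
  shows "(\<Sum>s\<in>S. (b s \<bullet> z)\<^sup>2) \<le> lambda_max_gram S b * (norm z)\<^sup>2"
proof -
  define E where "E = {e. \<exists>v::'s \<Rightarrow> real. (\<forall>s. s \<notin> S \<longrightarrow> v s = 0) \<and> (\<exists>s\<in>S. v s \<noteq> 0) \<and>
        (\<forall>s\<in>S. (\<Sum>t\<in>S. (b s \<bullet> b t) * v t) = e * v s)}"
  define Q where "Q z = (\<Sum>s\<in>S. (b s \<bullet> z)\<^sup>2)" for z
  \<comment> \<open>\<open>lambda_max_gram\<close> is a \<open>Max\<close>, so a member bounds it
    from below only once the set is known to be finite. Nonzero eigenvalues are transported to the
    operator \<open>\<Sum>s. b s (b s)^T\<close>, whose eigenvectors for distinct eigenvalues are
    orthogonal, and an orthogonal set in a Euclidean space is finite.\<close>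
  have finE: "finite E"
  proof -
    have "\<exists>u. u \<noteq> 0 \<and> (\<Sum>s\<in>S. (b s \<bullet> u) *\<^sub>R b s) = e *\<^sub>R u" if "e \<in> E - {0}" for e
    proof -
      from that obtain v s0 where v: "s0 \<in> S" "v s0 \<noteq> 0"
        "\<And>s. s \<in> S \<Longrightarrow> (\<Sum>t\<in>S. (b s \<bullet> b t) * v t) = e * v s" and e: "e \<noteq> 0"
        unfolding E_def by auto
      define u where "u = (\<Sum>t\<in>S. v t *\<^sub>R b t)"
      have bu: "b s \<bullet> u = e * v s" if "s \<in> S" for s
        using v(3)[OF that] by (simp add: u_def inner_sum_right mult.commute)
      have "u \<noteq> 0" using bu[OF v(1)] v(2) e by auto
      moreover have "(\<Sum>s\<in>S. (b s \<bullet> u) *\<^sub>R b s) = e *\<^sub>R u"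
        using bu by (simp add: u_def scaleR_sum_right)
      ultimately show ?thesis by blast
    qed
    then obtain u where u: "\<And>e. e \<in> E - {0} \<Longrightarrow> u e \<noteq> 0"
      "\<And>e. e \<in> E - {0} \<Longrightarrow> (\<Sum>s\<in>S. (b s \<bullet> u e) *\<^sub>R b s) = e *\<^sub>R u e" by metis
    have orth: "u e \<bullet> u e' = 0" if "e \<in> E - {0}" "e' \<in> E - {0}" "e \<noteq> e'" for e e'
    proof -
      have "e * (u e \<bullet> u e') = (\<Sum>s\<in>S. (b s \<bullet> u e) * (b s \<bullet> u e'))"
        using arg_cong[OF u(2)[OF that(1)], of "\<lambda>x. x \<bullet> u e'"] by (simp add: inner_sum_left)
      also have "\<dots> = (\<Sum>s\<in>S. (b s \<bullet> u e') * (b s \<bullet> u e))" by (simp add: mult.commute)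
      also have "\<dots> = e' * (u e' \<bullet> u e)"
        using arg_cong[OF u(2)[OF that(2)], of "\<lambda>x. x \<bullet> u e"] by (simp add: inner_sum_left)
      also have "\<dots> = e' * (u e \<bullet> u e')" by (simp add: inner_commute)
      finally show ?thesis using that by simp
    qed
    have "pairwise orthogonal (u ` (E - {0}))"
      by (rule pairwiseI) (auto simp: orthogonal_def intro!: orth)
    then have "finite (u ` (E - {0}))" by (rule pairwise_orthogonal_imp_finite)
    moreover have "inj_on u (E - {0})"
      by (rule inj_onI) (metis orth u(1) inner_eq_zero_iff)
    ultimately have "finite (E - {0})" by (rule finite_imageD)
    then show ?thesis by simp
  qed
  have "continuous_on (sphere 0 1) Q" unfolding Q_def by (intro continuous_intros)
  moreover obtain x0 :: 'a where "norm x0 = 1" using vector_choose_size[of 1] by auto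
  then have "sphere (0::'a) 1 \<noteq> {}" by auto
  ultimately obtain u where u: "norm u = 1" "\<And>x. norm x = 1 \<Longrightarrow> Q x \<le> Q u"
    using continuous_attains_sup[OF compact_sphere, of "0::'a" 1 Q] by auto
  define l where "l = Q u"
  have Q_le: "Q x \<le> l * (norm x)\<^sup>2" for x
  proof (cases "x = 0")
    case True then show ?thesis by (simp add: Q_def)
  next
    case False
    have "Q x = (norm x)\<^sup>2 * Q (x /\<^sub>R norm x)"
      using False by (simp add: Q_def sum_distrib_left power_mult_distrib power_inverse field_simps)
    also have "\<dots> \<le> (norm x)\<^sup>2 * l"
      unfolding l_def using False by (intro mult_left_mono u) auto
    finally show ?thesis by (simp add: mult.commute)
  qed
  have lin: "l * (u \<bullet> x) = (\<Sum>s\<in>S. (b s \<bullet> u) * (b s \<bullet> x))" for x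
  proof -
    \<comment> \<open>Stationarity of the maximiser: \<open>Q_le\<close> at
      \<open>u + t *\<^sub>R x\<close> is a quadratic in \<open>t\<close> without constant term, so
      its linear coefficient vanishes.\<close>
    have "(l * (norm x)\<^sup>2 - Q x) * t\<^sup>2 + 2 * (l * (u \<bullet> x) - (\<Sum>s\<in>S. (b s \<bullet> u) * (b s \<bullet> x))) * t \<ge> 0" for t
    proof -
      have "(norm (u + t *\<^sub>R x))\<^sup>2 = 1 + 2 * t * (u \<bullet> x) + t\<^sup>2 * (norm x)\<^sup>2"
      proof -
        have "u \<bullet> u = 1" using u(1) by (simp add: norm_eq_1)
        then show ?thesis unfolding power2_norm_eq_inner
          by (simp add: inner_add_left inner_add_right inner_commute power2_eq_square algebra_simps)
      qed
      moreover have "Q (u + t *\<^sub>R x) = l + 2 * t * (\<Sum>s\<in>S. (b s \<bullet> u) * (b s \<bullet> x)) + t\<^sup>2 * Q x"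
        unfolding Q_def l_def
        by (simp add: inner_add_right power2_eq_square algebra_simps sum.distrib sum_distrib_left)
      ultimately show ?thesis using Q_le[of "u + t *\<^sub>R x"] by (simp add: algebra_simps)
    qed
    then have "2 * (l * (u \<bullet> x) - (\<Sum>s\<in>S. (b s \<bullet> u) * (b s \<bullet> x))) = 0"
      by (rule nonneg_quadratic_linear_coeff)
    then show ?thesis by simp
  qed
  have "l \<in> E"
  proof (cases "l = 0")
    \<comment> \<open>The coefficient vector of \<open>u\<close> is zero here and cannot serve as an
      eigenvector. But then every \<open>b s\<close> is orthogonal to everything, the Gram matrix is
      zero, and any indicator vector is an eigenvector for 0.\<close>
    case True
    have "b s \<bullet> x = 0" if "s \<in> S" for s x
    proof -
      have "Q x = 0" using Q_le[of x] True by (simp add: Q_def sum_nonneg order_antisym)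
      then show ?thesis using S that by (simp add: Q_def sum_nonneg_eq_0_iff)
    qed
    moreover obtain s0 where "s0 \<in> S" using S by auto
    ultimately show ?thesis unfolding E_def True
      by (auto intro!: exI[of _ "\<lambda>s. if s = s0 then 1 else 0"] sum.neutral)
  next
    case False
    define v where "v s = (if s \<in> S then b s \<bullet> u else 0)" for s
    have "\<exists>s\<in>S. v s \<noteq> 0"
    proof (rule ccontr)
      assume "\<not> ?thesis"
      then have "Q u = 0" by (auto simp: Q_def v_def)
      then show False using False l_def by simp
    qed
    moreover have "(\<Sum>t\<in>S. (b s \<bullet> b t) * v t) = l * v s" if "s \<in> S" for s
      using lin[of "b s"] that by (simp add: v_def inner_commute mult.commute)
    ultimately show ?thesis unfolding E_def by (auto intro!: exI[of _ v] simp: v_def)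
  qed
  then have "l \<le> lambda_max_gram S b"
    unfolding lambda_max_gram_def using finE unfolding E_def by (rule Max_ge[rotated])
  then show ?thesis using Q_le[of z] unfolding Q_def
    by (meson mult_right_mono order_trans zero_le_power2)
qed

text \<open>An operator and its adjoint have the same norm: pair the combination \<open>z\<close>
  with itself, apply Cauchy-Schwarz to the coefficients, and cancel one factor
  \<open>(norm z)^2\<close>.\<close>

lemma gram_bound_dual:
  fixes b :: "'s \<Rightarrow> 'a::real_inner"
  assumes "\<And>z. (\<Sum>s\<in>S. (b s \<bullet> z)\<^sup>2) \<le> l * (norm z)\<^sup>2" "l \<ge> 0"
  shows "(norm (\<Sum>s\<in>S. t s *\<^sub>R b s))\<^sup>2 \<le> l * (\<Sum>s\<in>S. (t s)\<^sup>2)"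
proof -
  define z where "z = (\<Sum>s\<in>S. t s *\<^sub>R b s)"
  have "(norm z)\<^sup>2 = (\<Sum>s\<in>S. t s * (b s \<bullet> z))"
    by (subst power2_norm_eq_inner, subst (1) z_def) (simp add: inner_sum_left)
  then have "((norm z)\<^sup>2)\<^sup>2 \<le> (\<Sum>s\<in>S. (t s)\<^sup>2) * (\<Sum>s\<in>S. (b s \<bullet> z)\<^sup>2)"
    by (metis Cauchy_Schwarz_ineq_sum)
  also have "\<dots> \<le> (\<Sum>s\<in>S. (t s)\<^sup>2) * (l * (norm z)\<^sup>2)"
    by (intro mult_left_mono assms sum_nonneg) auto
  finally have A: "(norm z)\<^sup>2 * (norm z)\<^sup>2 \<le> (norm z)\<^sup>2 * (l * (\<Sum>s\<in>S. (t s)\<^sup>2))"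
    by (simp add: power2_eq_square mult_ac)
  show ?thesis
  proof (cases "z = 0")
    case True
    then show ?thesis using assms(2) unfolding z_def by (simp add: sum_nonneg)
  next
    case False
    then have "(norm z)\<^sup>2 > 0" by simp
    with A have "(norm z)\<^sup>2 \<le> l * (\<Sum>s\<in>S. (t s)\<^sup>2)" by (rule mult_left_le_imp_le)
    then show ?thesis unfolding z_def .
  qed
qed

section \<open>Rational functions near zero\<close>

text \<open>A germ at \<open>0+\<close>, since only small \<open>mu\<close> matters. In the
  multiplied-out form poles need no care, and with \<open>inverse 0 = 0\<close> the class is closed
  under inverses even when the function vanishes identically.\<close>

definition ratfun :: "(real \<Rightarrow> real) \<Rightarrow> bool" where
  "ratfun f \<longleftrightarrow> (\<exists>p q. q \<noteq> 0 \<and> (\<forall>\<^sub>F x in at_right 0. f x * poly q x = poly p x))"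

lemma poly_split_at_0:
  fixes p :: "real poly"
  assumes "p \<noteq> 0"
  obtains k q where "poly q 0 \<noteq> 0" "\<And>x. poly p x = x ^ k * poly q x"
proof -
  obtain q where q: "p = [:- 0, 1:] ^ order 0 p * q" "\<not> [:- 0, 1:] dvd q"
    using order_decomp[OF assms] by blast
  have "poly q 0 \<noteq> 0" using q(2) poly_eq_0_iff_dvd[of q 0] by blast
  moreover have "poly p x = x ^ order 0 p * poly q x" for x
    by (subst q(1)) simp
  ultimately show ?thesis using that by blast
qed

lemma poly_tendsto_at_right_0: "((\<lambda>x. poly p x) \<longlongrightarrow> poly p 0) (at_right (0::real))"
  by (metis isCont_def order.refl poly_isCont tendsto_within_subset top_greatest)

lemma eventually_poly_neq_0:
  fixes q :: "real poly"
  assumes "q \<noteq> 0"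
  shows "\<forall>\<^sub>F x in at_right 0. poly q x \<noteq> 0"
proof -
  obtain k r where r: "poly r 0 \<noteq> 0" "\<And>x. poly q x = x ^ k * poly r x"
    using poly_split_at_0[OF assms] by blast
  have "\<forall>\<^sub>F x in at_right 0. poly r x \<noteq> 0"
    using tendsto_imp_eventually_ne[OF poly_tendsto_at_right_0 r(1)] .
  moreover have "\<forall>\<^sub>F x in at_right (0::real). x > 0" by (rule eventually_at_right_less)
  ultimately show ?thesis by eventually_elim (simp add: r(2))
qed

lemma ratfun_cong:
  assumes "ratfun f" "\<forall>\<^sub>F x in at_right 0. g x = f x"
  shows "ratfun g"
proof -
  obtain p q where pq: "q \<noteq> 0" "\<forall>\<^sub>F x in at_right 0. f x * poly q x = poly p x"
    using assms(1) unfolding ratfun_def by blast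
  have "\<forall>\<^sub>F x in at_right 0. g x * poly q x = poly p x"
    using pq(2) assms(2) by eventually_elim simp
  then show ?thesis unfolding ratfun_def using pq(1) by blast
qed

lemma ratfun_poly: "ratfun (poly p)"
  unfolding ratfun_def by (rule exI[of _ p], rule exI[of _ 1]) simp

lemma ratfun_const: "ratfun (\<lambda>_. c)"
  by (rule ratfun_cong[OF ratfun_poly[of "[:c:]"]]) simp

lemma ratfun_id: "ratfun (\<lambda>x. x)"
  by (rule ratfun_cong[OF ratfun_poly[of "[:0, 1:]"]]) simp

lemma ratfun_add:
  assumes "ratfun f" "ratfun g"
  shows "ratfun (\<lambda>x. f x + g x)"
proof -
  obtain p q where pq: "q \<noteq> 0" "\<forall>\<^sub>F x in at_right 0. f x * poly q x = poly p x"
    using assms(1) unfolding ratfun_def by blast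
  obtain p' q' where pq': "q' \<noteq> 0" "\<forall>\<^sub>F x in at_right 0. g x * poly q' x = poly p' x"
    using assms(2) unfolding ratfun_def by blast
  have "\<forall>\<^sub>F x in at_right 0. (f x + g x) * poly (q * q') x = poly (p * q' + p' * q) x"
    using pq(2) pq'(2) by eventually_elim (simp add: algebra_simps)
  moreover have "q * q' \<noteq> 0" using pq(1) pq'(1) by simp
  ultimately show ?thesis unfolding ratfun_def by blast
qed

lemma ratfun_mult:
  assumes "ratfun f" "ratfun g"
  shows "ratfun (\<lambda>x. f x * g x)"
proof -
  obtain p q where pq: "q \<noteq> 0" "\<forall>\<^sub>F x in at_right 0. f x * poly q x = poly p x"
    using assms(1) unfolding ratfun_def by blast
  obtain p' q' where pq': "q' \<noteq> 0" "\<forall>\<^sub>F x in at_right 0. g x * poly q' x = poly p' x"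
    using assms(2) unfolding ratfun_def by blast
  have "\<forall>\<^sub>F x in at_right 0. (f x * g x) * poly (q * q') x = poly (p * p') x"
    using pq(2) pq'(2)
  proof eventually_elim
    case (elim x)
    then show ?case by (simp flip: elim)
  qed
  moreover have "q * q' \<noteq> 0" using pq(1) pq'(1) by simp
  ultimately show ?thesis unfolding ratfun_def by blast
qed

lemma ratfun_inverse:
  assumes "ratfun f"
  shows "ratfun (\<lambda>x. inverse (f x))"
proof -
  obtain p q where pq: "q \<noteq> 0" "\<forall>\<^sub>F x in at_right 0. f x * poly q x = poly p x"
    using assms unfolding ratfun_def by blast
  have nz: "\<forall>\<^sub>F x in at_right 0. poly q x \<noteq> 0" by (rule eventually_poly_neq_0[OF pq(1)])
  show ?thesis
  proof (cases "p = 0")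
    case True
    have "\<forall>\<^sub>F x in at_right 0. inverse (f x) = 0"
      using pq(2) nz by eventually_elim (simp add: True)
    then show ?thesis by (rule ratfun_cong[OF ratfun_const])
  next
    case False
    then have "\<forall>\<^sub>F x in at_right 0. poly p x \<noteq> 0" by (rule eventually_poly_neq_0)
    then have "\<forall>\<^sub>F x in at_right 0. inverse (f x) * poly p x = poly q x"
      using pq(2)
    proof eventually_elim
      case (elim x)
      then have "f x \<noteq> 0" by auto
      then show ?case unfolding elim(2)[symmetric] by simp
    qed
    then show ?thesis using False unfolding ratfun_def by blast
  qed
qed

lemma ratfun_divide: "ratfun f \<Longrightarrow> ratfun g \<Longrightarrow> ratfun (\<lambda>x. f x / g x)"
  unfolding divide_inverse by (intro ratfun_mult ratfun_inverse)

lemma ratfun_minus: "ratfun f \<Longrightarrow> ratfun (\<lambda>x. - f x)"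
  using ratfun_mult[OF ratfun_const[of "-1"]] by simp

lemma ratfun_diff: "ratfun f \<Longrightarrow> ratfun g \<Longrightarrow> ratfun (\<lambda>x. f x - g x)"
  using ratfun_add[OF _ ratfun_minus, of f g] by simp

lemma ratfun_sum: "(\<And>i. i \<in> I \<Longrightarrow> ratfun (f i)) \<Longrightarrow> ratfun (\<lambda>x. \<Sum>i\<in>I. f i x)"
  by (induction I rule: infinite_finite_induct) (auto intro: ratfun_const ratfun_add)

lemma ratfun_prod: "(\<And>i. i \<in> I \<Longrightarrow> ratfun (f i)) \<Longrightarrow> ratfun (\<lambda>x. \<Prod>i\<in>I. f i x)"
  by (induction I rule: infinite_finite_induct) (auto intro: ratfun_const ratfun_mult)

lemma ratfun_power: "ratfun f \<Longrightarrow> ratfun (\<lambda>x. f x ^ n)"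
  by (induction n) (auto intro: ratfun_const ratfun_mult)

lemmas ratfun_intros = ratfun_const ratfun_id ratfun_add ratfun_mult ratfun_inverse ratfun_divide
  ratfun_minus ratfun_diff ratfun_sum ratfun_prod ratfun_power

lemma ratfun_normal_form:
  assumes "ratfun f"
  obtains "\<forall>\<^sub>F x in at_right 0. f x = 0"
    | i j p q where "poly p 0 \<noteq> 0" "poly q 0 \<noteq> 0"
        "\<forall>\<^sub>F x in at_right 0. f x = x ^ i * poly p x / (x ^ j * poly q x)"
proof -
  obtain p q where pq: "q \<noteq> 0" "\<forall>\<^sub>F x in at_right 0. f x * poly q x = poly p x"
    using assms unfolding ratfun_def by blast
  have nz: "\<forall>\<^sub>F x in at_right 0. poly q x \<noteq> 0" by (rule eventually_poly_neq_0[OF pq(1)])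
  show ?thesis
  proof (cases "p = 0")
    case True
    have "\<forall>\<^sub>F x in at_right 0. f x = 0"
      using pq(2) nz by eventually_elim (simp add: True)
    then show ?thesis by (rule that(1))
  next
    case False
    obtain i p' where p: "poly p' 0 \<noteq> 0" "\<And>x. poly p x = x ^ i * poly p' x"
      using poly_split_at_0[OF False] by blast
    obtain j q' where q: "poly q' 0 \<noteq> 0" "\<And>x. poly q x = x ^ j * poly q' x"
      using poly_split_at_0[OF pq(1)] by blast
    have "\<forall>\<^sub>F x in at_right 0. f x = x ^ i * poly p' x / (x ^ j * poly q' x)"
      using pq(2) nz by eventually_elim (simp add: p(2) q(2) eq_divide_eq)
    then show ?thesis by (rule that(2)[OF p(1) q(1)])
  qed
qed

text \<open>A rational germ has a pole at 0 or extends smoothly across it. A level with a pole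
  escapes from the bounded objective values; any other level drifts no faster than a constant times
  the change of \<open>mu\<close>.\<close>

lemma ratfun_lipschitz_or_unbounded:
  assumes "ratfun f"
  shows "filterlim (\<lambda>x. \<bar>f x\<bar>) at_top (at_right 0) \<or>
    (\<exists>C e. e > 0 \<and> (\<forall>x\<in>{0<..<e}. \<forall>y\<in>{0<..<e}. \<bar>f x - f y\<bar> \<le> C * \<bar>x - y\<bar>))"
  using assms
proof (cases rule: ratfun_normal_form)
  case 1
  then obtain e where "e > 0" "\<And>x. 0 < x \<Longrightarrow> x < e \<Longrightarrow> f x = 0"
    unfolding eventually_at_right_field by blast
  then show ?thesis by (intro disjI2 exI[of _ 0] exI[of _ e]) auto
next
  case (2 i j p q)
  show ?thesis
  proof (cases "i < j")
    case True
    have L: "((\<lambda>x. \<bar>poly p x / poly q x\<bar>) \<longlongrightarrow> \<bar>poly p 0 / poly q 0\<bar>) (at_right 0)"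
      using 2 by (intro tendsto_intros poly_tendsto_at_right_0) auto
    have "filterlim (\<lambda>x::real. x ^ (j - i)) (at_right 0) (at_right 0)"
      unfolding filterlim_at
    proof
      have "((\<lambda>x::real. x ^ (j - i)) \<longlongrightarrow> 0 ^ (j - i)) (at_right 0)" by (intro tendsto_intros)
      then show "((\<lambda>x::real. x ^ (j - i)) \<longlongrightarrow> 0) (at_right 0)" using True by simp
      show "\<forall>\<^sub>F x::real in at_right 0. x ^ (j - i) \<in> {0<..} \<and> x ^ (j - i) \<noteq> 0"
        using eventually_at_right_less[of "0::real"] by eventually_elim auto
    qed
    then have "filterlim (\<lambda>x::real. inverse (x ^ (j - i))) at_top (at_right 0)"
      by (rule filterlim_compose[OF filterlim_inverse_at_top_right])
    then have "filterlim (\<lambda>x. \<bar>poly p x / poly q x\<bar> * inverse (x ^ (j - i))) at_top (at_right 0)"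
      using 2 by (intro filterlim_tendsto_pos_mult_at_top[OF L]) auto
    moreover have "\<forall>\<^sub>F x in at_right 0. \<bar>poly p x / poly q x\<bar> * inverse (x ^ (j - i)) = \<bar>f x\<bar>"
      using 2(3) eventually_at_right_less[of "0::real"]
    proof eventually_elim
      case (elim x)
      have "x ^ j = x ^ (j - i) * x ^ i" using True by (simp flip: power_add)
      then have "f x = poly p x / poly q x * inverse (x ^ (j - i))"
        using elim by (simp add: field_simps)
      then show ?case using elim(2) by (simp add: abs_mult power_abs)
    qed
    ultimately show ?thesis by (auto elim: filterlim_mono_eventually)
  next
    case False
    \<comment> \<open>Without a pole the surplus power of \<open>x\<close> joins the numerator; the
      quotient is then smooth up to and including 0, and its derivative is bounded on a compact
      interval.\<close>
    define P where "P = monom 1 (i - j) * p"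
    have "\<forall>\<^sub>F x in at_right 0. f x = poly P x / poly q x"
      using 2(3) eventually_at_right_less[of "0::real"]
    proof eventually_elim
      case (elim x)
      have "x ^ i = x ^ (i - j) * x ^ j" using False by (simp flip: power_add)
      then show ?case using elim by (simp add: P_def poly_monom)
    qed
    then obtain e1 where e1: "e1 > 0" "\<And>x. 0 < x \<Longrightarrow> x < e1 \<Longrightarrow> f x = poly P x / poly q x"
      unfolding eventually_at_right_field by blast
    have "poly q \<midarrow>0\<rightarrow> poly q 0" by (rule isContD[OF poly_isCont])
    then have "\<forall>\<^sub>F x in at 0. poly q x \<noteq> 0" by (rule tendsto_imp_eventually_ne[OF _ 2(2)])
    then obtain e2 where e2: "e2 > 0" "\<And>x. x \<noteq> 0 \<Longrightarrow> \<bar>x\<bar> < e2 \<Longrightarrow> poly q x \<noteq> 0"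
      unfolding eventually_at by (auto simp: dist_real_def)
    \<comment> \<open>Half of \<open>e2\<close>, so that the denominator has no zero on the closed
      interval.\<close>
    define e where "e = min e1 (e2 / 2)"
    define D where "D x = (poly (pderiv P) x * poly q x - poly P x * poly (pderiv q) x) / (poly q x * poly q x)" for x
    have nz: "poly q x \<noteq> 0" if "x \<in> {0..e}" for x using that e2 2(2) by (cases "x = 0") (auto simp: e_def)
    have "continuous_on {0..e} D" unfolding D_def using nz by (intro continuous_intros) auto
    then have "bounded (D ` {0..e})"
      by (intro compact_imp_bounded compact_continuous_image) auto
    then obtain B where B: "\<forall>x\<in>{0..e}. \<bar>D x\<bar> \<le> B" unfolding bounded_iff by auto
    have "\<bar>poly P x / poly q x - poly P y / poly q y\<bar> \<le> B * \<bar>x - y\<bar>" if "x \<in> {0..e}" "y \<in> {0..e}" for x y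
    proof -
      have "norm (poly P x / poly q x - poly P y / poly q y) \<le> B * norm (x - y)"
        by (rule field_differentiable_bound[of "{0..e}" _ D])
          (use nz B that in \<open>auto simp: D_def intro!: derivative_eq_intros\<close>)
      then show ?thesis by simp
    qed
    moreover have "e > 0" using e1 e2 by (auto simp: e_def)
    ultimately show ?thesis
      using e1(2) by (intro disjI2 exI[of _ B] exI[of _ e]) (auto simp: e_def)
  qed
qed

text \<open>A nonzero rational germ is asymptotic to \<open>L * x^a\<close> with an integer
  \<open>a\<close> and \<open>L \<noteq> 0\<close>, so the weighted sequence behaves like a nonzero
  multiple of a power of \<open>k\<close>: it tends to 0 or stays away from it. For a general
  function of \<open>mu\<close> two levels could approach and separate infinitely often at the
  critical scale.\<close>

lemma ratfun_along_power_sequence: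
  assumes f: "ratfun f" and beta: "beta > 0" and d: "d > 0"
  defines "x \<equiv> \<lambda>k::nat. beta / (real k + 1) powr d"
  shows "(\<lambda>k. (real k + 1) powr s * f (x k)) \<longlonglongrightarrow> 0 \<or>
    (\<exists>g>0. \<forall>\<^sub>F k in sequentially. g \<le> (real k + 1) powr s * \<bar>f (x k)\<bar>)"
proof -
  have x_lim: "filterlim x (at_right 0) sequentially"
    unfolding filterlim_at
  proof
    have "(\<lambda>k. beta * (real (Suc k)) powr (- d)) \<longlonglongrightarrow> beta * 0"
      using d by (intro tendsto_mult tendsto_const LIMSEQ_Suc[OF tendsto_neg_powr]
          filterlim_real_sequentially) auto
    then show "x \<longlonglongrightarrow> 0"
      by (simp add: x_def powr_minus divide_inverse add.commute)
    show "\<forall>\<^sub>F k in sequentially. x k \<in> {0<..} \<and> x k \<noteq> 0"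
      using beta by (auto simp: x_def)
  qed
  show ?thesis using f
  proof (cases rule: ratfun_normal_form)
    case 1
    then have "\<forall>\<^sub>F k in sequentially. f (x k) = 0"
      by (rule eventually_compose_filterlim[OF _ x_lim])
    then have "\<forall>\<^sub>F k in sequentially. (real k + 1) powr s * f (x k) = 0"
      by eventually_elim simp
    then show ?thesis by (intro disjI1 tendsto_eventually)
  next
    case (2 i j p q)
    define a where "a = real i - real j"
    define e where "e = s - d * a"
    define L where "L = poly p 0 / poly q 0"
    have "((\<lambda>x. poly p x / poly q x) \<longlongrightarrow> L) (at_right 0)"
      unfolding L_def using 2 by (intro tendsto_intros poly_tendsto_at_right_0) auto
    then have L: "(\<lambda>k. poly p (x k) / poly q (x k)) \<longlonglongrightarrow> L"
      by (rule filterlim_compose[OF _ x_lim])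
    have L0: "L \<noteq> 0" using 2 by (simp add: L_def)
    have eq: "\<forall>\<^sub>F k in sequentially. (real k + 1) powr s * f (x k) =
        beta powr a * ((real k + 1) powr e * (poly p (x k) / poly q (x k)))"
      using eventually_compose_filterlim[OF 2(3) x_lim]
    proof eventually_elim
      case (elim k)
      let ?K = "real k + 1"
      have x0: "x k > 0" using beta by (simp add: x_def)
      have "x k ^ i / x k ^ j = x k powr a"
        using x0 by (simp add: a_def powr_diff powr_realpow)
      also have "x k powr a = (beta * ?K powr (- d)) powr a"
        by (simp add: x_def powr_minus divide_inverse)
      also have "(beta * ?K powr (- d)) powr a = beta powr a * ?K powr (- (d * a))"
        using beta by (simp add: powr_mult powr_powr)
      finally have xa: "x k ^ i / x k ^ j = beta powr a * ?K powr (- (d * a))" .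
      have "f (x k) = (x k ^ i / x k ^ j) * (poly p (x k) / poly q (x k))"
        using elim by simp
      then have "?K powr s * f (x k) = beta powr a * ((?K powr s * ?K powr (- (d * a))) * (poly p (x k) / poly q (x k)))"
        unfolding xa by (simp only: mult_ac)
      then show ?case by (simp add: e_def flip: powr_add)
    qed
    show ?thesis
    proof (cases "e < 0")
      case True
      then have "(\<lambda>k. real (Suc k) powr e) \<longlonglongrightarrow> 0"
        by (intro LIMSEQ_Suc[OF tendsto_neg_powr] filterlim_real_sequentially) auto
      then have "(\<lambda>k. (real k + 1) powr e) \<longlonglongrightarrow> 0" by (simp add: add.commute)
      then have "(\<lambda>k. beta powr a * ((real k + 1) powr e * (poly p (x k) / poly q (x k)))) \<longlonglongrightarrow> beta powr a * (0 * L)"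
        by (intro tendsto_intros L)
      then have "(\<lambda>k. (real k + 1) powr s * f (x k)) \<longlonglongrightarrow> 0"
        using eq by (simp add: tendsto_cong)
      then show ?thesis ..
    next
      case False
      have "\<forall>\<^sub>F k in sequentially. \<bar>L\<bar> / 2 < \<bar>poly p (x k) / poly q (x k)\<bar>"
        using L0 by (intro order_tendstoD(1)[OF tendsto_rabs[OF L]]) simp
      then have "\<forall>\<^sub>F k in sequentially. beta powr a * (\<bar>L\<bar> / 2) \<le> (real k + 1) powr s * \<bar>f (x k)\<bar>"
        using eq
      proof eventually_elim
        case (elim k)
        let ?K = "real k + 1"
        have "(real k + 1) powr s * \<bar>f (x k)\<bar> = \<bar>(real k + 1) powr s * f (x k)\<bar>"
          by (simp add: abs_mult)
        also have "\<dots> = beta powr a * (?K powr e * \<bar>poly p (x k) / poly q (x k)\<bar>)"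
          unfolding elim(2) by (simp add: abs_mult)
        also have "\<dots> \<ge> beta powr a * (1 * (\<bar>L\<bar> / 2))"
          using elim(1) False by (intro mult_left_mono mult_mono ge_one_powr_ge_zero) auto
        finally show ?case by simp
      qed
      moreover have "beta powr a * (\<bar>L\<bar> / 2) > 0" using beta L0 by simp
      ultimately show ?thesis by blast
    qed
  qed
qed

section \<open>Critical values of quadratic families\<close>

text \<open>A sequence of almost-kernel unit vectors would converge, along a subsequence with
  \<open>mu \<rightarrow> 0\<close>, to a unit vector annihilated by both forms.\<close>
lemma singular_pencil_bounded_below:
  fixes P D :: "'a::euclidean_space \<Rightarrow> 'a"
  assumes P: "linear P" "\<And>x y. P x \<bullet> y = x \<bullet> P y"
    and D: "linear D" "\<And>x. P x = 0 \<Longrightarrow> x \<bullet> D x = 0 \<Longrightarrow> x = 0"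
  shows "\<exists>c>0. \<exists>m>0. \<forall>mu\<in>{0<..<m}. \<forall>x. c * norm x \<le> norm (P x /\<^sub>R (2 * mu) - D x)"
proof (rule ccontr)
  assume contra: "\<not> ?thesis"
  have "\<exists>mu x. 0 < mu \<and> mu < inverse (real (Suc k)) \<and> norm x = 1 \<and>
      norm (P x /\<^sub>R (2 * mu) - D x) < inverse (real (Suc k))" for k
  proof -
    let ?e = "inverse (real (Suc k))"
    have "?e > 0" by simp
    then have "\<not> (\<forall>mu\<in>{0<..<?e}. \<forall>x. ?e * norm x \<le> norm (P x /\<^sub>R (2 * mu) - D x))"
      using contra by blast
    then obtain mu x where mu: "mu \<in> {0<..<?e}" and x: "norm (P x /\<^sub>R (2 * mu) - D x) < ?e * norm x"
      by (auto simp: not_le)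
    have "x \<noteq> 0" using x linear_0[OF P(1)] linear_0[OF D(1)] by auto
    then have n: "norm x > 0" by simp
    let ?u = "x /\<^sub>R norm x"
    have "P ?u /\<^sub>R (2 * mu) - D ?u = (P x /\<^sub>R (2 * mu) - D x) /\<^sub>R norm x"
      by (simp add: linear_cmul[OF P(1)] linear_cmul[OF D(1)] scaleR_diff_right)
    moreover have "norm (v /\<^sub>R norm x) = norm v / norm x" for v :: 'a
      by (simp add: divide_inverse mult.commute)
    ultimately have "norm (P ?u /\<^sub>R (2 * mu) - D ?u) = norm (P x /\<^sub>R (2 * mu) - D x) / norm x"
      by (simp only:)
    also have "\<dots> < ?e" using x n by (simp add: pos_divide_less_eq)
    finally show ?thesis using mu n by (intro exI[of _ mu] exI[of _ ?u]) auto
  qed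
  then obtain mu x where mx: "\<And>k::nat. 0 < mu k" "\<And>k. mu k < inverse (real (Suc k))" "\<And>k. norm (x k) = 1"
      "\<And>k. norm (P (x k) /\<^sub>R (2 * mu k) - D (x k)) < inverse (real (Suc k))" by metis
  define e where "e k = P (x k) /\<^sub>R (2 * mu k) - D (x k)" for k
  have "e \<longlonglongrightarrow> 0"
    by (rule Lim_null_comparison[OF _ LIMSEQ_inverse_real_of_nat])
      (use mx(4) in \<open>auto simp: e_def intro!: always_eventually less_imp_le\<close>)
  moreover have "mu \<longlonglongrightarrow> 0"
    by (rule Lim_null_comparison[OF _ LIMSEQ_inverse_real_of_nat])
      (use mx(1,2) in \<open>auto simp: abs_of_pos intro!: always_eventually less_imp_le\<close>)
  moreover obtain l r where l: "l \<in> sphere 0 1" and r: "strict_mono r" and xr: "(x \<circ> r) \<longlonglongrightarrow> l"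
    using compact_sphere[of "0::'a" 1, unfolded compact_def, rule_format, of x] mx(3) by auto
  ultimately have er: "(e \<circ> r) \<longlonglongrightarrow> 0" and mr: "(mu \<circ> r) \<longlonglongrightarrow> 0"
    using LIMSEQ_subseq_LIMSEQ by blast+
  note bP = P(1)[unfolded linear_conv_bounded_linear] and bD = D(1)[unfolded linear_conv_bounded_linear]
  have Pl: "(\<lambda>k. P ((x \<circ> r) k)) \<longlonglongrightarrow> P l" by (rule bounded_linear.tendsto[OF bP xr])
  have Dl: "(\<lambda>k. D ((x \<circ> r) k)) \<longlonglongrightarrow> D l" by (rule bounded_linear.tendsto[OF bD xr])
  have "P ((x \<circ> r) k) = (2 * (mu \<circ> r) k) *\<^sub>R ((e \<circ> r) k + D ((x \<circ> r) k))" for k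
    using mx(1)[of "r k"] by (simp add: e_def)
  moreover have "(\<lambda>k. (2 * (mu \<circ> r) k) *\<^sub>R ((e \<circ> r) k + D ((x \<circ> r) k))) \<longlonglongrightarrow> (2 * 0) *\<^sub>R (0 + D l)"
    by (intro tendsto_intros mr er Dl)
  ultimately have "(\<lambda>k. P ((x \<circ> r) k)) \<longlonglongrightarrow> 0" by simp
  then have P0: "P l = 0" using Pl LIMSEQ_unique by blast
  \<comment> \<open>Pairing with the limit \<open>l\<close> in the kernel of the symmetric
    \<open>P\<close> removes the term with the unbounded factor \<open>1 / (2 * mu)\<close>.\<close>
  have "l \<bullet> (e \<circ> r) k = - (l \<bullet> D ((x \<circ> r) k))" for k
    using P(2)[of l "x (r k)"] P0 by (simp add: e_def inner_diff_right)
  moreover have "(\<lambda>k. l \<bullet> (e \<circ> r) k) \<longlonglongrightarrow> l \<bullet> 0" by (intro tendsto_intros er)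
  moreover have "(\<lambda>k. - (l \<bullet> D ((x \<circ> r) k))) \<longlonglongrightarrow> - (l \<bullet> D l)" by (intro tendsto_intros Dl)
  ultimately have "l \<bullet> D l = 0" using LIMSEQ_unique by fastforce
  then have "l = 0" using D(2)[OF P0] by simp
  then show False using l by simp
qed

lemma ratfun_det:
  fixes A :: "real \<Rightarrow> real^'n^'n"
  assumes "\<And>i j. ratfun (\<lambda>m. A m $ i $ j)"
  shows "ratfun (\<lambda>m. det (A m))"
  unfolding det_def by (intro ratfun_intros assms)

text \<open>A quadratic family that either has no critical point, and then a gradient bounded away from
  \<open>0\<close>, or has a rational critical value at which the \<open>1/2\<close>-Kurdyka--Lojasiewicz inequality holds
  with constants independent of \<open>mu\<close>. Neither the critical point nor the inequality refers to the
  cell on which the quadratic coincides with the objective.\<close>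
lemma quadratic_KL:
  fixes b :: "'i \<Rightarrow> real^'n" and q :: "'n \<Rightarrow> real" and h :: "real^'n" and y :: "'i \<Rightarrow> real"
    and A :: "'i set" and c0 c1 :: real
  assumes q: "\<And>p. q p \<ge> 0"
  defines "Psi \<equiv> \<lambda>mu x. (\<Sum>i\<in>A. (y i - b i \<bullet> x)\<^sup>2) / (4 * mu) - (\<Sum>p\<in>UNIV. q p * (x $ p)\<^sup>2) / 2
      + h \<bullet> x + c0 + c1 * mu"
    and "dPsi \<equiv> \<lambda>mu x. h - (\<Sum>i\<in>A. (y i - b i \<bullet> x) *\<^sub>R b i) /\<^sub>R (2 * mu) - (\<chi> p. q p * x $ p)"
  shows "\<exists>v C g m. ratfun v \<and> g > 0 \<and> m > 0 \<and>
    (\<forall>mu\<in>{0<..<m}. \<forall>x. norm (dPsi mu x) < g \<longrightarrow> \<bar>Psi mu x - v mu\<bar> \<le> C * (norm (dPsi mu x))\<^sup>2)"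
proof -
  define P where "P x = (\<Sum>i\<in>A. (b i \<bullet> x) *\<^sub>R b i)" for x
  define D where "D x = (\<chi> p. q p * x $ p)" for x :: "real^'n"
  \<comment> \<open>By symmetry this is the common kernel of \<open>P\<close> and \<open>D\<close>:
    the directions in which the Hessian vanishes whatever \<open>mu\<close> is.\<close>
  define N where "N = {u. (\<forall>x. u \<bullet> P x = 0) \<and> (\<forall>x. u \<bullet> D x = 0)}"
  define H where "H mu x = P x /\<^sub>R (2 * mu) - D x" for mu x
  have linP: "linear P" unfolding P_def
    by (intro linear_compose_sum ballI linearI) (auto simp: inner_add_right scaleR_add_left)
  have linD: "linear D"
    by (rule linearI) (auto simp: D_def vec_eq_iff algebra_simps)
  have linH: "linear (H mu)" for mu unfolding H_def
    by (rule linearI) (auto simp: linear_add[OF linP] linear_add[OF linD] linear_cmul[OF linP] linear_cmul[OF linD] algebra_simps)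
  have symP: "P x \<bullet> z = x \<bullet> P z" for x z
    by (simp add: P_def inner_sum_left inner_sum_right inner_commute mult.commute)
  have symD: "D x \<bullet> z = x \<bullet> D z" for x z
    by (simp add: D_def inner_vec_def mult_ac)
  have xPx: "x \<bullet> P x = (\<Sum>i\<in>A. (b i \<bullet> x)\<^sup>2)" for x
    by (simp add: P_def inner_sum_right power2_eq_square inner_commute)
  have xDx: "x \<bullet> D x = (\<Sum>p\<in>UNIV. q p * (x $ p)\<^sup>2)" for x
    by (simp add: D_def inner_vec_def power2_eq_square mult_ac)
  \<comment> \<open>The part of the right-hand side that is multiplied by
    \<open>1 / (2 * mu)\<close> is always orthogonal to \<open>N\<close>; only \<open>h\<close> can
    obstruct the existence of a critical point.\<close>
  have yb: "(\<Sum>i\<in>A. y i *\<^sub>R b i) \<bullet> u = 0" if "u \<in> N" for u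
  proof (cases "finite A")
    case True
    have "(\<Sum>i\<in>A. (b i \<bullet> u)\<^sup>2) = 0" using that by (simp add: N_def flip: xPx)
    then have "b i \<bullet> u = 0" if "i \<in> A" for i
      using True that by (subst (asm) sum_nonneg_eq_0_iff) auto
    then show ?thesis by (simp add: inner_sum_left)
  qed simp
  have dPsi_eq: "dPsi mu x = H mu x - ((\<Sum>i\<in>A. y i *\<^sub>R b i) /\<^sub>R (2 * mu) - h)" for mu x
    by (simp add: dPsi_def H_def P_def D_def scaleR_diff_left sum_subtractf scaleR_diff_right)
  have Taylor: "Psi mu (z + x) = Psi mu z + dPsi mu z \<bullet> x + (x \<bullet> H mu x) / 2" if mu: "mu > 0" for mu z x
  proof -
    have e1: "(\<Sum>i\<in>A. (y i - b i \<bullet> (z + x))\<^sup>2) = (\<Sum>i\<in>A. (y i - b i \<bullet> z)\<^sup>2)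
        - 2 * (\<Sum>i\<in>A. (y i - b i \<bullet> z) * (b i \<bullet> x)) + (\<Sum>i\<in>A. (b i \<bullet> x)\<^sup>2)"
      by (simp add: inner_add_right power2_eq_square algebra_simps sum.distrib sum_subtractf sum_distrib_left)
    have e2: "(\<Sum>p\<in>UNIV. q p * ((z + x) $ p)\<^sup>2) = (\<Sum>p\<in>UNIV. q p * (z $ p)\<^sup>2)
        + 2 * (\<Sum>p\<in>UNIV. q p * z $ p * x $ p) + (\<Sum>p\<in>UNIV. q p * (x $ p)\<^sup>2)"
      by (simp add: power2_eq_square algebra_simps sum.distrib sum_distrib_left)
    have "D z \<bullet> x = (\<Sum>p\<in>UNIV. q p * z $ p * x $ p)"
      by (simp add: D_def inner_vec_def)
    moreover have "(\<Sum>i\<in>A. (y i - b i \<bullet> z) *\<^sub>R b i) \<bullet> x = (\<Sum>i\<in>A. (y i - b i \<bullet> z) * (b i \<bullet> x))"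
      by (simp add: inner_sum_left)
    ultimately have e3: "dPsi mu z \<bullet> x = h \<bullet> x - inverse (2 * mu) * (\<Sum>i\<in>A. (y i - b i \<bullet> z) * (b i \<bullet> x))
        - (\<Sum>p\<in>UNIV. q p * z $ p * x $ p)"
      by (simp only: dPsi_def D_def inner_diff_left inner_scaleR_left)
    have e4: "x \<bullet> H mu x = inverse (2 * mu) * (\<Sum>i\<in>A. (b i \<bullet> x)\<^sup>2) - (\<Sum>p\<in>UNIV. q p * (x $ p)\<^sup>2)"
      by (simp only: H_def inner_diff_right inner_scaleR_right xPx xDx)
    have "(a - 2 * e + k) / (4 * mu) - (a' + 2 * e' + k') / 2 + (hz + hx) + c0 + c1 * mu
      = a / (4 * mu) - a' / 2 + hz + c0 + c1 * mu + (hx - inverse (2 * mu) * e - e') + (inverse (2 * mu) * k - k') / 2"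
      for a e k a' e' k' hz hx using mu by (simp add: field_simps)
    then show ?thesis unfolding Psi_def e1 e2 e3 e4 inner_add_right[of h] .
  qed
  have subN: "subspace N"
    unfolding N_def subspace_def by (auto simp: inner_add_left)
  obtain U where U: "U \<subseteq> N" "pairwise orthogonal U" "\<And>u. u \<in> U \<Longrightarrow> norm u = 1" "span U = N"
    using orthonormal_basis_subspace[OF subN] by metis
  have finO: "finite U" using U(2) by (rule pairwise_orthogonal_imp_finite)
  define Pi where "Pi x = (\<Sum>u\<in>U. (u \<bullet> x) *\<^sub>R u)" for x
  have linPi: "linear Pi" unfolding Pi_def
    by (intro linear_compose_sum ballI linearI) (auto simp: inner_add_right scaleR_add_left)
  have uPi: "u \<bullet> Pi x = u \<bullet> x" if "u \<in> U" for u x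
  proof -
    have "u \<bullet> Pi x = (\<Sum>u'\<in>U. if u' = u then u \<bullet> x else 0)"
      unfolding Pi_def inner_sum_right
    proof (rule sum.cong[OF refl])
      fix u' assume u': "u' \<in> U"
      have "u \<bullet> u = 1" using U(3)[OF that] by (simp add: norm_eq_1)
      moreover have "u \<bullet> u' = 0" if "u' \<noteq> u"
        using U(2) \<open>u \<in> U\<close> u' that unfolding pairwise_def orthogonal_def by metis
      ultimately show "u \<bullet> (u' \<bullet> x) *\<^sub>R u' = (if u' = u then u \<bullet> x else 0)" by simp
    qed
    then show ?thesis using that finO by simp
  qed
  have PiN: "Pi x \<in> N" for x
    unfolding Pi_def using U(1) subN by (intro subspace_sum subspace_scale) auto
  have Pi0: "Pi x = 0" if "\<And>u. u \<in> U \<Longrightarrow> u \<bullet> x = 0" for x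
    unfolding Pi_def using that by simp
  \<comment> \<open>Adding the projection \<open>Pi\<close> onto the common kernel makes the pencil
    injective for small \<open>mu\<close>. Its sign is that of \<open>D\<close>, so
    \<open>D + Pi\<close> stays positive semidefinite, as
    \<open>singular_pencil_bounded_below\<close> requires.\<close>
  define A' where "A' mu x = P x /\<^sub>R (2 * mu) - (D x + Pi x)" for mu x
  have linA': "linear (A' mu)" for mu unfolding A'_def
    by (rule linearI) (auto simp: linear_add[OF linP] linear_add[OF linD] linear_add[OF linPi]
      linear_cmul[OF linP] linear_cmul[OF linD] linear_cmul[OF linPi] algebra_simps)
  have A'_H: "A' mu x = H mu x - Pi x" for mu x by (simp add: A'_def H_def)
  have uH: "u \<bullet> H mu x = 0" if "u \<in> N" for u mu x
    using that by (simp add: N_def H_def inner_diff_right)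
  have HN: "H mu u = 0" if "u \<in> N" for u mu
  proof -
    have "P u \<bullet> P u = 0" "D u \<bullet> D u = 0"
      using that unfolding symP symD N_def by auto
    then have "P u = 0" "D u = 0" by simp_all
    then show ?thesis by (simp add: H_def)
  qed
  have "\<exists>c>0. \<exists>m>0. \<forall>mu\<in>{0<..<m}. \<forall>x. c * norm x \<le> norm (P x /\<^sub>R (2 * mu) - (D x + Pi x))"
  proof (rule singular_pencil_bounded_below[OF linP symP])
    show "linear (\<lambda>x. D x + Pi x)" by (rule linear_compose_add[OF linD linPi])
    fix x assume x: "P x = 0" "x \<bullet> (D x + Pi x) = 0"
    have xPi: "x \<bullet> Pi x = (\<Sum>u\<in>U. (u \<bullet> x)\<^sup>2)"
      by (simp add: Pi_def inner_sum_right power2_eq_square inner_commute)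
    have "x \<bullet> D x \<ge> 0" "x \<bullet> Pi x \<ge> 0" unfolding xDx xPi using q by (auto intro!: sum_nonneg)
    then have z: "x \<bullet> D x = 0" "x \<bullet> Pi x = 0" using x(2) by (auto simp: inner_add_right)
    have "q p * x $ p = 0" for p
    proof -
      have "q p * (x $ p)\<^sup>2 = 0"
        using z(1) q unfolding xDx by (subst (asm) sum_nonneg_eq_0_iff) auto
      then show ?thesis by simp
    qed
    then have "D x = 0" by (simp add: D_def vec_eq_iff)
    then have "x \<in> N" using x(1) symP[of x] symD[of x] by (simp add: N_def)
    then have "x \<in> span U" using U(4) by simp
    moreover have "orthogonal x u" if "u \<in> U" for u
    proof -
      have "(u \<bullet> x)\<^sup>2 = 0"
        using z(2) finO that unfolding xPi by (subst (asm) sum_nonneg_eq_0_iff) auto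
      then show ?thesis by (simp add: orthogonal_def inner_commute)
    qed
    ultimately have "orthogonal x x" by (metis orthogonal_to_span)
    then show "x = 0" by (simp add: orthogonal_def)
  qed
  then obtain c m where c: "c > 0" and m: "m > 0"
    and lower: "\<And>mu x. 0 < mu \<Longrightarrow> mu < m \<Longrightarrow> c * norm x \<le> norm (A' mu x)"
    unfolding A'_def by (metis greaterThanLessThan_iff)
  show ?thesis
  proof (cases "\<exists>u\<in>N. h \<bullet> u \<noteq> 0")
    case True
    then obtain u where u: "u \<in> N" "h \<bullet> u \<noteq> 0" by blast

    have "norm u > 0" using u(2) by auto
    \<comment> \<open>The gradient has the constant component \<open>h \<bullet> u\<close> along
      \<open>u\<close>. With this bound as \<open>g\<close> the claim is vacuous, and the level and
      the constant below are placeholders.\<close>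
    have "\<bar>h \<bullet> u\<bar> / norm u \<le> norm (dPsi mu x)" for mu x
    proof -
      have "dPsi mu x \<bullet> u = h \<bullet> u"
        using uH[OF u(1), of mu x]
        unfolding dPsi_eq inner_diff_left inner_scaleR_left yb[OF u(1)] by (simp add: inner_commute)
      then have "\<bar>h \<bullet> u\<bar> \<le> norm (dPsi mu x) * norm u" by (metis Cauchy_Schwarz_ineq2)
      then show ?thesis using \<open>norm u > 0\<close> by (simp add: pos_divide_le_eq)
    qed
    moreover have "\<bar>h \<bullet> u\<bar> / norm u > 0" using u(2) \<open>norm u > 0\<close> by simp
    ultimately show ?thesis
      by (intro exI[of _ "\<lambda>_. 0"] exI[of _ 0] exI[of _ "\<bar>h \<bullet> u\<bar> / norm u"] exI[of _ 1])
        (auto simp: ratfun_const not_less[symmetric])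
  next
    case False
    define rhs where "rhs mu = (\<Sum>i\<in>A. y i *\<^sub>R b i) /\<^sub>R (2 * mu) - h" for mu
    define M where "M mu = matrix (A' mu)" for mu
    \<comment> \<open>Cramer's rule, so that the critical point is a quotient of determinants and
      hence rational in \<open>mu\<close>.\<close>
    define xs where "xs mu = (\<chi> k. det (\<chi> i j. if j = k then rhs mu $ i else M mu $ i $ j) / det (M mu))" for mu
    have A'xs: "A' mu (xs mu) = rhs mu" if "0 < mu" "mu < m" for mu
    proof -
      have "inj (A' mu)"
      proof (rule injI)
        fix x z assume "A' mu x = A' mu z"
        then have "A' mu (x - z) = 0" by (simp add: linear_diff[OF linA'])
        then have "c * norm (x - z) \<le> 0" using lower[OF that, of "x - z"] by simp
        then show "x = z" using c by (simp add: mult_le_0_iff)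
      qed
      then have "det (M mu) \<noteq> 0" unfolding M_def using det_nz_iff_inj[OF linA'] by blast
      then have "M mu *v xs mu = rhs mu" unfolding xs_def by (simp add: cramer)
      then show ?thesis unfolding M_def by (simp add: matrix_works linA' matrix_vector_mul(2))
    qed
    have rhsN: "u \<bullet> rhs mu = 0" if "u \<in> N" for u mu
    proof -
      have "h \<bullet> u = 0" using False that by blast
      then have "rhs mu \<bullet> u = 0" unfolding rhs_def inner_diff_left inner_scaleR_left yb[OF that] by simp
      then show ?thesis by (simp add: inner_commute)
    qed
    have Hxs: "dPsi mu (xs mu) = 0" if "0 < mu" "mu < m" for mu
    proof -
      \<comment> \<open>Tested against \<open>u\<close>, the regularised equation reads
        \<open>- (u \<bullet> xs mu) = u \<bullet> rhs mu = 0\<close>; so the regularisation does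
        not act on its own solution, which is critical for the original quadratic.\<close>
      have "u \<bullet> xs mu = 0" if "u \<in> U" for u
      proof -
        have "u \<bullet> A' mu (xs mu) = - (u \<bullet> xs mu)"
          using uH[of u mu "xs mu"] uPi[OF that] U(1) that by (auto simp: A'_H inner_diff_right)
        then show ?thesis using A'xs rhsN[of u mu] U(1) that \<open>0 < mu\<close> \<open>mu < m\<close> by auto
      qed
      then have "Pi (xs mu) = 0" by (rule Pi0)
      then show ?thesis using A'xs[OF that] by (simp add: dPsi_eq A'_H rhs_def)
    qed
    have KL: "\<bar>Psi mu x - Psi mu (xs mu)\<bar> \<le> (1 / (2 * c)) * (norm (dPsi mu x))\<^sup>2"
      if mu: "0 < mu" "mu < m" for mu x
    proof -
      define xi where "xi = x - xs mu"
      \<comment> \<open>The kernel component of the displacement may be arbitrarily large but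
        affects neither the value nor the gradient; without it the lower bound of the pencil applies
        and gives the constant \<open>1 / (2 * c)\<close>.\<close>
      define xi' where "xi' = xi - Pi xi"
      have d: "dPsi mu x = H mu xi"
        using Hxs[OF mu] by (simp add: dPsi_eq xi_def linear_diff[OF linH])
      have "u \<bullet> xi' = 0" if "u \<in> U" for u using uPi[OF that, of xi] by (simp add: xi'_def inner_diff_right)
      then have "Pi xi' = 0" by (rule Pi0)
      then have "A' mu xi' = H mu xi"
        using HN[OF PiN] by (simp add: A'_H xi'_def linear_diff[OF linH])
      then have l: "c * norm xi' \<le> norm (H mu xi)" using lower[OF mu, of xi'] by simp
      have "Psi mu x - Psi mu (xs mu) = (xi \<bullet> H mu xi) / 2"
        using Taylor[OF mu(1), of "xs mu" xi] Hxs[OF mu] by (simp add: xi_def)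
      also have "xi \<bullet> H mu xi = xi' \<bullet> H mu xi"
        using uH[OF PiN, of xi mu xi] by (simp add: xi'_def inner_diff_left)
      finally have "Psi mu x - Psi mu (xs mu) = xi' \<bullet> H mu xi / 2" .
      then have "\<bar>Psi mu x - Psi mu (xs mu)\<bar> = \<bar>xi' \<bullet> H mu xi\<bar> / 2"
        by (simp only: abs_divide abs_numeral)
      also have "\<dots> \<le> norm xi' * norm (H mu xi) / 2"
        by (intro divide_right_mono Cauchy_Schwarz_ineq2) auto
      also have "\<dots> \<le> (norm (H mu xi) / c) * norm (H mu xi) / 2"
        using l c by (intro divide_right_mono mult_right_mono) (auto simp: field_simps)
      finally show ?thesis using c by (simp add: d power2_eq_square field_simps)
    qed
    have rat_rhs: "ratfun (\<lambda>mu. rhs mu $ i)" for i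
      unfolding rhs_def by (simp, intro ratfun_intros)
    have rat_M: "ratfun (\<lambda>mu. M mu $ i $ j)" for i j
      unfolding M_def matrix_def A'_def by (simp, intro ratfun_intros)
    have rat_xs: "ratfun (\<lambda>mu. xs mu $ k)" for k
    proof -
      have "ratfun (\<lambda>mu. det (\<chi> i j. if j = k then rhs mu $ i else M mu $ i $ j))"
      proof (rule ratfun_det)
        fix i j show "ratfun (\<lambda>mu. (\<chi> i j. if j = k then rhs mu $ i else M mu $ i $ j) $ i $ j)"
          by (cases "j = k") (simp_all add: rat_rhs rat_M)
      qed
      moreover have "ratfun (\<lambda>mu. det (M mu))" by (intro ratfun_det rat_M)
      ultimately have "ratfun (\<lambda>mu. det (\<chi> i j. if j = k then rhs mu $ i else M mu $ i $ j) / det (M mu))"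
        by (rule ratfun_divide)
      then show ?thesis by (rule ratfun_cong) (simp add: xs_def)
    qed
    have "ratfun (\<lambda>mu. Psi mu (xs mu))"
      unfolding Psi_def inner_vec_def inner_real_def by (intro ratfun_intros rat_xs)
    then show ?thesis using KL m
      \<comment> \<open>With a critical point the inequality holds for gradients of every size, so
        the threshold 1 is arbitrary.\<close>
      by (intro exI[of _ "\<lambda>mu. Psi mu (xs mu)"] exI[of _ "1 / (2 * c)"] exI[of _ 1] exI[of _ m]) auto
  qed
qed

section \<open>Rates from descent towards slowly moving levels\<close>

lemma powr_Suc_tendsto_0:
  assumes "e < 0"
  shows "(\<lambda>k. (real k + 1) powr e) \<longlonglongrightarrow> 0"
proof -
  have "(\<lambda>k. real (Suc k) powr e) \<longlonglongrightarrow> 0"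
    using assms by (intro LIMSEQ_Suc[OF tendsto_neg_powr] filterlim_real_sequentially) auto
  then show ?thesis by (simp add: add.commute)
qed

text \<open>Telescoping would bound the partial sums of the harmonic series. Every qualitative
  convergence statement below is reduced to this contradiction.\<close>

lemma no_harmonic_descent:
  fixes Phi :: "nat \<Rightarrow> real"
  assumes "c > 0" "\<And>k. Phi k \<ge> 0" "\<forall>\<^sub>F k in sequentially. Phi k - Phi (Suc k) \<ge> c / (real k + 1)"
  shows False
proof -
  obtain N where N: "\<And>k. k \<ge> N \<Longrightarrow> Phi k - Phi (Suc k) \<ge> c / (real k + 1)"
    using assms(3) unfolding eventually_sequentially by blast
  have "(\<Sum>k<n. c / (real (k + N) + 1)) \<le> Phi N - Phi (n + N)" for n
  proof (induction n)
    case (Suc n)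
    then show ?case using N[of "n + N"] by simp
  qed simp
  then have "(\<Sum>k<n. c / (real (k + N) + 1)) + Phi (n + N) \<le> Phi N" for n
    by (simp add: le_diff_eq)
  then have "(\<Sum>k<n. c / (real (k + N) + 1)) \<le> Phi N" for n
    using assms(2)[of "n + N"] order_trans[OF le_add_same_cancel1[THEN iffD2]] by blast
  then have "summable (\<lambda>k. c / (real (k + N) + 1))"
    using assms(1) by (intro summableI_nonneg_bounded) auto
  then have "summable (\<lambda>k. c / (real k + 1))"
    using summable_iff_shift[of "\<lambda>k. c / (real k + 1)" N] by simp
  then have "summable (\<lambda>k. (1 / c) * (c / (real k + 1)))" by (rule summable_mult)
  then have "summable (\<lambda>k. inverse (real (Suc k)))"
    using assms(1) by (simp add: inverse_eq_divide add.commute)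
  then show False
    using not_summable_harmonic[where 'a = real] summable_Suc_iff[of "\<lambda>k. inverse (real k)"] by simp
qed

text \<open>As long as the positive part of \<open>y\<close> exceeds \<open>e\<close> it loses at
  least \<open>c * e / (k + 1)\<close> per step, which cannot go on forever; once below
  \<open>e\<close> it stays there, being nonincreasing.\<close>

lemma contraction_eventually_small:
  fixes y a :: "nat \<Rightarrow> real"
  assumes step: "\<forall>\<^sub>F k in sequentially. y (Suc k) \<le> (1 - a k) * y k"
    and a: "c > 0" "\<forall>\<^sub>F k in sequentially. c / (real k + 1) \<le> a k \<and> a k \<le> 1"
    and e: "e > 0"
  shows "\<forall>\<^sub>F k in sequentially. y k \<le> e"
proof (rule ccontr)
  assume contra: "\<not> ?thesis"
  define Y where "Y k = max (y k) 0" for k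
  obtain N where N: "\<And>k. k \<ge> N \<Longrightarrow> y (Suc k) \<le> (1 - a k) * y k"
    "\<And>k. k \<ge> N \<Longrightarrow> c / (real k + 1) \<le> a k" "\<And>k. k \<ge> N \<Longrightarrow> a k \<le> 1"
    using eventually_conj[OF step a(2)] unfolding eventually_sequentially by blast
  have Ystep: "Y (Suc k) \<le> (1 - a k) * Y k" if "k \<ge> N" for k
  proof -
    have "(1 - a k) * y k \<le> (1 - a k) * Y k" "0 \<le> (1 - a k) * Y k"
      using N(3)[OF that] by (auto simp: Y_def intro!: mult_left_mono mult_nonneg_nonneg)
    then show ?thesis using N(1)[OF that] by (simp add: Y_def)
  qed
  have apos: "a k \<ge> 0" if "k \<ge> N" for k
    using N(2)[OF that] a(1) by (meson divide_nonneg_nonneg less_imp_le of_nat_0_le_iff order_trans add_nonneg_nonneg zero_le_one)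
  have mono: "Y (Suc k) \<le> Y k" if "k \<ge> N" for k
  proof -
    have "0 \<le> a k * Y k" using apos[OF that] by (simp add: Y_def)
    then show ?thesis using Ystep[OF that] by (simp add: left_diff_distrib)
  qed
  have big: "Y k > e" if "k \<ge> N" for k
  proof (rule ccontr)
    assume "\<not> Y k > e"
    have "Y j \<le> Y k" if "j \<ge> k" for j
      using that
    proof (induction j rule: dec_induct)
      case (step j)
      then show ?case using mono[of j] \<open>k \<ge> N\<close> by simp
    qed simp
    then have "\<forall>j\<ge>k. y j \<le> e" using \<open>\<not> Y k > e\<close> by (metis Y_def max.bounded_iff not_le order_trans)
    then show False using contra unfolding eventually_sequentially by blast
  qed
  have "\<forall>\<^sub>F k in sequentially. Y k - Y (Suc k) \<ge> (c * e) / (real k + 1)"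
    unfolding eventually_sequentially
  proof (intro exI allI impI)
    fix k assume k: "k \<ge> N"
    have "(c * e) / (real k + 1) = c / (real k + 1) * e" by simp
    also have "\<dots> \<le> a k * Y k"
      using N(2)[OF k] big[OF k] apos[OF k] e by (intro mult_mono) auto
    also have "\<dots> \<le> Y k - Y (Suc k)" using Ystep[OF k] by (simp add: algebra_simps)
    finally show "Y k - Y (Suc k) \<ge> (c * e) / (real k + 1)" .
  qed
  then show False by (rule no_harmonic_descent[rotated 2]) (use a e in \<open>auto simp: Y_def\<close>)
qed

lemma powr_Suc_ratio:
  assumes "0 \<le> e" "e \<le> 1"
  shows "(real k + 1) powr e \<le> (real (Suc k) + 1) powr e"
    and "(real (Suc k) + 1) powr e \<le> (real k + 1) powr e * (1 + 1 / (real k + 1))"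
proof -
  let ?K = "real k + 1"
  show "?K powr e \<le> (real (Suc k) + 1) powr e"
    using assms by (intro powr_mono2) auto
  have "real (Suc k) + 1 = ?K * (1 + 1 / ?K)" by (simp add: field_simps)
  then have "(real (Suc k) + 1) powr e = ?K powr e * (1 + 1 / ?K) powr e"
    by (simp only: powr_mult)
  also have "\<dots> \<le> ?K powr e * (1 + 1 / ?K) powr 1"
    using assms by (intro mult_left_mono powr_mono) auto
  finally show "(real (Suc k) + 1) powr e \<le> ?K powr e * (1 + 1 / ?K)" by simp
qed

text \<open>For small \<open>\<theta> \<noteq> 0\<close> the set \<open>{a \<le> \<theta>}\<close> is eventually forward invariant: at a first exit the
  value would be near \<open>\<theta>\<close>, hence away from every level, and the guaranteed descent
  outweighs the drift of the levels.\<close>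
lemma level_barrier:
  fixes Phi :: "nat \<Rightarrow> real" and V :: "(nat \<Rightarrow> real) set" and d c eta E theta g :: real and v :: "nat \<Rightarrow> real"
  assumes d: "0 < d" "d < 1" and c: "c > 0" and eta: "eta > 0" and E: "E \<ge> 0"
    and dec: "\<forall>\<^sub>F k in sequentially. Phi (Suc k) \<le> Phi k"
    and drop: "\<forall>\<^sub>F k in sequentially. \<forall>e. 0 \<le> e \<and> e \<le> eta \<and> (\<forall>v\<in>V. e \<le> \<bar>Phi (Suc k) - v (Suc k)\<bar>) \<longrightarrow>
        c * e * (real k + 1) powr (- d) - E * (real k + 1) powr (- 2 - d) \<le> Phi k - Phi (Suc k)"
    and drift: "\<forall>\<^sub>F k in sequentially. \<bar>v (Suc k) - v k\<bar> \<le> E * (real k + 1) powr (- 1 - d)"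
    and sep: "\<forall>\<^sub>F k in sequentially. \<forall>u\<in>V. (real k + 1) powr (1 - d) * \<bar>v k - u k\<bar> \<le> \<bar>theta\<bar> / 4 \<or>
        4 * \<bar>theta\<bar> \<le> (real k + 1) powr (1 - d) * \<bar>v k - u k\<bar>"
    and theta: "theta \<noteq> 0"
  defines "a \<equiv> \<lambda>k. (real k + 1) powr (1 - d) * (Phi k - v k)"
  shows "\<forall>\<^sub>F k in sequentially. a k \<le> theta \<longrightarrow> a (Suc k) \<le> theta"
proof -
  \<comment> \<open>Three smallness conditions: \<open>n1\<close> limits the overshoot of a single
    step to \<open>|theta| / 4\<close>, \<open>n2\<close> lets the descent beat rescaling, drift and
    error, \<open>n3\<close> keeps the tested distance below \<open>eta\<close>.\<close>
  have lim1: "(\<lambda>k. \<bar>theta\<bar> * (real k + 1) powr (-1) + 2 * E * (real k + 1) powr (- 2 * d)) \<longlonglongrightarrow> \<bar>theta\<bar> * 0 + 2 * E * 0"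
    using d by (intro tendsto_intros powr_Suc_tendsto_0) auto
  have n1: "\<forall>\<^sub>F k in sequentially. \<bar>theta\<bar> * (real k + 1) powr (-1) + 2 * E * (real k + 1) powr (- 2 * d) < \<bar>theta\<bar> / 4"
    by (rule order_tendstoD(2)[OF lim1]) (use theta in simp)
  have lim2: "(\<lambda>k. \<bar>theta\<bar> * (real k + 1) powr (d - 1) + 4 * E * (real k + 1) powr (- d)) \<longlonglongrightarrow> \<bar>theta\<bar> * 0 + 4 * E * 0"
    using d by (intro tendsto_intros powr_Suc_tendsto_0) auto
  have n2: "\<forall>\<^sub>F k in sequentially. \<bar>theta\<bar> * (real k + 1) powr (d - 1) + 4 * E * (real k + 1) powr (- d) < c * \<bar>theta\<bar> / 2"
    by (rule order_tendstoD(2)[OF lim2]) (use theta c in simp)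
  have lim3: "(\<lambda>k. \<bar>theta\<bar> / 2 * (real k + 1) powr (d - 1)) \<longlonglongrightarrow> \<bar>theta\<bar> / 2 * 0"
    using d by (intro tendsto_intros powr_Suc_tendsto_0) auto
  have n3: "\<forall>\<^sub>F k in sequentially. \<bar>theta\<bar> / 2 * (real k + 1) powr (d - 1) < eta"
    by (rule order_tendstoD(2)[OF lim3]) (use eta in simp)
  have sep': "\<forall>\<^sub>F k in sequentially. \<forall>u\<in>V. (real (Suc k) + 1) powr (1 - d) * \<bar>v (Suc k) - u (Suc k)\<bar> \<le> \<bar>theta\<bar> / 4 \<or>
        4 * \<bar>theta\<bar> \<le> (real (Suc k) + 1) powr (1 - d) * \<bar>v (Suc k) - u (Suc k)\<bar>"
    using sep by (rule eventually_sequentially_Suc[THEN iffD2])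
  show ?thesis using dec drop drift sep' n1 n2 n3
  proof eventually_elim
    case (elim k)
    note dec = elim(1) and drop = elim(2) and drift = elim(3) and sep = elim(4) and n = elim(5-7)
    define K where "K = real k + 1"
    define r where "r = K powr (1 - d)"
    define R where "R = (real (Suc k) + 1) powr (1 - d)"
    have K: "K \<ge> 1" by (simp add: K_def)
    have r0: "r > 0" using K by (simp add: r_def)
    have rR: "r \<le> R" "R \<le> r * (1 + 1 / K)"
      using powr_Suc_ratio[of "1 - d" k] d by (auto simp: r_def R_def K_def)
    have R0: "R > 0" using rR r0 by simp
    have "r * (1 + 1 / K) \<le> r * 2" using r0 K by (intro mult_left_mono) (auto simp: field_simps)
    then have R2: "R \<le> 2 * r" using rR by simp
    have pw: "r * K powr (- 1 - d) = K powr (- 2 * d)" "r * K powr (- 2 - d) \<le> K powr (- 2 * d)"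
      "r * K powr (- d) = K powr (1 - 2 * d)"
      using K by (auto simp: r_def simp flip: powr_add intro!: powr_mono)
    have pw': "K powr (- 1) = K powr (- d) * K powr (d - 1)" "K powr (- 2 * d) = K powr (- d) * K powr (- d)"
      by (simp_all flip: powr_add)
    show ?case
    proof (rule impI, rule ccontr)
      assume ak: "a k \<le> theta" and "\<not> a (Suc k) \<le> theta"
      then have a': "a (Suc k) > theta" by simp
      have ak': "Phi k - v k \<le> theta / r"
        using ak r0 by (simp add: a_def r_def K_def field_simps)
      have Rr: "R * (theta / r) \<le> theta + \<bar>theta\<bar> * K powr (-1)"
      proof -
        have "(R / r - 1) * theta \<le> (R / r - 1) * \<bar>theta\<bar>"
          using rR(1) r0 by (intro mult_left_mono) auto
        also have "\<dots> \<le> (1 / K) * \<bar>theta\<bar>"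
          using rR(2) r0 by (intro mult_right_mono) (auto simp: field_simps)
        also have "1 / K = K powr (-1)" using K by (simp add: powr_minus divide_inverse)
        finally show ?thesis using r0 by (simp add: field_simps)
      qed
      have aS: "a (Suc k) = R * (Phi (Suc k) - v (Suc k))" by (simp add: a_def R_def)
      have "Phi (Suc k) - v (Suc k) \<le> theta / r + E * K powr (- 1 - d)"
        using dec drift ak' by (simp add: K_def)
      then have "a (Suc k) \<le> R * (theta / r + E * K powr (- 1 - d))"
        unfolding aS using R0 by (intro mult_left_mono) auto
      also have "\<dots> = R * (theta / r) + R * (E * K powr (- 1 - d))" by (simp add: distrib_left)
      also have "R * (E * K powr (- 1 - d)) \<le> (2 * r) * (E * K powr (- 1 - d))"
        using R2 E by (intro mult_right_mono) auto
      also have "(2 * r) * (E * K powr (- 1 - d)) = 2 * E * K powr (- 2 * d)"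
        by (subst pw(1)[symmetric]) (simp only: mult_ac)
      finally have up: "a (Suc k) \<le> theta + \<bar>theta\<bar> / 4" using Rr n(1) unfolding K_def by linarith
      \<comment> \<open>At an exit \<open>|a (Suc k)|\<close> lies between \<open>3/4\<close> and
        \<open>5/4\<close> of \<open>|theta|\<close>. A level within \<open>|theta| / 4\<close> of
        \<open>v\<close> is then at scaled distance at least \<open>|theta| / 2\<close>, and one
        beyond \<open>4 * |theta|\<close> is farther still.\<close>
      have away: "\<bar>theta\<bar> / 2 \<le> R * \<bar>Phi (Suc k) - u (Suc k)\<bar>" if "u \<in> V" for u
      proof -
        have "R * (Phi (Suc k) - u (Suc k)) = a (Suc k) + R * (v (Suc k) - u (Suc k))"
          by (simp add: aS algebra_simps)
        then have "\<bar>R * (Phi (Suc k) - u (Suc k))\<bar> = \<bar>a (Suc k) + R * (v (Suc k) - u (Suc k))\<bar>" by simp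
        moreover have "\<bar>R * (Phi (Suc k) - u (Suc k))\<bar> = R * \<bar>Phi (Suc k) - u (Suc k)\<bar>"
          "\<bar>R * (v (Suc k) - u (Suc k))\<bar> = R * \<bar>v (Suc k) - u (Suc k)\<bar>"
          using R0 by (simp_all add: abs_mult)
        moreover have "R * \<bar>v (Suc k) - u (Suc k)\<bar> \<le> \<bar>theta\<bar> / 4 \<or> 4 * \<bar>theta\<bar> \<le> R * \<bar>v (Suc k) - u (Suc k)\<bar>"
          using sep that by (simp add: R_def)
        ultimately show ?thesis using up a' by linarith
      qed
      let ?e = "\<bar>theta\<bar> / (2 * R)"
      have "?e \<le> \<bar>theta\<bar> / (2 * r)" using rR r0 by (intro divide_left_mono) auto
      also have "\<dots> = \<bar>theta\<bar> / 2 * K powr (d - 1)"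
        using K by (simp add: r_def powr_diff powr_minus field_simps)
      finally have "?e \<le> eta" using n(3) by (simp add: K_def)
      moreover have "0 \<le> ?e" using R0 by simp
      moreover have "\<forall>u\<in>V. ?e \<le> \<bar>Phi (Suc k) - u (Suc k)\<bar>"
        using away R0 by (auto simp: field_simps)
      ultimately have "c * ?e * K powr (- d) - E * K powr (- 2 - d) \<le> Phi k - Phi (Suc k)"
        using drop unfolding K_def by blast
      then have "Phi (Suc k) - v (Suc k) \<le> theta / r + E * K powr (- 1 - d) + E * K powr (- 2 - d) - c * ?e * K powr (- d)"
        using drift ak' by (simp add: K_def)
      then have "a (Suc k) \<le> R * (theta / r + E * K powr (- 1 - d) + E * K powr (- 2 - d) - c * ?e * K powr (- d))"
        unfolding aS using R0 by (intro mult_left_mono) auto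
      also have "\<dots> = R * (theta / r) + R * (E * K powr (- 1 - d)) + R * (E * K powr (- 2 - d)) - c * \<bar>theta\<bar> / 2 * K powr (- d)"
        using R0 by (simp add: field_simps)
      also have "R * (E * K powr (- 1 - d)) \<le> (2 * r) * (E * K powr (- 1 - d))"
        using R2 E by (intro mult_right_mono) auto
      also have "(2 * r) * (E * K powr (- 1 - d)) = 2 * E * K powr (- 2 * d)"
        by (subst pw(1)[symmetric]) (simp only: mult_ac)
      also have "R * (E * K powr (- 2 - d)) \<le> (2 * r) * (E * K powr (- 2 - d))"
        using R2 E by (intro mult_right_mono) auto
      also have "(2 * r) * (E * K powr (- 2 - d)) = 2 * E * (r * K powr (- 2 - d))"
        by (simp only: mult_ac)
      also have "\<dots> \<le> 2 * E * K powr (- 2 * d)" using pw(2) E by (intro mult_left_mono) auto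
      finally have "a (Suc k) \<le> theta + (\<bar>theta\<bar> * K powr (-1) + 4 * E * K powr (- 2 * d) - c * \<bar>theta\<bar> / 2 * K powr (- d))"
        using Rr by linarith
      also have "\<bar>theta\<bar> * K powr (-1) + 4 * E * K powr (- 2 * d) - c * \<bar>theta\<bar> / 2 * K powr (- d)
        = K powr (- d) * (\<bar>theta\<bar> * K powr (d - 1) + 4 * E * K powr (- d) - c * \<bar>theta\<bar> / 2)"
        unfolding pw' by (simp add: algebra_simps)
      also have "\<dots> \<le> 0" using n(2) by (intro mult_nonneg_nonpos) (auto simp: K_def)
      finally show False using a' by simp
    qed
  qed
qed

text \<open>By the barrier, \<open>a v\<close> eventually stays on one side of each small
  \<open>theta \<noteq> 0\<close>, so it either tends to 0 or is eventually bounded away from 0. If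
  every level is avoided in this sense, the guaranteed descent is of order \<open>1 / k\<close>,
  contradicting \<open>no_harmonic_descent\<close>.\<close>

lemma level_selection:
  fixes Phi :: "nat \<Rightarrow> real" and V :: "(nat \<Rightarrow> real) set" and d c eta E :: real
  assumes d: "0 < d" "d < 1" and c: "c > 0" and eta: "eta > 0" and E: "E \<ge> 0" and V: "finite V"
    and nonneg: "\<And>k. Phi k \<ge> 0"
    and dec: "\<forall>\<^sub>F k in sequentially. Phi (Suc k) \<le> Phi k"
    and drop: "\<forall>\<^sub>F k in sequentially. \<forall>e. 0 \<le> e \<and> e \<le> eta \<and> (\<forall>v\<in>V. e \<le> \<bar>Phi (Suc k) - v (Suc k)\<bar>) \<longrightarrow>
        c * e * (real k + 1) powr (- d) - E * (real k + 1) powr (- 2 - d) \<le> Phi k - Phi (Suc k)"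
    and drift: "\<And>v. v \<in> V \<Longrightarrow> \<forall>\<^sub>F k in sequentially. \<bar>v (Suc k) - v k\<bar> \<le> E * (real k + 1) powr (- 1 - d)"
    and sep: "\<And>u v. u \<in> V \<Longrightarrow> v \<in> V \<Longrightarrow> (\<lambda>k. (real k + 1) powr (1 - d) * (v k - u k)) \<longlonglongrightarrow> 0 \<or>
        (\<exists>g>0. \<forall>\<^sub>F k in sequentially. g \<le> (real k + 1) powr (1 - d) * \<bar>v k - u k\<bar>)"
  shows "\<exists>v\<in>V. (\<lambda>k. (real k + 1) powr (1 - d) * (Phi k - v k)) \<longlonglongrightarrow> 0"
proof (rule ccontr)
  assume contra: "\<not> ?thesis"
  define r where "r k = (real k + 1) powr (1 - d)" for k :: nat
  define a where "a v k = r k * (Phi k - v k)" for v k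
  have bounded_away: "\<exists>del>0. \<forall>\<^sub>F k in sequentially. del \<le> \<bar>a v k\<bar>" if v: "v \<in> V" for v
  proof -
    have "\<exists>g>0. (\<lambda>k. r k * (v k - u k)) \<longlonglongrightarrow> 0 \<or> (\<forall>\<^sub>F k in sequentially. g \<le> r k * \<bar>v k - u k\<bar>)"
      if "u \<in> V" for u using sep[OF that v] zero_less_one unfolding r_def by blast
    then obtain g where g: "\<And>u. u \<in> V \<Longrightarrow> g u > 0"
      "\<And>u. u \<in> V \<Longrightarrow> (\<lambda>k. r k * (v k - u k)) \<longlonglongrightarrow> 0 \<or> (\<forall>\<^sub>F k in sequentially. g u \<le> r k * \<bar>v k - u k\<bar>)"
      by metis
    define g0 where "g0 = Min (g ` V)"
    have g0: "g0 > 0" "\<And>u. u \<in> V \<Longrightarrow> g0 \<le> g u"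
    proof -
    have ne: "finite (g ` V)" "g ` V \<noteq> {}" using V v by auto
    show "g0 > 0" unfolding g0_def Min_gr_iff[OF ne] using g(1) by blast
    show "g0 \<le> g u" if "u \<in> V" for u unfolding g0_def using ne that by simp
  qed
    \<comment> \<open>The bound by \<open>g0\<close> makes \<open>theta\<close> small against the
      gap to every level that does not merge with \<open>v\<close>, which supplies the separation
      hypothesis of the barrier.\<close>
    have dich: "(\<forall>\<^sub>F k in sequentially. a v k \<le> theta) \<or> (\<forall>\<^sub>F k in sequentially. a v k > theta)"
      if theta: "theta \<noteq> 0" "4 * \<bar>theta\<bar> \<le> g0" for theta
    proof -
      have "\<forall>\<^sub>F k in sequentially. \<forall>u\<in>V. r k * \<bar>v k - u k\<bar> \<le> \<bar>theta\<bar> / 4 \<or> 4 * \<bar>theta\<bar> \<le> r k * \<bar>v k - u k\<bar>"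
        unfolding eventually_ball_finite_distrib[OF V]
      proof
        fix u assume u: "u \<in> V"
        from g(2)[OF u] show "\<forall>\<^sub>F k in sequentially. r k * \<bar>v k - u k\<bar> \<le> \<bar>theta\<bar> / 4 \<or> 4 * \<bar>theta\<bar> \<le> r k * \<bar>v k - u k\<bar>"
        proof
          assume "(\<lambda>k. r k * (v k - u k)) \<longlonglongrightarrow> 0"
          then have "(\<lambda>k. \<bar>r k * (v k - u k)\<bar>) \<longlonglongrightarrow> 0" by (rule tendsto_rabs_zero)
          then have "\<forall>\<^sub>F k in sequentially. \<bar>r k * (v k - u k)\<bar> < \<bar>theta\<bar> / 4"
            by (rule order_tendstoD) (use theta in simp)
          then show ?thesis by eventually_elim (simp add: abs_mult r_def)
        next
          assume "\<forall>\<^sub>F k in sequentially. g u \<le> r k * \<bar>v k - u k\<bar>"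
          then show ?thesis by eventually_elim (use theta(2) g0(2)[OF u] in linarith)
        qed
      qed
      then have "\<forall>\<^sub>F k in sequentially. a v k \<le> theta \<longrightarrow> a v (Suc k) \<le> theta"
        unfolding r_def a_def by (rule level_barrier[OF d c eta E dec drop drift[OF v] _ theta(1)])
      then obtain N where N: "\<And>k. k \<ge> N \<Longrightarrow> a v k \<le> theta \<Longrightarrow> a v (Suc k) \<le> theta"
        unfolding eventually_sequentially by blast
      show ?thesis
      proof (cases "\<exists>k\<ge>N. a v k \<le> theta")
        case True
        then obtain k where k: "k \<ge> N" "a v k \<le> theta" by blast
        have "a v j \<le> theta" if "j \<ge> k" for j
          using that by (induction j rule: dec_induct) (use k N in auto)
        then show ?thesis unfolding eventually_sequentially by blast
      next
        case False
        then show ?thesis unfolding eventually_sequentially by (meson not_le)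
      qed
    qed
    show ?thesis
    proof (rule ccontr)
      assume none: "\<not> ?thesis"
      have "a v \<longlonglongrightarrow> 0"
      proof (rule tendstoI)
        fix e :: real assume e: "e > 0"
        define th where "th = min (e / 2) (g0 / 4)"
        have th: "th > 0" "4 * th \<le> g0" "th < e" using e g0(1) by (auto simp: th_def)
        have "\<not> (\<forall>\<^sub>F k in sequentially. a v k > th)"
        proof
          assume "\<forall>\<^sub>F k in sequentially. a v k > th"
          then have "\<forall>\<^sub>F k in sequentially. th \<le> \<bar>a v k\<bar>" by eventually_elim simp
          then show False using none th(1) by blast
        qed
        then have up: "\<forall>\<^sub>F k in sequentially. a v k \<le> th" using dich[of th] th by auto
        have "\<not> (\<forall>\<^sub>F k in sequentially. a v k \<le> - th)"
        proof
          assume "\<forall>\<^sub>F k in sequentially. a v k \<le> - th"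
          then have "\<forall>\<^sub>F k in sequentially. th \<le> \<bar>a v k\<bar>" by eventually_elim simp
          then show False using none th(1) by blast
        qed
        then have "\<forall>\<^sub>F k in sequentially. a v k > - th" using dich[of "- th"] th by auto
        with up show "\<forall>\<^sub>F k in sequentially. dist (a v k) 0 < e"
          by eventually_elim (use th in \<open>auto simp: dist_real_def\<close>)
      qed
      then show False using contra v unfolding a_def r_def by blast
    qed
  qed
  then obtain del where del: "\<And>v. v \<in> V \<Longrightarrow> del v > 0" "\<And>v. v \<in> V \<Longrightarrow> \<forall>\<^sub>F k in sequentially. del v \<le> \<bar>a v k\<bar>"
    by metis
  \<comment> \<open>The inserted 1 keeps the minimum meaningful when there are no levels at
    all.\<close>
  define D where "D = Min (insert 1 (del ` V))"
  have D: "D > 0" "\<And>v. v \<in> V \<Longrightarrow> D \<le> del v"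
    unfolding D_def using V del(1) by (auto simp: Min_gr_iff)
  have "\<forall>\<^sub>F k in sequentially. \<forall>v\<in>V. D \<le> \<bar>a v k\<bar>"
    unfolding eventually_ball_finite_distrib[OF V]
  proof
    fix v assume v: "v \<in> V"
    from del(2)[OF v] show "\<forall>\<^sub>F k in sequentially. D \<le> \<bar>a v k\<bar>"
      by eventually_elim (use D(2)[OF v] in linarith)
  qed
  then have away: "\<forall>\<^sub>F k in sequentially. \<forall>v\<in>V. D \<le> \<bar>a v (Suc k)\<bar>"
    by (rule eventually_sequentially_Suc[THEN iffD2])
  have lim3: "(\<lambda>k. D * (real k + 1) powr (d - 1)) \<longlonglongrightarrow> D * 0"
    using d by (intro tendsto_intros powr_Suc_tendsto_0) auto
  have n3: "\<forall>\<^sub>F k in sequentially. D * (real k + 1) powr (d - 1) < eta"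
    by (rule order_tendstoD(2)[OF lim3]) (use eta in simp)
  have lim4: "(\<lambda>k. E * (real k + 1) powr (- 1 - d)) \<longlonglongrightarrow> E * 0"
    using d by (intro tendsto_intros powr_Suc_tendsto_0) auto
  have n4: "\<forall>\<^sub>F k in sequentially. E * (real k + 1) powr (- 1 - d) < c * D / 4"
    by (rule order_tendstoD(2)[OF lim4]) (use c D in simp)
  \<comment> \<open>Since \<open>R\<close> is at most twice \<open>K^(1-d)\<close>, testing with
    distance \<open>D / R\<close> gives a descent of \<open>(c * D / 2) / K\<close>, of which the
    error term consumes at most half.\<close>
  have "\<forall>\<^sub>F k in sequentially. Phi k - Phi (Suc k) \<ge> (c * D / 4) / (real k + 1)"
    using drop away n3 n4
  proof eventually_elim
    case (elim k)
    define K where "K = real k + 1"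
    define R where "R = r (Suc k)"
    have K: "K \<ge> 1" by (simp add: K_def)
    have r0: "r k > 0" using K by (simp add: r_def K_def)
    have rR: "r k \<le> R" "R \<le> r k * (1 + 1 / K)"
      using powr_Suc_ratio[of "1 - d" k] d by (auto simp: r_def R_def K_def)
    have R0: "R > 0" using rR r0 by simp
    have "r k * (1 + 1 / K) \<le> r k * 2" using r0 K by (intro mult_left_mono) (auto simp: field_simps)
    then have R2: "R \<le> 2 * r k" using rR by simp
    have "D / R \<le> D / r k" using rR r0 D(1) by (intro divide_left_mono) auto
    also have "\<dots> = D * K powr (d - 1)" using K by (simp add: r_def K_def powr_diff field_simps)
    finally have "D / R \<le> eta" using elim(3) by (simp add: K_def)
    moreover have "0 \<le> D / R" using D(1) R0 by simp
    moreover have "\<forall>v\<in>V. D / R \<le> \<bar>Phi (Suc k) - v (Suc k)\<bar>"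
    proof
      fix v assume "v \<in> V"
      then have "D \<le> \<bar>a v (Suc k)\<bar>" using elim(2) by blast
      also have "\<dots> = \<bar>Phi (Suc k) - v (Suc k)\<bar> * R"
        using R0 by (simp add: a_def R_def[symmetric] abs_mult)
      finally show "D / R \<le> \<bar>Phi (Suc k) - v (Suc k)\<bar>" using R0 by (simp add: pos_divide_le_eq)
    qed
    ultimately have "c * (D / R) * K powr (- d) - E * K powr (- 2 - d) \<le> Phi k - Phi (Suc k)"
      using elim(1) unfolding K_def by blast
    moreover have "c * (D / R) * K powr (- d) \<ge> c * (D / (2 * r k)) * K powr (- d)"
      using R2 R0 D(1) c by (intro mult_right_mono mult_left_mono divide_left_mono) auto
    moreover have "c * (D / (2 * r k)) * K powr (- d) = (c * D / 2) / K"
    proof -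
      have "r k = K powr (1 - d)" by (simp add: r_def K_def)
      then show ?thesis using K by (simp add: powr_diff powr_minus field_simps)
    qed
    moreover have "E * K powr (- 2 - d) = (E * K powr (- 1 - d)) * K powr (-1)"
    proof -
      have "K powr (- 2 - d) = K powr (- 1 - d + (-1))" by simp
      then show ?thesis by (simp only: powr_add mult.assoc)
    qed
    moreover have "(E * K powr (- 1 - d)) * K powr (-1) \<le> (c * D / 4) * K powr (-1)"
      using elim(4) by (intro mult_right_mono) (auto simp: K_def)
    moreover have "K powr (-1) = 1 / K" using K by simp
    then have "(c * D / 4) * K powr (-1) = (c * D / 4) / K" by (simp only: times_divide_eq_right mult_1_right)
    moreover have "(c * D / 2) / K = (c * D / 4) / K + (c * D / 4) / K" by simp
    ultimately show ?case unfolding K_def by linarith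
  qed
  then show False by (rule no_harmonic_descent[rotated 2]) (use c D nonneg in auto)
qed

text \<open>The Lyapunov function \<open>A + \<theta> p\<^sup>2\<close> turns the descent of \<open>A\<close> into a contraction, so that a rate for
  \<open>A\<close> passes to \<open>p\<^sup>2\<close> although \<open>p\<close> itself need not be monotone.\<close>
lemma step_rate_from_level_rate:
  fixes A p :: "nat \<Rightarrow> real" and d a b E :: real
  assumes d: "0 < d" "d < 1" and a: "a \<ge> 0" and b: "b > 0" and E: "E \<ge> 0" and p: "\<And>k. p k \<ge> 0"
    and growth: "\<forall>\<^sub>F k in sequentially. p (Suc k) \<le> (1 + a * (real k + 1) powr (- d)) * (p k + E * (real k + 1) powr (-1))"
    and descent: "\<forall>\<^sub>F k in sequentially. A (Suc k) \<le> A k - b * (p k)\<^sup>2 * (real k + 1) powr (- d) + E * (real k + 1) powr (- 1 - d)"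
    and A: "(\<lambda>k. (real k + 1) powr (1 - d) * A k) \<longlonglongrightarrow> 0"
  shows "(\<lambda>k. (real k + 1) powr (1 - d) * (p k)\<^sup>2) \<longlonglongrightarrow> 0"
proof -
  \<comment> \<open>\<open>a'\<close> bounds the growth of \<open>p^2\<close>:
    \<open>(1 + a * x)^2 * (1 + x) \<le> 1 + a' * x\<close> for \<open>x\<close> in
    \<open>[0, 1]\<close>. The weight \<open>th\<close> makes \<open>b = 2 * a' * th\<close>: half
    of the descent pays for this growth, the other half contracts \<open>th * p^2\<close> by the
    factor \<open>1 - a' * x\<close>.\<close>
  define a' where "a' = 2 * (1 + a)\<^sup>2"
  define E' where "E' = a' * E\<^sup>2"
  define th where "th = b / (2 * a')"
  have a': "a' \<ge> 2" using a by (simp add: a'_def one_le_power)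
  have E': "E' \<ge> 0" using a' by (simp add: E'_def)
  have th: "th > 0" using a' b by (simp add: th_def)
  define B where "B k = A k + th * (p k)\<^sup>2" for k
  \<comment> \<open>\<open>A\<close> may be negative, the objective lying below its level. Only the
    positive part of \<open>B\<close> is contracted; \<open>|A|\<close> is added back at the
    end.\<close>
  define z where "z k = (real k + 1) powr (1 - d) * max (B k) 0" for k
  have p_step: "\<forall>\<^sub>F k in sequentially. (p (Suc k))\<^sup>2 \<le> (p k)\<^sup>2 + a' * (real k + 1) powr (- d) * (p k)\<^sup>2 + E' * (real k + 1) powr (d - 2)"
    using growth
  proof eventually_elim
    case (elim k)
    define K where "K = real k + 1"
    define x where "x = K powr (- d)"
    have K: "K \<ge> 1" by (simp add: K_def)
    have x: "x > 0" "x \<le> 1" using K d powr_mono[of "- d" 0 K] by (auto simp: x_def)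
    have F: "(1 + a * x)\<^sup>2 * (1 + x) \<le> 1 + a' * x"
    proof -
      have xx: "x * x \<le> x" using x by simp
      have "(1 + a * x)\<^sup>2 = 1 + 2 * a * x + a\<^sup>2 * (x * x)" by (simp add: power2_eq_square algebra_simps)
      also have "\<dots> \<le> 1 + 2 * a * x + a\<^sup>2 * x" using xx by (intro add_left_mono mult_left_mono) auto
      finally have "(1 + a * x)\<^sup>2 \<le> 1 + (2 * a + a\<^sup>2) * x" by (simp add: algebra_simps)
      then have "(1 + a * x)\<^sup>2 * (1 + x) \<le> (1 + (2 * a + a\<^sup>2) * x) * (1 + x)"
        using x by (intro mult_right_mono) auto
      also have "\<dots> = 1 + x + (2 * a + a\<^sup>2) * x + (2 * a + a\<^sup>2) * (x * x)" by (simp add: algebra_simps)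
      also have "\<dots> \<le> 1 + x + (2 * a + a\<^sup>2) * x + (2 * a + a\<^sup>2) * x"
        using xx a by (intro add_left_mono mult_left_mono) auto
      also have "\<dots> \<le> 1 + a' * x" using x by (simp add: a'_def power2_eq_square algebra_simps)
      finally show ?thesis .
    qed
    \<comment> \<open>Young's inequality with weight \<open>x = K^(-d)\<close>: the factor
      \<open>1 + x\<close> on \<open>p^2\<close> is of the order of the growth already allowed, and
      the error becomes \<open>K^(-2) / x = K^(d-2)\<close>.\<close>
    have Y: "(p k + E * K powr (-1))\<^sup>2 \<le> (1 + x) * ((p k)\<^sup>2 + E\<^sup>2 * K powr (d - 2))"
    proof -
      have e1: "K powr (d - 2) = (K powr (-1))\<^sup>2 / x" using K
        by (simp add: x_def power2_eq_square powr_minus powr_diff powr_add[symmetric] field_simps)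
      define q where "q = E * K powr (-1)"
      have "(1 + x) * ((p k)\<^sup>2 + q\<^sup>2 / x) - (p k + q)\<^sup>2 = (x * p k - q)\<^sup>2 / x"
        using x by (simp add: power2_eq_square field_simps)
      moreover have "(x * p k - q)\<^sup>2 / x \<ge> 0" using x by simp
      ultimately have "(p k + q)\<^sup>2 \<le> (1 + x) * ((p k)\<^sup>2 + q\<^sup>2 / x)" by linarith
      then show ?thesis unfolding e1 by (simp only: q_def power_mult_distrib times_divide_eq_right)
    qed
    have "(p (Suc k))\<^sup>2 \<le> ((1 + a * x) * (p k + E * K powr (-1)))\<^sup>2"
      using elim p by (intro power_mono) (auto simp: K_def x_def)
    also have "\<dots> = (1 + a * x)\<^sup>2 * (p k + E * K powr (-1))\<^sup>2" by (simp add: power_mult_distrib)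
    also have "\<dots> \<le> (1 + a * x)\<^sup>2 * ((1 + x) * ((p k)\<^sup>2 + E\<^sup>2 * K powr (d - 2)))"
      by (intro mult_left_mono Y) auto
    also have "\<dots> = (1 + a * x)\<^sup>2 * (1 + x) * (p k)\<^sup>2 + (1 + a * x)\<^sup>2 * (1 + x) * (E\<^sup>2 * K powr (d - 2))"
      by (simp add: algebra_simps)
    also have "\<dots> \<le> (1 + a' * x) * (p k)\<^sup>2 + a' * (E\<^sup>2 * K powr (d - 2))"
    proof (intro add_mono mult_right_mono F)
      have "(1 + a * x)\<^sup>2 * (1 + x) \<le> (1 + a)\<^sup>2 * 2"
        using x a by (intro mult_mono power_mono add_left_mono) (auto intro: mult_left_le)
      then show "(1 + a * x)\<^sup>2 * (1 + x) \<le> a'" by (simp add: a'_def)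
    qed auto
    finally show ?case by (simp add: K_def x_def E'_def algebra_simps)
  qed
  have errlim: "(\<lambda>k. 2 * a' * \<bar>(real k + 1) powr (1 - d) * A k\<bar>
      + 2 * (E * (real k + 1) powr (- d) + th * E' * (real k + 1) powr (d - 1))) \<longlonglongrightarrow> 2 * a' * \<bar>0\<bar> + 2 * (E * 0 + th * E' * 0)"
    using d by (intro tendsto_intros powr_Suc_tendsto_0 A) auto
  \<comment> \<open>The scaled errors are eventually at most \<open>(a' / 2) * x * e\<close>, so the
    shifted sequence \<open>z - e\<close> contracts without any error; it drops below
    \<open>e\<close>, whence the bound \<open>2 * e\<close>.\<close>
  have small: "\<forall>\<^sub>F k in sequentially. z k \<le> 2 * e" if e: "e > 0" for e
  proof -
    have n1: "\<forall>\<^sub>F k in sequentially. 2 * a' * \<bar>(real k + 1) powr (1 - d) * A k\<bar>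
      + 2 * (E * (real k + 1) powr (- d) + th * E' * (real k + 1) powr (d - 1)) < a' / 2 * e"
      by (rule order_tendstoD(2)[OF errlim]) (use e a' in simp)
    have n2: "\<forall>\<^sub>F k in sequentially. (real k + 1) powr (d - 1) < a' / 2"
      by (rule order_tendstoD(2)[OF powr_Suc_tendsto_0]) (use d a' in auto)
    have n3: "\<forall>\<^sub>F k in sequentially. (real k + 1) powr (- d) < 1 / a'"
      by (rule order_tendstoD(2)[OF powr_Suc_tendsto_0]) (use d a' in auto)
    have "\<forall>\<^sub>F k in sequentially. z (Suc k) - e \<le> (1 - a' / 2 * (real k + 1) powr (- d)) * (z k - e)"
      using p_step descent n1 n2 n3
    proof eventually_elim
      case (elim k)
      define K where "K = real k + 1"
      define x where "x = K powr (- d)"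
      define r where "r = K powr (1 - d)"
      define R where "R = (real (Suc k) + 1) powr (1 - d)"
      have K: "K \<ge> 1" by (simp add: K_def)
      have x: "x > 0" "a' * x \<le> 1" using K elim(5) a' by (auto simp: x_def K_def field_simps)
      have r0: "r > 0" using K by (simp add: r_def)
      have rR: "r \<le> R" "R \<le> r * (1 + 1 / K)"
        using powr_Suc_ratio[of "1 - d" k] d by (auto simp: r_def R_def K_def)
      have R0: "R > 0" using rR r0 by simp
      have "r * (1 + 1 / K) \<le> r * 2" using r0 K by (intro mult_left_mono) (auto simp: field_simps)
      then have R2: "R \<le> 2 * r" using rR by simp
      define err where "err = E * K powr (- 1 - d) + th * E' * K powr (d - 2)"
      have err0: "err \<ge> 0" using E E' th by (simp add: err_def)
      have bth: "b = 2 * a' * th" using a' by (simp add: th_def)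
      have "th * (p (Suc k))\<^sup>2 \<le> th * ((p k)\<^sup>2 + a' * x * (p k)\<^sup>2 + E' * K powr (d - 2))"
        using elim(1) th by (intro mult_left_mono) (auto simp: K_def x_def)
      then have "B (Suc k) \<le> A k - b * (p k)\<^sup>2 * x + E * K powr (- 1 - d) + th * ((p k)\<^sup>2 + a' * x * (p k)\<^sup>2 + E' * K powr (d - 2))"
        using elim(2) unfolding B_def K_def x_def by linarith
      also have "\<dots> = (1 - a' * x) * B k + a' * x * A k + err"
        unfolding bth B_def err_def by (simp add: algebra_simps)
      finally have "B (Suc k) \<le> (1 - a' * x) * B k + a' * x * A k + err" .
      moreover have "(1 - a' * x) * B k \<le> (1 - a' * x) * max (B k) 0"
        using x(2) by (intro mult_left_mono) auto
      moreover have "a' * x * A k \<le> a' * x * \<bar>A k\<bar>" using x a' by (intro mult_left_mono) auto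
      moreover have "0 \<le> (1 - a' * x) * max (B k) 0" "0 \<le> a' * x * \<bar>A k\<bar>" using x a' by auto
      ultimately have "max (B (Suc k)) 0 \<le> (1 - a' * x) * max (B k) 0 + (a' * x * \<bar>A k\<bar> + err)"
        using err0 by simp
      then have "z (Suc k) \<le> R * ((1 - a' * x) * max (B k) 0 + (a' * x * \<bar>A k\<bar> + err))"
        unfolding z_def R_def[symmetric] using R0 by (intro mult_left_mono) auto
      also have "\<dots> = R * ((1 - a' * x) * max (B k) 0) + R * (a' * x * \<bar>A k\<bar> + err)"
        by (simp add: distrib_left)
      also have "\<dots> \<le> (r * (1 + 1 / K)) * ((1 - a' * x) * max (B k) 0) + (2 * r) * (a' * x * \<bar>A k\<bar> + err)"
        using rR R2 x a' err0 by (intro add_mono mult_right_mono) auto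
      also have "(r * (1 + 1 / K)) * ((1 - a' * x) * max (B k) 0) = ((1 + 1 / K) * (1 - a' * x)) * z k"
        by (simp add: z_def r_def K_def mult_ac)
      \<comment> \<open>The change of scale costs \<open>1 / K = x * K^(d-1)\<close>, which is
        eventually at most half of the contraction \<open>a' * x\<close>.\<close>
      also have "\<dots> \<le> (1 - a' / 2 * x) * z k"
      proof (rule mult_right_mono)
        have "1 / K = K powr (-1)" using K by (simp add: powr_minus divide_inverse)
        also have "\<dots> = K powr (- d + (d - 1))" by simp
        also have "\<dots> = x * K powr (d - 1)" by (simp only: powr_add x_def)
        also have "\<dots> \<le> x * (a' / 2)" using elim(4) x by (intro mult_left_mono) (auto simp: K_def)
        finally have i: "1 / K \<le> a' / 2 * x" by (simp add: mult.commute)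
        have "(1 + 1 / K) * (1 - a' * x) = 1 - a' * x + 1 / K - 1 / K * (a' * x)" by (simp add: algebra_simps)
        moreover have "0 \<le> 1 / K * (a' * x)" using K x a' by simp
        ultimately show "(1 + 1 / K) * (1 - a' * x) \<le> 1 - a' / 2 * x" using i by linarith
        show "0 \<le> z k" by (simp add: z_def)
      qed
      also have "(2 * r) * (a' * x * \<bar>A k\<bar> + err) \<le> a' / 2 * x * e"
      proof -
        have q1: "r * K powr (- 1 - d) = x * K powr (- d)" "r * K powr (d - 2) = x * K powr (d - 1)"
          by (simp_all only: r_def x_def powr_add[symmetric]) simp_all
        have "(2 * r) * (a' * x * \<bar>A k\<bar> + err) = 2 * a' * x * (r * \<bar>A k\<bar>) + 2 * (E * (r * K powr (- 1 - d)) + th * E' * (r * K powr (d - 2)))"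
          by (simp add: err_def algebra_simps)
        also have "\<dots> = x * (2 * a' * \<bar>r * A k\<bar> + 2 * (E * K powr (- d) + th * E' * K powr (d - 1)))"
          unfolding q1 using r0 by (simp add: abs_mult algebra_simps)
        also have "\<dots> \<le> x * (a' / 2 * e)"
          using elim(3) x by (intro mult_left_mono) (auto simp: K_def r_def)
        finally show ?thesis by (simp add: mult_ac)
      qed
      finally have "z (Suc k) \<le> (1 - a' / 2 * x) * z k + a' / 2 * x * e" by simp
      moreover have "(1 - t) * z k + t * e - e = (1 - t) * (z k - e)" for t by (simp add: algebra_simps)
      ultimately have "z (Suc k) - e \<le> (1 - a' / 2 * x) * (z k - e)" by (metis diff_right_mono)
      then show ?case by (simp only: x_def K_def)
    qed
    moreover have "\<forall>\<^sub>F k in sequentially. (a' / 2) / (real k + 1) \<le> a' / 2 * (real k + 1) powr (- d) \<and> a' / 2 * (real k + 1) powr (- d) \<le> 1"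
      using n3
    proof eventually_elim
      case (elim k)
      have "1 / (real k + 1) = (real k + 1) powr (-1)" by (simp add: powr_minus divide_inverse)
      also have "\<dots> \<le> (real k + 1) powr (- d)" using d by (intro powr_mono) auto
      finally have "a' / 2 * (1 / (real k + 1)) \<le> a' / 2 * (real k + 1) powr (- d)"
        using a' by (intro mult_left_mono) auto
      moreover have "a' * (real k + 1) powr (- d) < 1" using elim a' by (simp add: field_simps)
      ultimately show ?case by simp
    qed
    ultimately have "\<forall>\<^sub>F k in sequentially. z k - e \<le> e"
      using a' e by (intro contraction_eventually_small[of "\<lambda>k. z k - e" "\<lambda>k. a' / 2 * (real k + 1) powr (- d)" "a' / 2" e]) auto
    then show ?thesis by eventually_elim simp
  qed
  have z_lim: "z \<longlonglongrightarrow> 0"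
  proof (rule tendstoI)
    fix e :: real assume "e > 0"
    then have "\<forall>\<^sub>F k in sequentially. z k \<le> 2 * (e / 4)" by (intro small) simp
    then show "\<forall>\<^sub>F k in sequentially. dist (z k) 0 < e"
    proof eventually_elim
      case (elim k)
      have "z k \<ge> 0" by (simp add: z_def)
      then show ?case using elim \<open>e > 0\<close> by (simp add: dist_real_def)
    qed
  qed
  have "(\<lambda>k. (1 / th) * (z k + \<bar>(real k + 1) powr (1 - d) * A k\<bar>)) \<longlonglongrightarrow> (1 / th) * (0 + \<bar>0\<bar>)"
    by (intro tendsto_intros z_lim A)
  then have lim: "(\<lambda>k. (1 / th) * (z k + \<bar>(real k + 1) powr (1 - d) * A k\<bar>)) \<longlonglongrightarrow> 0" by simp
  show ?thesis
  proof (rule Lim_null_comparison[OF always_eventually lim], rule allI)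
    fix k
    let ?r = "(real k + 1) powr (1 - d)"
    have "th * (p k)\<^sup>2 \<le> max (B k) 0 + \<bar>A k\<bar>" by (simp add: B_def)
    then have "?r * (th * (p k)\<^sup>2) \<le> ?r * (max (B k) 0 + \<bar>A k\<bar>)" by (intro mult_left_mono) auto
    also have "\<dots> = z k + \<bar>?r * A k\<bar>" by (simp add: z_def abs_mult distrib_left)
    finally have "th * (?r * (p k)\<^sup>2) \<le> z k + \<bar>?r * A k\<bar>" by (simp add: mult_ac)
    then show "norm (?r * (p k)\<^sup>2) \<le> (1 / th) * (z k + \<bar>?r * A k\<bar>)"
      using th by (simp add: field_simps)
  qed
qed

section \<open>The smoothed loss and the cells of the objective\<close>

text \<open>\<open>Lam\<close> is any bound on the Gram form, not necessarily the eigenvalue. With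
  \<open>Lam = 2 * (beta * c)\<close> the curvature bound \<open>Lam / (2 * mu)\<close> of the loss
  is exactly the prox weight of the step.\<close>

locale quantile_data =
  fixes S :: "'s set" and b :: "'s \<Rightarrow> 'a::real_inner" and y :: "'s \<Rightarrow> real" and tau Lam :: real
  assumes finS: "finite S" and tau: "0 < tau" "tau < 1"
    and Lam: "Lam \<ge> 0" and gram: "\<And>z. (\<Sum>s\<in>S. (b s \<bullet> z)\<^sup>2) \<le> Lam * (norm z)\<^sup>2"
begin

definition loss :: "'a \<Rightarrow> real \<Rightarrow> real" where
  "loss w mu = (\<Sum>s\<in>S. fsmooth (y s - b s \<bullet> w) mu / 2 + (tau - 1/2) * (y s - b s \<bullet> w))"

definition dloss :: "'a \<Rightarrow> real \<Rightarrow> 'a" where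
  "dloss w mu = - (\<Sum>s\<in>S. (huber_slope (y s - b s \<bullet> w) mu / 2 + (tau - 1/2)) *\<^sub>R b s)"

lemma dloss_inner:
  "dloss w mu \<bullet> z = (\<Sum>s\<in>S. - ((huber_slope (y s - b s \<bullet> w) mu / 2 + (tau - 1/2)) * (b s \<bullet> z)))"
  by (simp add: dloss_def inner_sum_left sum_negf)

lemma loss_lower:
  assumes "mu > 0"
  shows "loss w mu + dloss w mu \<bullet> (u - w) \<le> loss u mu"
  unfolding loss_def dloss_inner sum.distrib[symmetric]
proof (rule sum_mono)
  fix s assume "s \<in> S"
  let ?r = "y s - b s \<bullet> w" and ?z = "b s \<bullet> (u - w)"
  have e: "y s - b s \<bullet> u = ?r - ?z" by (simp add: inner_diff_right)
  have "fsmooth ?r mu - huber_slope ?r mu * ?z \<le> fsmooth (?r - ?z) mu"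
    using fsmooth_lower[OF assms, of ?r "?r - ?z"] by simp
  then show "fsmooth ?r mu / 2 + (tau - 1/2) * ?r + - ((huber_slope ?r mu / 2 + (tau - 1/2)) * ?z)
      \<le> fsmooth (y s - b s \<bullet> u) mu / 2 + (tau - 1/2) * (y s - b s \<bullet> u)"
    unfolding e distrib_right right_diff_distrib[of "tau - 1/2" ?r] by linarith
qed

lemma loss_upper:
  assumes "mu > 0"
  shows "loss u mu \<le> loss w mu + dloss w mu \<bullet> (u - w) + Lam / (4 * mu) * (norm (u - w))\<^sup>2"
proof -
  have "loss u mu \<le> loss w mu + dloss w mu \<bullet> (u - w) + (\<Sum>s\<in>S. (b s \<bullet> (u - w))\<^sup>2 / (4 * mu))"
    unfolding loss_def dloss_inner sum.distrib[symmetric]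
  proof (rule sum_mono)
    fix s assume "s \<in> S"
    let ?r = "y s - b s \<bullet> w" and ?z = "b s \<bullet> (u - w)"
    have e: "y s - b s \<bullet> u = ?r - ?z" by (simp add: inner_diff_right)
    have "fsmooth (?r - ?z) mu \<le> fsmooth ?r mu - huber_slope ?r mu * ?z + ?z\<^sup>2 / (2 * mu)"
      using fsmooth_upper[OF assms, of "?r - ?z" ?r] by simp
    then show "fsmooth (y s - b s \<bullet> u) mu / 2 + (tau - 1/2) * (y s - b s \<bullet> u)
      \<le> fsmooth ?r mu / 2 + (tau - 1/2) * ?r + - ((huber_slope ?r mu / 2 + (tau - 1/2)) * ?z) + ?z\<^sup>2 / (4 * mu)"
      unfolding e distrib_right right_diff_distrib[of "tau - 1/2" ?r] using assms by (simp add: field_simps)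
  qed
  also have "(\<Sum>s\<in>S. (b s \<bullet> (u - w))\<^sup>2 / (4 * mu)) \<le> Lam / (4 * mu) * (norm (u - w))\<^sup>2"
    using gram[of "u - w"] assms by (simp add: divide_right_mono flip: sum_divide_distrib)
  finally show ?thesis by simp
qed

lemma loss_gderiv:
  assumes "mu > 0"
  shows "GDERIV (\<lambda>w. loss w mu) w :> dloss w mu"
proof (rule gderiv_of_quadratic_bound[where C = "Lam / (4 * mu)"])
  fix u
  have "0 \<le> Lam / (4 * mu) * (norm (u - w))\<^sup>2" using Lam assms by simp
  then show "\<bar>loss u mu - loss w mu - dloss w mu \<bullet> (u - w)\<bar> \<le> Lam / (4 * mu) * (norm (u - w))\<^sup>2"
    using loss_lower[OF assms, of w u] loss_upper[OF assms, of u w] by linarith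
qed

lemma loss_nonneg:
  assumes "mu > 0"
  shows "loss w mu \<ge> 0"
  unfolding loss_def
proof (rule sum_nonneg)
  fix s assume "s \<in> S"
  let ?r = "y s - b s \<bullet> w"
  have "\<bar>(tau - 1/2) * ?r\<bar> \<le> 1/2 * \<bar>?r\<bar>"
  proof -
    have "\<bar>tau - 1/2\<bar> \<le> 1/2" using tau by linarith
    then show ?thesis unfolding abs_mult by (intro mult_right_mono) auto
  qed
  then have "- ((tau - 1/2) * ?r) \<le> 1/2 * \<bar>?r\<bar>" by (rule abs_le_D2)
  moreover have "0 \<le> f / 2 + t" if "- t \<le> 1/2 * R" "R \<le> f" for t R f :: real using that by linarith
  ultimately show "0 \<le> fsmooth ?r mu / 2 + (tau - 1/2) * ?r"
    using fsmooth_ge_abs[OF assms, of ?r] by blast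
qed

lemma loss_mono: "0 < mu \<Longrightarrow> mu \<le> mu' \<Longrightarrow> loss w mu \<le> loss w mu'"
  unfolding loss_def by (intro sum_mono add_right_mono divide_right_mono fsmooth_mono) auto

lemma dloss_mu_diff:
  assumes "0 < mu'" "mu' \<le> mu"
  shows "norm (dloss w mu' - dloss w mu) \<le> (\<Sum>s\<in>S. norm (b s)) * (1 - mu' / mu)"
proof -
  have "dloss w mu' - dloss w mu =
      (\<Sum>s\<in>S. ((huber_slope (y s - b s \<bullet> w) mu - huber_slope (y s - b s \<bullet> w) mu') / 2) *\<^sub>R b s)"
    unfolding dloss_def by (simp add: sum_subtractf[symmetric] scaleR_diff_left[symmetric] diff_divide_distrib)
  also have "norm \<dots> \<le> (\<Sum>s\<in>S. (1 - mu' / mu) * norm (b s))"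
  proof (rule sum_norm_le)
    fix s
    have "\<bar>(huber_slope (y s - b s \<bullet> w) mu - huber_slope (y s - b s \<bullet> w) mu') / 2\<bar> \<le> 1 - mu' / mu"
    proof -
      have "\<bar>(p - q) / 2\<bar> \<le> e" if "\<bar>q - p\<bar> \<le> e" for p q e :: real
        using that by (simp add: abs_le_iff)
      then show ?thesis using huber_slope_diff_mu[OF assms, of "y s - b s \<bullet> w"] by blast
    qed
    then show "norm (((huber_slope (y s - b s \<bullet> w) mu - huber_slope (y s - b s \<bullet> w) mu') / 2) *\<^sub>R b s)
        \<le> (1 - mu' / mu) * norm (b s)"
      unfolding norm_scaleR real_norm_def by (intro mult_right_mono) auto
  qed
  finally show ?thesis unfolding sum_distrib_left[symmetric] by (simp only: mult.commute)
qed

text \<open>Co-coercivity gives \<open>|h|^2 \<le> sg * (h \<bullet> z)\<close> for the gradient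
  difference \<open>h\<close>, so expanding the square leaves at most \<open>(sg * |z|)^2\<close>.
  The Lipschitz bound alone would yield the factor 2, too much for the step growth.\<close>

lemma gradient_step_nonexpansive:
  assumes mu: "mu > 0" and sg: "Lam / (2 * mu) \<le> sg"
  shows "norm (dloss u mu - dloss w mu - sg *\<^sub>R (u - w)) \<le> sg * norm (u - w)"
proof -
  define t where "t s = (huber_slope (y s - b s \<bullet> w) mu - huber_slope (y s - b s \<bullet> u) mu) / 2" for s
  define z where "z = u - w"
  define h where "h = (\<Sum>s\<in>S. t s *\<^sub>R b s)"
  have h: "dloss u mu - dloss w mu = h"
    unfolding dloss_def h_def t_def
    by (simp add: sum_subtractf[symmetric] scaleR_diff_left[symmetric] diff_divide_distrib)
  have "2 * mu * (\<Sum>s\<in>S. (t s)\<^sup>2) \<le> (\<Sum>s\<in>S. t s * (b s \<bullet> z))"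
    unfolding sum_distrib_left
  proof (rule sum_mono)
    fix s
    show "2 * mu * (t s)\<^sup>2 \<le> t s * (b s \<bullet> z)"
      using huber_slope_coercive[OF mu, of "y s - b s \<bullet> w" "y s - b s \<bullet> u"]
      by (simp add: t_def z_def inner_diff_right power_divide)
  qed
  also have "\<dots> = h \<bullet> z" by (simp add: h_def inner_sum_left)
  finally have hz: "2 * mu * (\<Sum>s\<in>S. (t s)\<^sup>2) \<le> h \<bullet> z" .
  have sq: "0 \<le> (\<Sum>s\<in>S. (t s)\<^sup>2)" by (simp add: sum_nonneg)
  have hz0: "0 \<le> h \<bullet> z" using hz sq mu by (smt (verit) mult_nonneg_nonneg)
  have "(norm h)\<^sup>2 \<le> Lam * (\<Sum>s\<in>S. (t s)\<^sup>2)"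
    unfolding h_def by (rule gram_bound_dual[OF gram Lam])
  also have "\<dots> = Lam / (2 * mu) * (2 * mu * (\<Sum>s\<in>S. (t s)\<^sup>2))" using mu by simp
  also have "\<dots> \<le> Lam / (2 * mu) * (h \<bullet> z)" using hz Lam mu by (intro mult_left_mono) auto
  also have "\<dots> \<le> sg * (h \<bullet> z)" using sg hz0 by (rule mult_right_mono)
  finally have "(norm h)\<^sup>2 \<le> sg * (h \<bullet> z)" .
  moreover have "(norm (h - sg *\<^sub>R z))\<^sup>2 = (norm h)\<^sup>2 - 2 * (sg * (h \<bullet> z)) + (sg * norm z)\<^sup>2"
    unfolding power_mult_distrib power2_norm_eq_inner
    by (simp add: inner_diff_left inner_diff_right inner_commute power2_eq_square)
  moreover have sg0: "sg \<ge> 0"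
    using sg Lam mu by (smt (verit) divide_nonneg_pos)
  then have "0 \<le> sg * (h \<bullet> z)" using hz0 by simp
  ultimately have "(norm (h - sg *\<^sub>R z))\<^sup>2 \<le> (sg * norm z)\<^sup>2" by linarith
  then have "norm (h - sg *\<^sub>R z) \<le> sg * norm z"
    by (rule power2_le_imp_le) (use sg0 in simp)
  then show ?thesis unfolding h z_def .
qed

end

section \<open>The penalised objective and its uniform KL inequality\<close>

locale quantile_vec = quantile_data S b y tau Lam
  for S :: "'s set" and b :: "'s \<Rightarrow> real^'n" and y tau Lam +
  fixes i0 :: 'n and N :: real and g :: "real \<Rightarrow> real" and T :: "(real \<times> real \<times> real) set"
  assumes N: "N > 0" and pieces: "penalty_pieces g T"
begin

definition obj :: "real^'n \<Rightarrow> real \<Rightarrow> real" where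
  "obj w mu = loss w mu + N * penalty g i0 w"

lemma penalty_nonneg: "penalty g i0 w \<ge> 0"
  using pieces unfolding penalty_def penalty_pieces_def by (auto intro: sum_nonneg)

lemma obj_nonneg: "mu > 0 \<Longrightarrow> obj w mu \<ge> 0"
  using loss_nonneg penalty_nonneg N unfolding obj_def by simp

text \<open>Penalised coordinates that vanish are left unconstrained: on the cell they are frozen at
  0, and the quadratic has no derivative in them. Quantifying over all \<open>D\<close> avoids
  choosing a derivative of \<open>g\<close>.\<close>

definition critical_residual :: "real^'n \<Rightarrow> real \<Rightarrow> real^'n \<Rightarrow> bool" where
  "critical_residual x mu kap \<longleftrightarrow> kap $ i0 = dloss x mu $ i0 \<and>
     (\<forall>p. p \<noteq> i0 \<and> x $ p \<noteq> 0 \<longrightarrow>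
       (\<forall>D. (g has_real_derivative D) (at (x $ p)) \<longrightarrow> kap $ p = dloss x mu $ p + N * D))"

text \<open>On each cell --- a sign pattern of the residuals relative to \<open>mu\<close> together with a piece of the
  penalty, or the value \<open>0\<close>, for each coordinate --- the objective is one of finitely many
  quadratics, restricted to the subspace on which the vanishing coordinates are \<open>0\<close>.\<close>
lemma obj_KL:
  "\<exists>V C g0 m. finite V \<and> (\<forall>v\<in>V. ratfun v) \<and> C \<ge> 1 \<and> g0 > 0 \<and> m > 0 \<and>
    (\<forall>mu\<in>{0<..<m}. \<forall>x kap. critical_residual x mu kap \<and> norm kap < g0 \<longrightarrow>
       (\<exists>v\<in>V. \<bar>obj x mu - v mu\<bar> \<le> C * (norm kap)\<^sup>2))"
proof -
  \<comment> \<open>Residual signs: 0 marks the quadratic zone, \<open>1\<close> and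
    \<open>-1\<close> the linear ones. Coordinates: \<open>None\<close> marks a frozen zero, and the
    extra triple \<open>(0, 0, 0)\<close> serves the unpenalised intercept.\<close>
  define codes where "codes = (PiE S (\<lambda>_. {-1, 0, 1::real})) \<times> (PiE (UNIV::'n set) (\<lambda>_. insert None (Some ` insert (0, 0, 0) T)))"
  have finT: "finite T" and qT: "\<And>q h c. (q, h, c) \<in> T \<Longrightarrow> q \<ge> 0" and g0: "g 0 = 0"
    and piece: "\<And>t. t \<noteq> 0 \<Longrightarrow> \<exists>(q, h, c)\<in>T. g t = c + h * t - q * t\<^sup>2 / 2 \<and>
                                 (g has_real_derivative h - q * t) (at t)"
    using pieces unfolding penalty_pieces_def by auto
  have fin_codes: "finite codes"
    unfolding codes_def using finS finT by (intro finite_cartesian_product finite_PiE) auto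
  define Q where "Q eta p = (case eta p of None \<Rightarrow> 0 | Some (q, h, c) \<Rightarrow> N * q)"
    for eta :: "'n \<Rightarrow> (real \<times> real \<times> real) option" and p
  define H where "H eta p = (case eta p of None \<Rightarrow> 0 | Some (q, h, c) \<Rightarrow> N * h)"
    for eta :: "'n \<Rightarrow> (real \<times> real \<times> real) option" and p
  define Cc where "Cc eta p = (case eta p of None \<Rightarrow> 0 | Some (q, h, c) \<Rightarrow> N * c)"
    for eta :: "'n \<Rightarrow> (real \<times> real \<times> real) option" and p
  define b' where "b' eta s = (\<chi> p. if eta p = None then 0 else b s $ p)"
    for eta :: "'n \<Rightarrow> (real \<times> real \<times> real) option" and s
  define A where "A ep = {s\<in>S. ep s = 0}" for ep :: "'s \<Rightarrow> real"
  define lin where "lin ep s = ep s / 2 + (tau - 1/2)" for ep :: "'s \<Rightarrow> real" and s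
  define h where "h ep eta = (\<chi> p. H eta p) - (\<Sum>s\<in>S. lin ep s *\<^sub>R b' eta s)" for ep eta
  define c0 where "c0 ep eta = (\<Sum>p\<in>UNIV. Cc eta p) + (\<Sum>s\<in>S. lin ep s * y s)" for ep eta
  define c1 where "c1 ep = (\<Sum>s\<in>A ep. 1 / 4 :: real)" for ep
  define Psi where "Psi ep eta mu x = (\<Sum>i\<in>A ep. (y i - b' eta i \<bullet> x)\<^sup>2) / (4 * mu)
      - (\<Sum>p\<in>UNIV. Q eta p * (x $ p)\<^sup>2) / 2 + h ep eta \<bullet> x + c0 ep eta + c1 ep * mu" for ep eta mu x
  define dPsi where "dPsi ep eta mu x = h ep eta - (\<Sum>i\<in>A ep. (y i - b' eta i \<bullet> x) *\<^sub>R b' eta i) /\<^sub>R (2 * mu)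
      - (\<chi> p. Q eta p * x $ p)" for ep eta mu x
  have "\<exists>v C g m. ratfun v \<and> g > 0 \<and> m > 0 \<and> (\<forall>mu\<in>{0<..<m}. \<forall>x. norm (dPsi ep eta mu x) < g \<longrightarrow>
      \<bar>Psi ep eta mu x - v mu\<bar> \<le> C * (norm (dPsi ep eta mu x))\<^sup>2)" if "(ep, eta) \<in> codes" for ep eta
    unfolding Psi_def dPsi_def
  proof (rule quadratic_KL)
    fix p
    have "eta \<in> PiE UNIV (\<lambda>_. insert None (Some ` insert (0, 0, 0) T))"
      using that unfolding codes_def by blast
    then have "eta p \<in> insert None (Some ` insert (0, 0, 0) T)" by (rule PiE_mem) simp
    then show "0 \<le> Q eta p" using qT N by (auto simp: Q_def)
  qed
  then have "\<forall>ce\<in>codes. \<exists>v C g m. ratfun v \<and> g > 0 \<and> m > 0 \<and> (\<forall>mu\<in>{0<..<m}. \<forall>x. norm (dPsi (fst ce) (snd ce) mu x) < g \<longrightarrow>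
      \<bar>Psi (fst ce) (snd ce) mu x - v mu\<bar> \<le> C * (norm (dPsi (fst ce) (snd ce) mu x))\<^sup>2)"
    by auto
  then obtain v C gg m where KL: "\<And>ce. ce \<in> codes \<Longrightarrow> ratfun (v ce)" "\<And>ce. ce \<in> codes \<Longrightarrow> gg ce > 0"
    "\<And>ce. ce \<in> codes \<Longrightarrow> m ce > 0"
    "\<And>ce mu x. ce \<in> codes \<Longrightarrow> mu \<in> {0<..<m ce} \<Longrightarrow> norm (dPsi (fst ce) (snd ce) mu x) < gg ce \<Longrightarrow>
      \<bar>Psi (fst ce) (snd ce) mu x - v ce mu\<bar> \<le> C ce * (norm (dPsi (fst ce) (snd ce) mu x))\<^sup>2"
    by metis
  define C' where "C' = 1 + (\<Sum>ce\<in>codes. \<bar>C ce\<bar>)"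
  define g' where "g' = Min (insert 1 (gg ` codes))"
  define m' where "m' = Min (insert 1 (m ` codes))"
  have C': "C' \<ge> 1" unfolding C'_def by (simp add: sum_nonneg)
  have CC': "C ce \<le> C'" if "ce \<in> codes" for ce
    using member_le_sum[of ce codes "\<lambda>ce. \<bar>C ce\<bar>"] that fin_codes unfolding C'_def by simp
  have g': "g' > 0" unfolding g'_def using fin_codes KL(2) by (auto simp: Min_gr_iff)
  have m': "m' > 0" unfolding m'_def using fin_codes KL(3) by (auto simp: Min_gr_iff)
  have gg': "g' \<le> gg ce" if "ce \<in> codes" for ce unfolding g'_def using fin_codes that by simp
  have mm': "m' \<le> m ce" if "ce \<in> codes" for ce unfolding m'_def using fin_codes that by simp
  have "\<exists>u\<in>v ` codes. \<bar>obj x mu - u mu\<bar> \<le> C' * (norm kap)\<^sup>2"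
    if mu: "mu \<in> {0<..<m'}" and kap: "critical_residual x mu kap" "norm kap < g'" for mu x kap
  proof -
    have mu0: "mu > 0" using mu by simp
    define r where "r s = y s - b s \<bullet> x" for s
    define ep where "ep = restrict (\<lambda>s. if r s \<ge> mu then 1 else if r s \<le> - mu then -1 else 0 :: real) S"
    have "\<exists>pc. (p = i0 \<longrightarrow> pc = Some (0, 0, 0)) \<and> (p \<noteq> i0 \<and> x $ p = 0 \<longrightarrow> pc = None) \<and>
        (p \<noteq> i0 \<and> x $ p \<noteq> 0 \<longrightarrow> (\<exists>q h c. pc = Some (q, h, c) \<and> (q, h, c) \<in> T \<and>
          g (x $ p) = c + h * x $ p - q * (x $ p)\<^sup>2 / 2 \<and> (g has_real_derivative h - q * x $ p) (at (x $ p))))" for p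
      using piece[of "x $ p"] by (cases "p = i0"; cases "x $ p = 0") auto
    then obtain eta where eta: "eta i0 = Some (0, 0, 0)" "\<And>p. p \<noteq> i0 \<Longrightarrow> x $ p = 0 \<Longrightarrow> eta p = None"
      "\<And>p. p \<noteq> i0 \<Longrightarrow> x $ p \<noteq> 0 \<Longrightarrow> \<exists>q h c. eta p = Some (q, h, c) \<and> (q, h, c) \<in> T \<and>
          g (x $ p) = c + h * x $ p - q * (x $ p)\<^sup>2 / 2 \<and> (g has_real_derivative h - q * x $ p) (at (x $ p))"
      by metis
    have "eta p \<in> insert None (Some ` insert (0, 0, 0) T)" for p
      using eta by (cases "p = i0"; cases "x $ p = 0") fastforce+
    then have "eta \<in> PiE UNIV (\<lambda>_. insert None (Some ` insert (0, 0, 0) T))" by (rule PiE_I) simp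
    moreover have "ep \<in> PiE S (\<lambda>_. {-1, 0, 1})" by (auto simp: ep_def)
    ultimately have code: "(ep, eta) \<in> codes" unfolding codes_def by blast
    have none: "x $ p = 0" if "eta p = None" for p
      using that eta(1) eta(3)[of p] by (cases "p = i0") auto
    have b'x: "b' eta s \<bullet> x = b s \<bullet> x" for s
      unfolding inner_vec_def by (rule sum.cong) (auto simp: b'_def none)
    have slope: "huber_slope (r s) mu = ep s + (if ep s = 0 then r s / mu else 0)" if "s \<in> S" for s
      using that mu0 by (simp add: ep_def huber_slope_eq)
    have fs: "fsmooth (r s) mu = ep s * r s + (if ep s = 0 then (r s)\<^sup>2 / (2 * mu) + mu / 2 else 0)" if "s \<in> S" for s
      using that mu0 by (auto simp: ep_def fsmooth_def abs_if)
    have sumA: "(\<Sum>s\<in>S. if ep s = 0 then f s else 0) = (\<Sum>s\<in>A ep. f s)" for f :: "'s \<Rightarrow> 'b::comm_monoid_add"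
      unfolding A_def using finS by (simp add: sum.inter_filter)
    have loss_eq: "loss x mu = (\<Sum>s\<in>S. lin ep s * r s) + (\<Sum>s\<in>A ep. (r s)\<^sup>2 / (4 * mu) + mu / 4)"
    proof -
      have "loss x mu = (\<Sum>s\<in>S. lin ep s * r s + (if ep s = 0 then (r s)\<^sup>2 / (4 * mu) + mu / 4 else 0))"
        unfolding loss_def r_def[symmetric]
        by (rule sum.cong) (auto simp: fs lin_def algebra_simps add_divide_distrib)
      then show ?thesis by (simp only: sum.distrib sumA)
    qed
    have pen_eq: "N * penalty g i0 x = (\<Sum>p\<in>UNIV. Cc eta p + H eta p * x $ p - Q eta p * (x $ p)\<^sup>2 / 2)"
    proof -
      have "(\<Sum>p\<in>UNIV. Cc eta p + H eta p * x $ p - Q eta p * (x $ p)\<^sup>2 / 2)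
         = (\<Sum>p\<in>UNIV - {i0}. Cc eta p + H eta p * x $ p - Q eta p * (x $ p)\<^sup>2 / 2)"
        by (rule sum.mono_neutral_right) (auto simp: eta(1) Cc_def H_def Q_def)
      also have "\<dots> = (\<Sum>p\<in>UNIV - {i0}. N * g (x $ p))"
      proof (rule sum.cong[OF refl])
        fix p assume p: "p \<in> UNIV - {i0}"
        show "Cc eta p + H eta p * x $ p - Q eta p * (x $ p)\<^sup>2 / 2 = N * g (x $ p)"
        proof (cases "x $ p = 0")
          case True
          then show ?thesis using eta(2)[of p] p g0 by (simp add: Cc_def)
        next
          case False
          then obtain q h c where e: "eta p = Some (q, h, c)" "g (x $ p) = c + h * x $ p - q * (x $ p)\<^sup>2 / 2"
            using eta(3)[of p] p by blast
          show ?thesis unfolding e(2) by (simp add: e(1) Cc_def H_def Q_def algebra_simps)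
        qed
      qed
      finally show ?thesis by (simp add: penalty_def sum_distrib_left)
    qed
    have obj_eq: "obj x mu = Psi ep eta mu x"
    proof -
      have "h ep eta \<bullet> x = (\<Sum>p\<in>UNIV. H eta p * x $ p) - (\<Sum>s\<in>S. lin ep s * (b s \<bullet> x))"
        by (simp add: h_def inner_diff_left inner_sum_left b'x inner_vec_def[of "\<chi> p. H eta p"])
      moreover have "(\<Sum>s\<in>S. lin ep s * r s) = (\<Sum>s\<in>S. lin ep s * y s) - (\<Sum>s\<in>S. lin ep s * (b s \<bullet> x))"
        by (simp add: r_def right_diff_distrib sum_subtractf)
      ultimately show ?thesis
        unfolding obj_def loss_eq pen_eq Psi_def b'x r_def[symmetric] c0_def c1_def
        by (simp add: sum.distrib sum_subtractf sum_divide_distrib sum_distrib_right)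
    qed
    have comp: "dPsi ep eta mu x $ p = (if eta p = None then 0 else kap $ p)" for p
    proof (cases "eta p = None")
      case True
      then show ?thesis
        by (simp add: dPsi_def h_def b'_def H_def Q_def)
    next
      case False
      have "dloss x mu $ p = - (\<Sum>s\<in>S. (huber_slope (r s) mu / 2 + (tau - 1/2)) * b s $ p)"
        by (simp add: dloss_def r_def)
      also have "(\<Sum>s\<in>S. (huber_slope (r s) mu / 2 + (tau - 1/2)) * b s $ p)
          = (\<Sum>s\<in>S. lin ep s * b s $ p + (if ep s = 0 then r s / (2 * mu) * b s $ p else 0))"
        by (rule sum.cong) (auto simp: slope lin_def algebra_simps)
      finally have dl: "dloss x mu $ p = - (\<Sum>s\<in>S. lin ep s * b s $ p) - (\<Sum>s\<in>A ep. r s / (2 * mu) * b s $ p)"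
        by (simp only: sum.distrib sumA minus_add_distrib diff_conv_add_uminus)
      have b'p: "b' eta s $ p = b s $ p" for s by (simp add: b'_def False del: not_None_eq)
      have "dPsi ep eta mu x $ p = H eta p - (\<Sum>s\<in>S. lin ep s * b s $ p)
          - inverse (2 * mu) * (\<Sum>s\<in>A ep. r s * b s $ p) - Q eta p * x $ p"
        unfolding dPsi_def h_def b'x r_def[symmetric] by (simp add: b'p)
      also have "inverse (2 * mu) * (\<Sum>s\<in>A ep. r s * b s $ p) = (\<Sum>s\<in>A ep. r s / (2 * mu) * b s $ p)"
        unfolding sum_distrib_left by (rule sum.cong) (simp_all add: field_simps)
      finally have dP: "dPsi ep eta mu x $ p = dloss x mu $ p + (H eta p - Q eta p * x $ p)"
        using dl by simp
      show ?thesis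
      proof (cases "p = i0")
        case True
        then show ?thesis using dP kap(1) eta(1) by (simp add: critical_residual_def H_def Q_def)
      next
        case p: False
        have xp: "x $ p \<noteq> 0"
        proof
          assume "x $ p = 0"
          then have "eta p = None" by (rule eta(2)[OF p])
          then show False using False by contradiction
        qed
        obtain q h c where e: "eta p = Some (q, h, c)" "(g has_real_derivative h - q * x $ p) (at (x $ p))"
          using eta(3)[OF p xp] by blast
        have "kap $ p = dloss x mu $ p + N * (h - q * x $ p)"
          using kap(1) p xp e(2) unfolding critical_residual_def by metis
        then show ?thesis unfolding dP by (simp add: e(1) H_def Q_def right_diff_distrib)
      qed
    qed
    have le: "norm (dPsi ep eta mu x) \<le> norm kap"
      by (rule norm_le_componentwise_cart) (simp add: comp)
    have "\<bar>Psi ep eta mu x - v (ep, eta) mu\<bar> \<le> C (ep, eta) * (norm (dPsi ep eta mu x))\<^sup>2"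
      using KL(4)[OF code, of mu x] mu mm'[OF code] gg'[OF code] le kap(2) by simp
    also have "\<dots> \<le> C' * (norm (dPsi ep eta mu x))\<^sup>2" using CC'[OF code] by (intro mult_right_mono) auto
    also have "\<dots> \<le> C' * (norm kap)\<^sup>2" using le C' by (intro mult_left_mono power_mono) auto
    finally show ?thesis using code obj_eq by (intro bexI[of _ "v (ep, eta)"]) auto
  qed
  then show ?thesis
    using fin_codes KL(1) C' g' m'
    by (intro exI[of _ "v ` codes"] exI[of _ C'] exI[of _ g'] exI[of _ m']) blast
qed

end

section \<open>The proximal gradient iteration\<close>

text \<open>\<open>m k\<close> and \<open>sg k\<close> are the parameters number
  \<open>k + 1\<close> of the algorithm, those of the step from \<open>w k\<close> to
  \<open>w (Suc k)\<close>. Minimality enters as \<open>prox\<close>, the optimality condition read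
  as a subgradient inequality with quadratic slack.\<close>

locale fspg = quantile_vec S b y tau "2 * (beta * c)" i0 N g T
  for S :: "'s set" and b :: "'s \<Rightarrow> real^'n" and y tau beta c i0 N g T +
  fixes d rho :: real and w :: "nat \<Rightarrow> real^'n" and m sg :: "nat \<Rightarrow> real"
  assumes c: "c > 0" and beta: "beta > 0" and d: "0 < d" "d < 1" and rho: "rho \<ge> 0"
    and m_def: "\<And>k. m k = beta / (real k + 1) powr d"
    and sg_def: "\<And>k. sg k = c * (real k + 1) powr d"
    and prox: "\<And>k u. N * penalty g i0 (w (Suc k))
        - (dloss (w k) (m k) + sg k *\<^sub>R (w (Suc k) - w k)) \<bullet> (u - w (Suc k))
        - N * rho / 2 * (norm (u - w (Suc k)))\<^sup>2 \<le> N * penalty g i0 u"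
begin

text \<open>The subtracted bracket is, up to sign, the element of \<open>N\<close> times the penalty
  subdifferential given by optimality of \<open>w (Suc k)\<close>; the gradient is taken with the
  parameter of the following step.\<close>

definition kap :: "nat \<Rightarrow> real^'n" where
  "kap k = dloss (w (Suc k)) (m (Suc k)) - (dloss (w k) (m k) + sg k *\<^sub>R (w (Suc k) - w k))"

definition step_size :: "nat \<Rightarrow> real" where
  "step_size k = sg k * norm (w (Suc k) - w k)"

text \<open>Taken with the smoothing parameter of the coming step: passing to \<open>Suc k\<close>
  moves the point at fixed \<open>m k\<close> and then only lowers the parameter.\<close>

definition Phi :: "nat \<Rightarrow> real" where
  "Phi k = obj (w k) (m k)"

definition E0 :: real where
  "E0 = (\<Sum>s\<in>S. norm (b s))"

section \<open>Estimates for a single step\<close>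

lemma m_pos: "m k > 0" and sg_pos: "sg k > 0"
  using beta c by (simp_all add: m_def sg_def)

lemma m_ratio: "m (Suc k) \<le> m k" "1 - m (Suc k) / m k \<le> 1 / (real k + 1)"
proof -
  let ?a = "(real k + 1) powr d" and ?a' = "(real (Suc k) + 1) powr d"
  have r: "?a \<le> ?a'" "?a' \<le> ?a * (1 + 1 / (real k + 1))"
    using powr_Suc_ratio[of d k] d by auto
  have a: "?a > 0" "?a' > 0" by simp_all
  show "m (Suc k) \<le> m k" using r(1) a beta unfolding m_def by (intro divide_left_mono) auto
  have "1 - m (Suc k) / m k = 1 - ?a / ?a'" using beta a by (simp add: m_def)
  also have "\<dots> = (?a' - ?a) / ?a'" using a by (simp add: field_simps)
  also have "\<dots> \<le> (?a' - ?a) / ?a" using r(1) a by (intro divide_left_mono) auto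
  also have "\<dots> = ?a' / ?a - 1" using a by (simp add: field_simps)
  also have "?a' / ?a \<le> 1 + 1 / (real k + 1)" using r(2) a by (simp add: pos_divide_le_eq mult.commute)
  finally show "1 - m (Suc k) / m k \<le> 1 / (real k + 1)" by simp
qed

lemma m_diff: "\<bar>m (Suc k) - m k\<bar> \<le> beta * (real k + 1) powr (- 1 - d)"
proof -
  have "\<bar>m (Suc k) - m k\<bar> = m k * (1 - m (Suc k) / m k)"
    using m_ratio(1)[of k] m_pos[of k] by (simp add: field_simps)
  also have "\<dots> \<le> m k * (1 / (real k + 1))"
    using m_ratio(2)[of k] m_pos[of k] by (intro mult_left_mono) auto
  also have "\<dots> = beta * ((real k + 1) powr (- d) * (real k + 1) powr (-1))"
    by (simp add: m_def powr_minus divide_inverse)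
  also have "\<dots> = beta * (real k + 1) powr (- 1 - d)" by (simp only: powr_add[symmetric]) (simp add: algebra_simps)
  finally show ?thesis .
qed

lemma sg_m: "2 * (beta * c) / (2 * m k) = sg k"
  using beta by (simp add: m_def sg_def)

text \<open>Moving the point at fixed \<open>mu\<close> is a nonexpansive gradient step and costs
  \<open>step_size k\<close>; changing \<open>mu\<close> at the new point costs the rest.\<close>

lemma norm_kap: "norm (kap k) \<le> step_size k + E0 / (real k + 1)"
proof -
  let ?u = "w (Suc k)"
  have "kap k = (dloss ?u (m k) - dloss (w k) (m k) - sg k *\<^sub>R (?u - w k)) + (dloss ?u (m (Suc k)) - dloss ?u (m k))"
    by (simp add: kap_def)
  then have "norm (kap k) \<le> norm (dloss ?u (m k) - dloss (w k) (m k) - sg k *\<^sub>R (?u - w k))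
      + norm (dloss ?u (m (Suc k)) - dloss ?u (m k))"
    by (metis norm_triangle_ineq)
  also have "norm (dloss ?u (m k) - dloss (w k) (m k) - sg k *\<^sub>R (?u - w k)) \<le> step_size k"
    unfolding step_size_def by (rule gradient_step_nonexpansive[OF m_pos eq_refl[OF sg_m]])
  also have "norm (dloss ?u (m (Suc k)) - dloss ?u (m k)) \<le> E0 * (1 - m (Suc k) / m k)"
    unfolding E0_def by (rule dloss_mu_diff[OF m_pos m_ratio(1)])
  also have "\<dots> \<le> E0 * (1 / (real k + 1))"
    using m_ratio(2) by (intro mult_left_mono) (auto simp: E0_def sum_nonneg)
  finally show ?thesis by simp
qed

text \<open>The prox inequality at \<open>w k\<close> gains \<open>sg k - N * rho / 2\<close> times
  the squared step, and the quadratic majorant of the loss takes back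
  \<open>sg k / 2\<close>.\<close>

lemma Phi_descent: "Phi (Suc k) \<le> Phi k - (sg k - N * rho) / 2 * (norm (w (Suc k) - w k))\<^sup>2"
proof -
  let ?u = "w (Suc k)" and ?z = "w (Suc k) - w k"
  have "loss ?u (m (Suc k)) \<le> loss ?u (m k)" by (rule loss_mono[OF m_pos m_ratio(1)])
  also have "\<dots> \<le> loss (w k) (m k) + dloss (w k) (m k) \<bullet> ?z + 2 * (beta * c) / (4 * m k) * (norm ?z)\<^sup>2"
    by (rule loss_upper[OF m_pos])
  also have "2 * (beta * c) / (4 * m k) = sg k / 2" using sg_m[of k] by (simp add: field_simps)
  finally have G: "loss ?u (m (Suc k)) \<le> loss (w k) (m k) + dloss (w k) (m k) \<bullet> ?z + sg k / 2 * (norm ?z)\<^sup>2" .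
  have "w k - ?u = - ?z" by simp
  then have "(dloss (w k) (m k) + sg k *\<^sub>R ?z) \<bullet> (w k - ?u) = - (dloss (w k) (m k) \<bullet> ?z) - sg k * (norm ?z)\<^sup>2"
    by (simp only: inner_minus_right inner_add_left inner_scaleR_left power2_norm_eq_inner)
  moreover have "norm (w k - ?u) = norm ?z" by (rule norm_minus_commute)
  ultimately have "N * penalty g i0 ?u + dloss (w k) (m k) \<bullet> ?z + sg k * (norm ?z)\<^sup>2 - N * rho / 2 * (norm ?z)\<^sup>2
      \<le> N * penalty g i0 (w k)"
    using prox[of k "w k"] by simp
  moreover have "(sg k - N * rho) / 2 * (norm ?z)\<^sup>2 = sg k * (norm ?z)\<^sup>2 - N * rho / 2 * (norm ?z)\<^sup>2 - sg k / 2 * (norm ?z)\<^sup>2"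
    by (simp add: field_simps)
  ultimately show ?thesis using G unfolding Phi_def obj_def by linarith
qed

text \<open>Test the prox inequalities of two consecutive steps at each other's point and add: the
  penalty values cancel, and the whole history is condensed into \<open>kap k\<close>.\<close>

lemma step_growth: "(sg (Suc k) - N * rho) * norm (w (Suc (Suc k)) - w (Suc k)) \<le> norm (kap k)"
proof -
  let ?u = "w (Suc k)" and ?v = "w (Suc (Suc k))"
  let ?z = "?v - ?u"
  let ?a = "dloss (w k) (m k) + sg k *\<^sub>R (?u - w k)"
  have "N * penalty g i0 ?u - ?a \<bullet> ?z - N * rho / 2 * (norm ?z)\<^sup>2 \<le> N * penalty g i0 ?v"
    by (rule prox)
  moreover have "N * penalty g i0 ?v + (dloss ?u (m (Suc k)) + sg (Suc k) *\<^sub>R ?z) \<bullet> ?z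
      - N * rho / 2 * (norm ?z)\<^sup>2 \<le> N * penalty g i0 ?u"
  proof -
    have "?u - ?v = - ?z" by simp
    then show ?thesis using prox[of "Suc k" ?u]
      by (simp only: inner_minus_right norm_minus_cancel diff_minus_eq_add)
  qed
  ultimately have "(dloss ?u (m (Suc k)) + sg (Suc k) *\<^sub>R ?z) \<bullet> ?z - ?a \<bullet> ?z - N * rho * (norm ?z)\<^sup>2 \<le> 0"
    by simp
  moreover have "(dloss ?u (m (Suc k)) + sg (Suc k) *\<^sub>R ?z) \<bullet> ?z = dloss ?u (m (Suc k)) \<bullet> ?z + sg (Suc k) * (norm ?z)\<^sup>2"
    by (simp only: inner_add_left inner_scaleR_left power2_norm_eq_inner)
  moreover have "kap k \<bullet> ?z = dloss ?u (m (Suc k)) \<bullet> ?z - ?a \<bullet> ?z"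
    unfolding kap_def by (rule inner_diff_left)
  ultimately have "(sg (Suc k) - N * rho) * (norm ?z)\<^sup>2 \<le> - (kap k \<bullet> ?z)"
    unfolding left_diff_distrib by linarith
  also have "\<dots> \<le> norm (kap k) * norm ?z" using Cauchy_Schwarz_ineq2[of "kap k" ?z] by simp
  finally have "norm ?z * ((sg (Suc k) - N * rho) * norm ?z) \<le> norm ?z * norm (kap k)"
    by (simp add: power2_eq_square mult_ac)
  then show ?thesis
    by (cases "?z = 0") (auto dest: mult_left_le_imp_le)
qed

text \<open>As \<open>prox\<close> is a global inequality it may be tested along coordinate axes,
  where it says that a function of one variable is minimal at 0; along the intercept axis the
  penalty does not change.\<close>

lemma kap_critical: "critical_residual (w (Suc k)) (m (Suc k)) (kap k)"
proof -
  define x where "x = w (Suc k)"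
  define a where "a = dloss (w k) (m k) + sg k *\<^sub>R (x - w k)"
  have coord: "N * penalty g i0 x - a $ p * t - N * rho / 2 * t\<^sup>2 \<le> N * penalty g i0 (x + t *\<^sub>R axis p 1)" for p t
    using prox[of k "x + t *\<^sub>R axis p 1"] unfolding x_def[symmetric] a_def[symmetric]
    by (simp add: inner_axis norm_axis_1 mult.commute)
  have kap: "kap k = dloss x (m (Suc k)) - a" by (simp add: kap_def x_def a_def)
  have "a $ i0 = 0"
  proof -
    have "penalty g i0 (x + t *\<^sub>R axis i0 1) = penalty g i0 x" for t
      unfolding penalty_def by (rule sum.cong) (auto simp: axis_def)
    then have "N * rho / 2 * t\<^sup>2 + a $ i0 * t \<ge> 0" for t using coord[of i0 t] by simp
    then show ?thesis by (rule nonneg_quadratic_linear_coeff)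
  qed
  moreover have "- (a $ p) = N * D" if p: "p \<noteq> i0" and D: "(g has_real_derivative D) (at (x $ p))" for p D
  proof -
    define f where "f t = N * g (x $ p + t) + a $ p * t + N * rho / 2 * t\<^sup>2" for t
    have pen: "penalty g i0 (x + t *\<^sub>R axis p 1) - penalty g i0 x = g (x $ p + t) - g (x $ p)" for t
    proof -
      have "penalty g i0 (x + t *\<^sub>R axis p 1) = g (x $ p + t) + (\<Sum>q\<in>UNIV - {i0} - {p}. g ((x + t *\<^sub>R axis p 1) $ q))"
        unfolding penalty_def using p by (subst sum.remove[of _ p]) (auto simp: axis_def)
      also have "(\<Sum>q\<in>UNIV - {i0} - {p}. g ((x + t *\<^sub>R axis p 1) $ q)) = (\<Sum>q\<in>UNIV - {i0} - {p}. g (x $ q))"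
        by (rule sum.cong) (auto simp: axis_def)
      finally show ?thesis unfolding penalty_def using p by (subst (2) sum.remove[of _ p]) auto
    qed
    have "f 0 \<le> f t" for t
    proof -
      have "N * (penalty g i0 (x + t *\<^sub>R axis p 1) - penalty g i0 x) = N * (g (x $ p + t) - g (x $ p))"
        by (simp only: pen)
      then show ?thesis using coord[of p t] by (simp add: f_def right_diff_distrib)
    qed
    moreover have "(f has_real_derivative N * D + a $ p) (at 0)"
    proof -
      have "((\<lambda>t. g (x $ p + t)) has_real_derivative D) (at 0)"
        using DERIV_shift[of g D 0 "x $ p"] D by (simp add: add.commute)
      then show ?thesis unfolding f_def by (auto intro!: derivative_eq_intros)
    qed
    ultimately have "N * D + a $ p = 0"
      using DERIV_local_min[of f "N * D + a $ p" 0 1] by auto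
    then show ?thesis by simp
  qed
  ultimately show ?thesis unfolding critical_residual_def kap x_def[symmetric] by auto
qed

section \<open>Asymptotic descent and growth, choice of the level, and the rate\<close>

lemma eventually_sg_large: "\<forall>\<^sub>F k in sequentially. 2 * (N * rho) \<le> sg k"
proof -
  have "(\<lambda>k. 2 * (N * rho) * (real k + 1) powr (- d)) \<longlonglongrightarrow> 2 * (N * rho) * 0"
    using d by (intro tendsto_intros powr_Suc_tendsto_0) auto
  then have "\<forall>\<^sub>F k in sequentially. 2 * (N * rho) * (real k + 1) powr (- d) < c"
    by (rule order_tendstoD(2)) (use c in simp)
  then show ?thesis
  proof eventually_elim
    case (elim k)
    have "(real k + 1) powr d > 0" by simp
    then show ?case using elim unfolding sg_def by (simp add: powr_minus field_simps less_imp_le)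
  qed
qed

lemma E0_nonneg: "E0 \<ge> 0"
  by (simp add: E0_def sum_nonneg)

lemma m_tendsto: "filterlim m (at_right 0) sequentially"
  unfolding filterlim_at
proof
  have "(\<lambda>k. beta * (real k + 1) powr (- d)) \<longlonglongrightarrow> beta * 0"
    using d by (intro tendsto_intros powr_Suc_tendsto_0) auto
  then show "m \<longlonglongrightarrow> 0" by (simp add: m_def[abs_def] powr_minus divide_inverse)
  show "\<forall>\<^sub>F k in sequentially. m k \<in> {0<..} \<and> m k \<noteq> 0"   proof (intro always_eventually allI)
    fix k show "m k \<in> {0<..} \<and> m k \<noteq> 0" using m_pos[of k] by simp
  qed
qed

text \<open>Once \<open>N * rho \<le> sg k / 2\<close>, a quarter of \<open>sg k\<close> remains,
  and \<open>sg k / 4\<close> times the squared step is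
  \<open>(step_size k)^2 / (4 * sg k)\<close>.\<close>

lemma eventually_descent:
  "\<forall>\<^sub>F k in sequentially. (step_size k)\<^sup>2 * (real k + 1) powr (- d) / (4 * c) \<le> Phi k - Phi (Suc k)"
  using eventually_sg_large
proof eventually_elim
  case (elim k)
  let ?z = "norm (w (Suc k) - w k)"
  have "(step_size k)\<^sup>2 * (real k + 1) powr (- d) / (4 * c) = sg k / 4 * ?z\<^sup>2"
    using c by (simp add: step_size_def sg_def powr_minus power2_eq_square field_simps)
  also have "\<dots> \<le> (sg k - N * rho) / 2 * ?z\<^sup>2" using elim by (intro mult_right_mono) auto
  also have "\<dots> \<le> Phi k - Phi (Suc k)" using Phi_descent[of k] by simp
  finally show ?case .
qed

lemma eventually_growth:
  "\<forall>\<^sub>F k in sequentially. step_size (Suc k)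
     \<le> (1 + 2 * (N * rho) / c * (real k + 1) powr (- d)) * (step_size k + E0 * (real k + 1) powr (-1))"
  using eventually_sequentially_Suc[THEN iffD2, OF eventually_sg_large]
proof eventually_elim
  case (elim k)
  define K where "K = real k + 1"
  define q where "q = step_size k + E0 * K powr (-1)"
  define x where "x = N * rho / sg (Suc k)"
  have s0: "sg (Suc k) > 0" by (rule sg_pos)
  have x: "0 \<le> x" "x \<le> 1 / 2" using elim s0 N rho by (auto simp: x_def field_simps)
  have q0: "0 \<le> q" unfolding q_def step_size_def
    using sg_pos[of k] E0_nonneg by (intro add_nonneg_nonneg mult_nonneg_nonneg) auto
  have "(1 - x) * step_size (Suc k) = (sg (Suc k) - N * rho) * norm (w (Suc (Suc k)) - w (Suc k))"
    using s0 by (simp add: x_def step_size_def field_simps)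
  also have "\<dots> \<le> norm (kap k)" by (rule step_growth)
  also have "\<dots> \<le> q" using norm_kap[of k] by (simp add: q_def K_def)
  finally have le: "(1 - x) * step_size (Suc k) \<le> q" .
  have st0: "0 \<le> step_size (Suc k)" using s0 by (simp add: step_size_def)
  \<comment> \<open>The bound \<open>1 / (1 - x) \<le> 1 + 2 * x\<close> on \<open>[0, 1/2]\<close>,
    without division.\<close>
  have "1 \<le> (1 + 2 * x) * (1 - x)"
  proof -
    have "0 \<le> x * (1 - 2 * x)" using x by simp
    then show ?thesis by (simp add: algebra_simps)
  qed
  then have "step_size (Suc k) \<le> (1 + 2 * x) * (1 - x) * step_size (Suc k)"
    using mult_right_mono[OF _ st0] by fastforce
  also have "\<dots> = (1 + 2 * x) * ((1 - x) * step_size (Suc k))" by (simp only: mult.assoc)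
  also have "\<dots> \<le> (1 + 2 * x) * q" using le x by (intro mult_left_mono) auto
  also have "\<dots> \<le> (1 + 2 * (N * rho) / c * K powr (- d)) * q"
  proof (rule mult_right_mono[OF _ q0])
    have "sg k \<le> sg (Suc k)" using powr_Suc_ratio(1)[of d k] d c by (simp add: sg_def)
    then have "x \<le> N * rho / sg k" unfolding x_def using sg_pos N rho by (intro divide_left_mono) auto
    also have "\<dots> = (N * rho) / c * K powr (- d)" by (simp add: sg_def K_def powr_minus divide_inverse)
    finally show "1 + 2 * x \<le> 1 + 2 * (N * rho) / c * K powr (- d)" by simp
  qed
  finally show ?case by (simp only: q_def K_def)
qed

lemma norm_kap_sq: "(norm (kap k))\<^sup>2 \<le> 2 * (step_size k)\<^sup>2 + 2 * E0\<^sup>2 * (real k + 1) powr (-2)"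
proof -
  let ?e = "E0 / (real k + 1)"
  have "(norm (kap k))\<^sup>2 \<le> (step_size k + ?e)\<^sup>2"
    using norm_kap by (intro power_mono) auto
  also have "\<dots> \<le> 2 * (step_size k)\<^sup>2 + 2 * ?e\<^sup>2"
    using zero_le_power2[of "step_size k - ?e"] by (simp add: power2_eq_square algebra_simps)
  also have "?e\<^sup>2 = E0\<^sup>2 * (real k + 1) powr (-2)"
    by (simp add: powr_minus divide_inverse power_mult_distrib power_inverse)
  finally show ?thesis by simp
qed

text \<open>Distance \<open>e\<close> from all levels forces, by the KL inequality, a residual and
  then a step of squared size about \<open>e\<close>, hence the descent demanded by
  \<open>level_selection\<close>; rationality supplies the drift bound and the separation of
  levels.\<close>

lemma Phi_level:
  "\<exists>v E. E \<ge> 0 \<and> (\<lambda>k. (real k + 1) powr (1 - d) * (Phi k - v (m k))) \<longlonglongrightarrow> 0 \<and>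
     (\<forall>\<^sub>F k in sequentially. \<bar>v (m (Suc k)) - v (m k)\<bar> \<le> E * (real k + 1) powr (- 1 - d))"
proof -
  obtain V C g0 m0 where V: "finite V" "\<And>v. v \<in> V \<Longrightarrow> ratfun v" and C: "C \<ge> 1" and g0: "g0 > 0" and m0: "m0 > 0"
    and KL: "\<And>mu x k. mu \<in> {0<..<m0} \<Longrightarrow> critical_residual x mu k \<Longrightarrow> norm k < g0 \<Longrightarrow>
       \<exists>v\<in>V. \<bar>obj x mu - v mu\<bar> \<le> C * (norm k)\<^sup>2"
    using obj_KL by blast
  define lip where "lip v C \<longleftrightarrow> C \<ge> 0 \<and> (\<exists>e>0. \<forall>x\<in>{0<..<e}. \<forall>y\<in>{0<..<e}. \<bar>v x - v y\<bar> \<le> C * \<bar>x - y\<bar>)"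
    for v :: "real \<Rightarrow> real" and C
  \<comment> \<open>The critical values without a pole at 0. The others tend to infinity in absolute
    value along \<open>m\<close> and are never approached.\<close>
  define W where "W = {v\<in>V. \<exists>C. lip v C}"
  have W: "finite W" "W \<subseteq> V" using V(1) by (auto simp: W_def)
  have "\<forall>v\<in>W. \<exists>C. lip v C" unfolding W_def by blast
  then obtain Lc where Lc: "\<And>v. v \<in> W \<Longrightarrow> lip v (Lc v)" by metis
  define Lm where "Lm = (\<Sum>v\<in>W. Lc v)"
  have Lm: "Lc v \<le> Lm" if "v \<in> W" for v
    unfolding Lm_def using Lc W(1) that by (intro member_le_sum) (auto simp: lip_def)
  have Lm0: "Lm \<ge> 0" unfolding Lm_def using Lc by (intro sum_nonneg) (auto simp: lip_def)
  \<comment> \<open>One constant for two errors: the drift of the levels, and the part of the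
    residual caused by changing \<open>mu\<close> once it is multiplied by the descent
    factor.\<close>
  define E where "E = Lm * beta + E0\<^sup>2 / (4 * c)"
  have E: "E \<ge> 0" "Lm * beta \<le> E" "E0\<^sup>2 / (4 * c) \<le> E" using Lm0 beta c by (auto simp: E_def)
  have ev_m: "\<forall>\<^sub>F k in sequentially. m k \<in> {0<..<e}" if "e > 0" for e
    using eventually_compose_filterlim[OF eventually_at_right_real[OF that] m_tendsto] .
  have drift: "\<forall>\<^sub>F k in sequentially. \<bar>v (m (Suc k)) - v (m k)\<bar> \<le> E * (real k + 1) powr (- 1 - d)" if v: "v \<in> W" for v
  proof -
    obtain e where e: "e > 0" "\<And>x y. x \<in> {0<..<e} \<Longrightarrow> y \<in> {0<..<e} \<Longrightarrow> \<bar>v x - v y\<bar> \<le> Lc v * \<bar>x - y\<bar>" and L0: "Lc v \<ge> 0"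
      using Lc[OF v] unfolding lip_def by blast
    from ev_m[OF e(1)] show ?thesis
    proof eventually_elim
      case (elim k)
      then have "m (Suc k) \<in> {0<..<e}" using m_ratio(1)[of k] m_pos[of "Suc k"] by auto
      then have "\<bar>v (m (Suc k)) - v (m k)\<bar> \<le> Lc v * \<bar>m (Suc k) - m k\<bar>" using e(2) elim by blast
      also have "\<dots> \<le> Lm * (beta * (real k + 1) powr (- 1 - d))"
        using Lm[OF v] L0 m_diff[of k] Lm0 by (intro mult_mono) auto
      also have "\<dots> \<le> E * (real k + 1) powr (- 1 - d)"
        using E(2) unfolding mult.assoc[symmetric] by (intro mult_right_mono) auto
      finally show ?case .
    qed
  qed
  have dec: "\<forall>\<^sub>F k in sequentially. Phi (Suc k) \<le> Phi k"
    using eventually_descent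
  proof eventually_elim
    case (elim k)
    have "0 \<le> (step_size k)\<^sup>2 * (real k + 1) powr (- d) / (4 * c)" using c by simp
    then show ?case using elim by linarith
  qed
  obtain k0 where k0: "\<And>k. k \<ge> k0 \<Longrightarrow> Phi (Suc k) \<le> Phi k"
    using dec unfolding eventually_sequentially by blast
  have Phi_bdd: "Phi k \<le> Phi k0" if "k \<ge> k0" for k
    using that by (induction k rule: dec_induct) (use k0 in \<open>auto intro: order_trans\<close>)
  have far: "\<forall>\<^sub>F k in sequentially. \<forall>v\<in>V - W. 1 \<le> \<bar>Phi k - v (m k)\<bar>"
    unfolding eventually_ball_finite_distrib[OF finite_Diff[OF V(1)]]
  proof
    fix v assume v: "v \<in> V - W"
    have nl: "\<not> lip v C" for C using v unfolding W_def by blast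
    have "filterlim (\<lambda>x. \<bar>v x\<bar>) at_top (at_right 0)"
    proof (rule ccontr)
      assume "\<not> ?thesis"
      then obtain C e where "e > 0" and *: "\<forall>x\<in>{0<..<e}. \<forall>y\<in>{0<..<e}. \<bar>v x - v y\<bar> \<le> C * \<bar>x - y\<bar>"
        using ratfun_lipschitz_or_unbounded[of v] V(2) v by blast
      have "\<bar>v x - v y\<bar> \<le> \<bar>C\<bar> * \<bar>x - y\<bar>" if "x \<in> {0<..<e}" "y \<in> {0<..<e}" for x y
        using * that by (meson abs_ge_self abs_ge_zero mult_right_mono order_trans)
      then have "lip v \<bar>C\<bar>" unfolding lip_def using \<open>e > 0\<close> by auto
      then show False using nl by blast
    qed
    then have "filterlim (\<lambda>k. \<bar>v (m k)\<bar>) at_top sequentially"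
      by (rule filterlim_compose[OF _ m_tendsto])
    then have "\<forall>\<^sub>F k in sequentially. Phi k0 + 1 \<le> \<bar>v (m k)\<bar>"
      unfolding filterlim_at_top by blast
    then show "\<forall>\<^sub>F k in sequentially. 1 \<le> \<bar>Phi k - v (m k)\<bar>"
      using eventually_ge_at_top[of k0]
    proof eventually_elim
      case (elim k)
      have "0 \<le> Phi k" unfolding Phi_def by (rule obj_nonneg[OF m_pos])
      then show ?case using elim Phi_bdd[of k] by linarith
    qed
  qed
  \<comment> \<open>The bound 1 handles levels outside \<open>W\<close>, which are at distance at
    least 1; the bound \<open>g0^2\<close> handles residuals too large for the KL inequality, where
    \<open>C \<ge> 1\<close> suffices.\<close>
  define eta where "eta = min 1 (g0\<^sup>2)"
  have eta: "eta > 0" "eta \<le> 1" "eta \<le> g0\<^sup>2" using g0 by (auto simp: eta_def)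
  let ?W = "(\<lambda>v k. v (m k)) ` W"
  have drop: "\<forall>\<^sub>F k in sequentially. \<forall>e. 0 \<le> e \<and> e \<le> eta \<and> (\<forall>v\<in>?W. e \<le> \<bar>Phi (Suc k) - v (Suc k)\<bar>) \<longrightarrow>
        1 / (8 * c * C) * e * (real k + 1) powr (- d) - E * (real k + 1) powr (- 2 - d) \<le> Phi k - Phi (Suc k)"
    using eventually_descent eventually_sequentially_Suc[THEN iffD2, OF far]
      eventually_sequentially_Suc[THEN iffD2, OF ev_m[OF m0]]
  proof eventually_elim
    case (elim k)
    show ?case
    proof (intro allI impI)
      fix e assume e: "0 \<le> e \<and> e \<le> eta \<and> (\<forall>v\<in>?W. e \<le> \<bar>Phi (Suc k) - v (Suc k)\<bar>)"
      have eW: "e \<le> \<bar>Phi (Suc k) - v (m (Suc k))\<bar>" if "v \<in> W" for v using e that by auto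
      have kap_e: "e / C \<le> (norm (kap k))\<^sup>2"
      proof (cases "norm (kap k) < g0")
        case True
        then obtain v where v: "v \<in> V" "\<bar>Phi (Suc k) - v (m (Suc k))\<bar> \<le> C * (norm (kap k))\<^sup>2"
          using KL[OF elim(3) kap_critical True] unfolding Phi_def by blast
        have "e \<le> \<bar>Phi (Suc k) - v (m (Suc k))\<bar>"
        proof (cases "v \<in> W")
          case True
          then show ?thesis by (rule eW)
        next
          case False
          then have "1 \<le> \<bar>Phi (Suc k) - v (m (Suc k))\<bar>" using elim(2) v(1) by blast
          then show ?thesis using e eta by linarith
        qed
        then have "e \<le> C * (norm (kap k))\<^sup>2" using v(2) by linarith
        then show ?thesis using C by (simp add: pos_divide_le_eq mult.commute)
      next
        case False
        have "e / C \<le> e / 1" using e C by (intro divide_left_mono) auto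
        also have "\<dots> \<le> g0\<^sup>2" using e eta by simp
        also have "\<dots> \<le> (norm (kap k))\<^sup>2" using False g0 by (intro power_mono) auto
        finally show ?thesis .
      qed
      let ?K = "real k + 1"
      have "e / C \<le> 2 * (step_size k)\<^sup>2 + 2 * E0\<^sup>2 * ?K powr (-2)"
        using kap_e norm_kap_sq[of k] by linarith
      \<comment> \<open>Multiplied by the descent factor \<open>?K powr (- d) / (4 * c)\<close>,
        this yields the rate \<open>1 / (8 * c * C)\<close>.\<close>
      then have st: "e / (2 * C) - E0\<^sup>2 * ?K powr (-2) \<le> (step_size k)\<^sup>2"
        using C by (simp add: field_simps)
      have "1 / (8 * c * C) * e * ?K powr (- d) - E * ?K powr (- 2 - d)
          \<le> 1 / (8 * c * C) * e * ?K powr (- d) - E0\<^sup>2 / (4 * c) * ?K powr (- 2 - d)"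
        using E(3) by (intro diff_left_mono mult_right_mono) auto
      also have "\<dots> = (e / (2 * C) - E0\<^sup>2 * ?K powr (-2)) * (?K powr (- d) / (4 * c))"
      proof -
        have "?K powr (- 2 - d) = ?K powr (-2 + (- d))" by simp
        also have "\<dots> = ?K powr (-2) * ?K powr (- d)" by (rule powr_add)
        finally have pw: "?K powr (- 2 - d) = ?K powr (-2) * ?K powr (- d)" .
        have "1 / (8 * c * C) * e * x - E0\<^sup>2 / (4 * c) * (z * x) = (e / (2 * C) - E0\<^sup>2 * z) * (x / (4 * c))" for x z
          using c C by (simp add: field_simps)
        then show ?thesis unfolding pw .
      qed
      also have "\<dots> \<le> (step_size k)\<^sup>2 * (?K powr (- d) / (4 * c))"
        using st c by (intro mult_right_mono) auto
      also have "\<dots> \<le> Phi k - Phi (Suc k)" using elim(1) by simp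
      finally show "1 / (8 * c * C) * e * ?K powr (- d) - E * ?K powr (- 2 - d) \<le> Phi k - Phi (Suc k)" .
    qed
  qed
  have sep: "(\<lambda>k. (real k + 1) powr (1 - d) * (v k - u k)) \<longlonglongrightarrow> 0 \<or>
        (\<exists>g>0. \<forall>\<^sub>F k in sequentially. g \<le> (real k + 1) powr (1 - d) * \<bar>v k - u k\<bar>)"
    if uv: "u \<in> ?W" "v \<in> ?W" for u v
  proof -
    obtain u' v' where u': "u = (\<lambda>k. u' (m k))" "u' \<in> W" and v': "v = (\<lambda>k. v' (m k))" "v' \<in> W" using uv by blast
    have "ratfun (\<lambda>x. v' x - u' x)" using V(2) u' v' W(2) by (intro ratfun_diff) auto
    from ratfun_along_power_sequence[OF this beta d(1), of "1 - d"]
    show ?thesis unfolding u' v' m_def .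
  qed
  have "\<exists>v\<in>?W. (\<lambda>k. (real k + 1) powr (1 - d) * (Phi k - v k)) \<longlonglongrightarrow> 0"
  proof (rule level_selection[OF d _ eta(1) E(1) _ _ dec drop _ sep])
    show "1 / (8 * c * C) > 0" using c C by simp
    show "finite ?W" using W(1) by simp
    show "Phi k \<ge> 0" for k unfolding Phi_def by (rule obj_nonneg[OF m_pos])
    show "\<forall>\<^sub>F k in sequentially. \<bar>v (Suc k) - v k\<bar> \<le> E * (real k + 1) powr (- 1 - d)" if "v \<in> ?W" for v
      using drift that by auto
  qed
  then obtain v where "v \<in> W" "(\<lambda>k. (real k + 1) powr (1 - d) * (Phi k - v (m k))) \<longlonglongrightarrow> 0" by blast
  then show ?thesis using E(1) drift by blast
qed

lemma kap_rate: "(\<lambda>k. (real k + 1) powr (1 - d) * (norm (kap k))\<^sup>2) \<longlonglongrightarrow> 0"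
proof -
  obtain v E where E: "E \<ge> 0" and lim: "(\<lambda>k. (real k + 1) powr (1 - d) * (Phi k - v (m k))) \<longlonglongrightarrow> 0"
    and drift: "\<forall>\<^sub>F k in sequentially. \<bar>v (m (Suc k)) - v (m k)\<bar> \<le> E * (real k + 1) powr (- 1 - d)"
    using Phi_level by blast
  have "(\<lambda>k. (real k + 1) powr (1 - d) * (step_size k)\<^sup>2) \<longlonglongrightarrow> 0"
  \<comment> \<open>Measured from its moving level the objective need not decrease monotonically;
    the drift of the level is charged to the error term.\<close>
  proof (rule step_rate_from_level_rate[OF d, where A = "\<lambda>k. Phi k - v (m k)" and a = "2 * (N * rho) / c"
        and b = "1 / (4 * c)" and E = "max E E0"])
    show "0 \<le> 2 * (N * rho) / c" "0 < 1 / (4 * c)" "0 \<le> max E E0" using N rho c E by auto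
    show "0 \<le> step_size k" for k using sg_pos[of k] by (simp add: step_size_def)
    show "\<forall>\<^sub>F k in sequentially. step_size (Suc k) \<le> (1 + 2 * (N * rho) / c * (real k + 1) powr (- d)) *
        (step_size k + max E E0 * (real k + 1) powr (- 1))"
      using eventually_growth
    proof eventually_elim
      case (elim k)
      note elim
      also have "(1 + 2 * (N * rho) / c * (real k + 1) powr (- d)) * (step_size k + E0 * (real k + 1) powr (- 1))
        \<le> (1 + 2 * (N * rho) / c * (real k + 1) powr (- d)) * (step_size k + max E E0 * (real k + 1) powr (- 1))"
        using N rho c by (intro mult_left_mono add_left_mono mult_right_mono) auto
      finally show ?case .
    qed
    show "\<forall>\<^sub>F k in sequentially. Phi (Suc k) - v (m (Suc k)) \<le> Phi k - v (m k)
        - 1 / (4 * c) * (step_size k)\<^sup>2 * (real k + 1) powr (- d) + max E E0 * (real k + 1) powr (- 1 - d)"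
      using eventually_descent drift
    proof eventually_elim
      case (elim k)
      have "E * (real k + 1) powr (- 1 - d) \<le> max E E0 * (real k + 1) powr (- 1 - d)"
        by (intro mult_right_mono) auto
      moreover have "1 / (4 * c) * (step_size k)\<^sup>2 * (real k + 1) powr (- d)
          = (step_size k)\<^sup>2 * (real k + 1) powr (- d) / (4 * c)" by simp
      ultimately show ?case using elim by linarith
    qed
  qed (rule lim)
  then have "(\<lambda>k. 2 * ((real k + 1) powr (1 - d) * (step_size k)\<^sup>2) + 2 * E0\<^sup>2 * (real k + 1) powr (- 1 - d))
      \<longlonglongrightarrow> 2 * 0 + 2 * E0\<^sup>2 * 0"
    using d by (intro tendsto_intros powr_Suc_tendsto_0) auto
  then have lim2: "(\<lambda>k. 2 * ((real k + 1) powr (1 - d) * (step_size k)\<^sup>2) + 2 * E0\<^sup>2 * (real k + 1) powr (- 1 - d)) \<longlonglongrightarrow> 0"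
    by simp
  show ?thesis
  proof (rule Lim_null_comparison[OF always_eventually lim2], rule allI)
    fix k
    let ?K = "real k + 1"
    have "?K powr (1 - d) * (norm (kap k))\<^sup>2 \<le> ?K powr (1 - d) * (2 * (step_size k)\<^sup>2 + 2 * E0\<^sup>2 * ?K powr (-2))"
      by (intro mult_left_mono norm_kap_sq) auto
    also have "\<dots> = 2 * (?K powr (1 - d) * (step_size k)\<^sup>2) + 2 * E0\<^sup>2 * (?K powr (1 - d) * ?K powr (-2))"
      by (simp only: distrib_left mult_ac)
    also have "?K powr (1 - d) * ?K powr (-2) = ?K powr (- 1 - d)"
      by (simp only: powr_add[symmetric]) simp
    finally show "norm (?K powr (1 - d) * (norm (kap k))\<^sup>2)
        \<le> 2 * (?K powr (1 - d) * (step_size k)\<^sup>2) + 2 * E0\<^sup>2 * ?K powr (- 1 - d)" by simp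
  qed
qed

end

section \<open>From the minimisers to the rate\<close>

lemma nonneg_of_affine_nonneg:
  fixes X Y :: real
  assumes "\<And>t. 0 < t \<Longrightarrow> t < 1 \<Longrightarrow> 0 \<le> X + t * Y"
  shows "0 \<le> X"
proof -
  have "((\<lambda>t. X + t * Y) \<longlongrightarrow> X + 0 * Y) (at_right 0)" by (intro tendsto_intros)
  moreover have "\<forall>\<^sub>F t in at_right 0. 0 \<le> X + t * Y"
    using eventually_at_right_real[OF zero_less_one] by (rule eventually_mono) (use assms in auto)
  ultimately have "0 \<le> X + 0 * Y" by (rule tendsto_lowerbound) simp
  then show ?thesis by simp
qed

text \<open>Compare the minimiser with \<open>x + t *\<^sub>R (u - x)\<close>, divide by
  \<open>t\<close> and let \<open>t\<close> tend to 0. Weak convexity along the segment has the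
  defect \<open>rho / 2 * t * (1 - t) * q\<close>, which survives the limit as the quadratic
  slack.\<close>

lemma prox_minimizer_inequality:
  fixes P :: "'a::real_inner \<Rightarrow> real"
  assumes conv: "convex_on UNIV (\<lambda>u. P u + rho / 2 * (norm u)\<^sup>2)" and N: "N \<ge> 0"
    and min: "\<And>v. a \<bullet> (x - w) + N * P x + sg / 2 * (norm (x - w))\<^sup>2
        \<le> a \<bullet> (v - w) + N * P v + sg / 2 * (norm (v - w))\<^sup>2"
  shows "N * P x - (a + sg *\<^sub>R (x - w)) \<bullet> (u - x) - N * rho / 2 * (norm (u - x))\<^sup>2 \<le> N * P u"
proof -
  define e where "e = u - x"
  define z where "z = x - w"
  define q where "q = (norm e)\<^sup>2"
  have "0 \<le> (a \<bullet> e + N * (P u - P x) + N * rho / 2 * q + sg * (z \<bullet> e)) + t * ((sg - N * rho) / 2 * q)"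
    if t: "0 < t" "t < 1" for t
  proof -
    let ?v = "x + t *\<^sub>R e"
    have v: "?v = (1 - t) *\<^sub>R x + t *\<^sub>R u" by (simp add: e_def algebra_simps)
    have "P ?v + rho / 2 * (norm ?v)\<^sup>2 \<le> (1 - t) * (P x + rho / 2 * (norm x)\<^sup>2) + t * (P u + rho / 2 * (norm u)\<^sup>2)"
      using convex_onD[OF conv, of t x u] t unfolding v by simp
    moreover have nv: "(norm ?v)\<^sup>2 = (1 - t) * (norm x)\<^sup>2 + t * (norm u)\<^sup>2 - t * (1 - t) * q"
      unfolding q_def e_def power2_norm_eq_inner
      by (simp add: inner_add_left inner_add_right inner_diff_left inner_diff_right inner_commute algebra_simps)
    ultimately have "P ?v + rho / 2 * ((1 - t) * (norm x)\<^sup>2 + t * (norm u)\<^sup>2 - t * (1 - t) * q)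
        \<le> (1 - t) * (P x + rho / 2 * (norm x)\<^sup>2) + t * (P u + rho / 2 * (norm u)\<^sup>2)"
      by (simp only:)
    moreover have "(1 - t) * (P x + rho / 2 * (norm x)\<^sup>2) + t * (P u + rho / 2 * (norm u)\<^sup>2)
        = (1 - t) * P x + t * P u + rho / 2 * ((1 - t) * (norm x)\<^sup>2 + t * (norm u)\<^sup>2 - t * (1 - t) * q)
          + rho / 2 * (t * (1 - t) * q)"
      by (simp add: field_simps)
    ultimately have "P ?v \<le> (1 - t) * P x + t * P u + rho / 2 * (t * (1 - t) * q)"
      by linarith
    then have "N * P ?v \<le> N * ((1 - t) * P x + t * P u + rho / 2 * (t * (1 - t) * q))"
      using N by (rule mult_left_mono)
    moreover have "?v - w = z + t *\<^sub>R e" by (simp add: z_def)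
    then have "a \<bullet> (?v - w) = a \<bullet> z + t * (a \<bullet> e)"
      and "(norm (?v - w))\<^sup>2 = (norm z)\<^sup>2 + 2 * t * (z \<bullet> e) + t\<^sup>2 * q"
      unfolding q_def power2_norm_eq_inner
      by (simp_all add: inner_add_left inner_add_right inner_commute power2_eq_square algebra_simps)
    ultimately have "a \<bullet> z + N * P x + sg / 2 * (norm z)\<^sup>2
        \<le> a \<bullet> z + t * (a \<bullet> e) + N * ((1 - t) * P x + t * P u + rho / 2 * (t * (1 - t) * q))
          + sg / 2 * ((norm z)\<^sup>2 + 2 * t * (z \<bullet> e) + t\<^sup>2 * q)"
      using min[of ?v] by (simp add: z_def)
    then have "0 \<le> t * ((a \<bullet> e + N * (P u - P x) + N * rho / 2 * q + sg * (z \<bullet> e)) + t * ((sg - N * rho) / 2 * q))"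
      by (simp add: power2_eq_square field_simps)
    then show ?thesis using t by (simp add: zero_le_mult_iff)
  qed
  then have "0 \<le> a \<bullet> e + N * (P u - P x) + N * rho / 2 * q + sg * (z \<bullet> e)"
    by (rule nonneg_of_affine_nonneg)
  then show ?thesis
    by (simp add: e_def[symmetric] z_def[symmetric] q_def[symmetric] inner_add_left right_diff_distrib)
qed

text \<open>A quadratic slack is absorbed by \<open>e * norm (u - x)\<close> near \<open>x\<close>;
  this turns the global prox inequality into membership.\<close>

lemma frechet_subdiffI_quadratic:
  fixes F :: "'a::real_inner \<Rightarrow> real"
  assumes "\<And>u. F x + v \<bullet> (u - x) - C * (norm (u - x))\<^sup>2 \<le> F u"
  shows "v \<in> frechet_subdiff F x"
  unfolding frechet_subdiff_def
proof (intro CollectI allI impI)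
  fix e :: real assume e: "e > 0"
  have "((\<lambda>u. C * norm (u - x)) \<longlongrightarrow> C * norm (x - x)) (at x)" by (intro tendsto_intros)
  then have "\<forall>\<^sub>F u in at x. C * norm (u - x) < e" by (rule order_tendstoD(2)) (use e in simp)
  then show "\<forall>\<^sub>F u in at x. F u \<ge> F x + v \<bullet> (u - x) - e * norm (u - x)"
  proof eventually_elim
    case (elim u)
    have "C * norm (u - x) * norm (u - x) \<le> e * norm (u - x)"
      using elim by (intro mult_right_mono) auto
    then show ?case using assms[of u] by (simp add: power2_eq_square mult.assoc)
  qed
qed

text \<open>Serves the case without samples, where the residual is \<open>0\<close> times a
  subgradient but membership still asks for one.\<close>

lemma penalty_frechet_subdiff_nonempty:
  assumes "penalty_pieces g T"
  shows "\<exists>v. v \<in> frechet_subdiff (penalty g i0) (x :: real^'n)"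
proof -
  have "\<exists>D. \<forall>e>0. \<exists>del>0. \<forall>t. \<bar>t - x $ p\<bar> < del \<longrightarrow> g (x $ p) + D * (t - x $ p) - e * \<bar>t - x $ p\<bar> \<le> g t" for p
  proof (cases "x $ p = 0")
    case True
    have g: "g (x $ p) = 0" "\<And>t. g t \<ge> 0" using assms True unfolding penalty_pieces_def by auto
    show ?thesis
    proof (rule exI[of _ 0], intro allI impI)
      fix e :: real assume e: "e > 0"
      have "g (x $ p) + 0 * (t - x $ p) - e * \<bar>t - x $ p\<bar> \<le> g t" for t
      proof -
        have "0 \<le> e * \<bar>t - x $ p\<bar>" using e by simp
        then show ?thesis using g(1) g(2)[of t] by linarith
      qed
      then show "\<exists>del>0. \<forall>t. \<bar>t - x $ p\<bar> < del \<longrightarrow> g (x $ p) + 0 * (t - x $ p) - e * \<bar>t - x $ p\<bar> \<le> g t"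
        using zero_less_one by blast
    qed
  next
    case False
    then obtain D where "(g has_real_derivative D) (at (x $ p))"
      using assms unfolding penalty_pieces_def by blast
    then have D: "\<forall>e>0. \<exists>del>0. \<forall>t. norm (t - x $ p) < del \<longrightarrow>
        norm (g t - g (x $ p) - D * (t - x $ p)) \<le> e * norm (t - x $ p)"
      unfolding has_field_derivative_def has_derivative_at_alt by blast
    show ?thesis
    proof (rule exI[of _ D], intro allI impI)
      fix e :: real assume "e > 0"
      then obtain del where "del > 0" and *: "\<And>t. norm (t - x $ p) < del \<Longrightarrow>
          norm (g t - g (x $ p) - D * (t - x $ p)) \<le> e * norm (t - x $ p)" using D by blast
      have "g (x $ p) + D * (t - x $ p) - e * \<bar>t - x $ p\<bar> \<le> g t" if "\<bar>t - x $ p\<bar> < del" for t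
        using *[of t] that unfolding real_norm_def by linarith
      then show "\<exists>del>0. \<forall>t. \<bar>t - x $ p\<bar> < del \<longrightarrow> g (x $ p) + D * (t - x $ p) - e * \<bar>t - x $ p\<bar> \<le> g t"
        using \<open>del > 0\<close> by blast
    qed
  qed
  then obtain D where D: "\<And>p e. e > 0 \<Longrightarrow> \<exists>del>0. \<forall>t. \<bar>t - x $ p\<bar> < del \<longrightarrow>
      g (x $ p) + D p * (t - x $ p) - e * \<bar>t - x $ p\<bar> \<le> g t" by metis
  define v where "v = (\<chi> p. if p = i0 then 0 else D p)"
  have "v \<in> frechet_subdiff (penalty g i0) x"
    unfolding frechet_subdiff_def
  proof (intro CollectI allI impI)
    fix e :: real assume e: "e > 0"
    \<comment> \<open>The tolerance is shared equally among the coordinates, each of which differs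
      by at most the norm.\<close>
    define e' where "e' = e / real CARD('n)"
    have e': "e' > 0" using e by (simp add: e'_def)
    have "\<forall>\<^sub>F u in at x. \<forall>p\<in>UNIV. g (x $ p) + D p * (u $ p - x $ p) - e' * \<bar>u $ p - x $ p\<bar> \<le> g (u $ p)"
      unfolding eventually_ball_finite_distrib[OF finite]
    proof
      fix p
      obtain del where del: "del > 0" "\<And>t. \<bar>t - x $ p\<bar> < del \<Longrightarrow>
          g (x $ p) + D p * (t - x $ p) - e' * \<bar>t - x $ p\<bar> \<le> g t" using D[OF e', of p] by blast
      show "\<forall>\<^sub>F u in at x. g (x $ p) + D p * (u $ p - x $ p) - e' * \<bar>u $ p - x $ p\<bar> \<le> g (u $ p)"
        unfolding eventually_at
      proof (intro exI[of _ del] conjI ballI allI impI del(1))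
        fix u assume "u \<noteq> x \<and> dist u x < del"
        then have "\<bar>u $ p - x $ p\<bar> < del"
          using component_le_norm_cart[of "u - x" p] by (simp add: dist_norm)
        then show "g (x $ p) + D p * (u $ p - x $ p) - e' * \<bar>u $ p - x $ p\<bar> \<le> g (u $ p)" by (rule del(2))
      qed
    qed
    then show "\<forall>\<^sub>F u in at x. penalty g i0 u \<ge> penalty g i0 x + v \<bullet> (u - x) - e * norm (u - x)"
    proof eventually_elim
      case (elim u)
      have "v \<bullet> (u - x) = (\<Sum>p\<in>UNIV - {i0}. D p * (u $ p - x $ p))"
        unfolding inner_vec_def by (rule sum.mono_neutral_cong_right) (auto simp: v_def)
      then have "penalty g i0 x + v \<bullet> (u - x) - (\<Sum>p\<in>UNIV - {i0}. e' * \<bar>u $ p - x $ p\<bar>)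
          = (\<Sum>p\<in>UNIV - {i0}. g (x $ p) + D p * (u $ p - x $ p) - e' * \<bar>u $ p - x $ p\<bar>)"
        by (simp add: penalty_def sum.distrib sum_subtractf)
      also have "\<dots> \<le> penalty g i0 u" unfolding penalty_def using elim by (intro sum_mono) auto
      finally have le: "penalty g i0 x + v \<bullet> (u - x) - (\<Sum>p\<in>UNIV - {i0}. e' * \<bar>u $ p - x $ p\<bar>) \<le> penalty g i0 u" .
      have "(\<Sum>p\<in>UNIV - {i0}. e' * \<bar>u $ p - x $ p\<bar>) \<le> (\<Sum>p\<in>(UNIV :: 'n set). e' * \<bar>u $ p - x $ p\<bar>)"
        using e' by (intro sum_mono2) auto
      also have "\<dots> \<le> (\<Sum>p\<in>(UNIV :: 'n set). e' * norm (u - x))"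
        using e' component_le_norm_cart[of "u - x"] by (intro sum_mono mult_left_mono) auto
      also have "\<dots> = e * norm (u - x)" by (simp add: e'_def)
      finally show ?case using le by linarith
    qed
  qed
  then show ?thesis ..
qed

lemma smallo_of_weighted_square:
  fixes f :: "nat \<Rightarrow> real"
  assumes lim: "(\<lambda>k. (real k + 1) powr (1 - d) * (f k)\<^sup>2) \<longlonglongrightarrow> 0" and d: "d < 1"
  shows "f \<in> o(\<lambda>k. real k powr (- 1 / 2 + d / 2))"
proof (rule landau_o.smallI)
  fix e :: real assume e: "e > 0"
  have "\<forall>\<^sub>F k in sequentially. (real k + 1) powr (1 - d) * (f k)\<^sup>2 < e\<^sup>2"
    using lim by (rule order_tendstoD(2)) (use e in simp)
  then show "\<forall>\<^sub>F k in sequentially. norm (f k) \<le> e * norm (real k powr (- 1 / 2 + d / 2))"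
    using eventually_gt_at_top[of 0]
  proof eventually_elim
    case (elim k)
    have "real k powr (1 - d) * (f k)\<^sup>2 \<le> (real k + 1) powr (1 - d) * (f k)\<^sup>2"
      using d by (intro mult_right_mono powr_mono2) auto
    then have "real k powr (1 - d) * (f k)\<^sup>2 \<le> e\<^sup>2" using elim by linarith
    then have "(f k)\<^sup>2 \<le> e\<^sup>2 * inverse (real k powr (1 - d))"
      using elim by (simp add: field_simps)
    also have "inverse (real k powr (1 - d)) = (real k powr (- 1 / 2 + d / 2))\<^sup>2"
      using elim by (simp add: powr_minus[symmetric] power2_eq_square flip: powr_add)
    finally have "\<bar>f k\<bar>\<^sup>2 \<le> (e * real k powr (- 1 / 2 + d / 2))\<^sup>2"
      by (simp only: power_mult_distrib power2_abs)
    then have "\<bar>f k\<bar> \<le> e * real k powr (- 1 / 2 + d / 2)"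
      by (rule power2_le_imp_le) (use e in simp)
    then show ?case by simp
  qed
qed

theorem theorem2:
  fixes L :: nat and M :: "nat \<Rightarrow> nat"
    and y :: "nat \<Rightarrow> nat \<Rightarrow> real" and xb :: "nat \<Rightarrow> nat \<Rightarrow> real^'n"
    and i0 :: 'n
    and tau lam gam c beta d rho :: real
    and g :: "real \<Rightarrow> real"
    and w :: "nat \<Rightarrow> real^'n"
    and n :: nat and sigma mu :: "nat \<Rightarrow> real"
  assumes intercept: "\<forall>l<L. \<forall>i<M l. xb l i $ i0 = 1"
    and tau: "0 < tau" "tau < 1"
    and lam: "lam > 0"
    and pen: "(gam \<ge> 1 \<and> g = mcp lam gam) \<or> (gam \<ge> 2 \<and> g = scad lam gam)"
    and n_def: "n = (\<Sum>l<L. M l)"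
    and params: "c > 0" "beta > 0" "0 < d" "d < 1"
    and sigma_def: "\<forall>k\<ge>1. sigma k = c * real k powr d"
    and mu_def: "\<forall>k\<ge>1. mu k = beta / real k powr d"
    and iter: "\<forall>k. \<forall>v.
        (\<Sum>l<L. grad (\<lambda>u. gtilde tau M y xb l u (mu (k+1))) (w k) \<bullet> (w (k+1) - w k))
          + real n * penalty g i0 (w (k+1)) + sigma (k+1) / 2 * (norm (w (k+1) - w k))^2
        \<le> (\<Sum>l<L. grad (\<lambda>u. gtilde tau M y xb l u (mu (k+1))) (w k) \<bullet> (v - w k))
          + real n * penalty g i0 v + sigma (k+1) / 2 * (norm (v - w k))^2"
    and step: "beta * c \<ge> lambda_max_gram {(l,i). l < L \<and> i < M l} (\<lambda>(l,i). xb l i) / 2"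
    and weakcvx: "rho \<ge> 0" "convex_on UNIV (\<lambda>u. penalty g i0 u + rho / 2 * (norm u)^2)"
    and K: "\<exists>K. \<forall>k\<ge>K. sigma (k+1) \<ge> real n * rho"
  shows "\<exists>kappa :: nat \<Rightarrow> real^'n.
           (\<forall>k. kappa k \<in> {grad (\<lambda>u. \<Sum>l<L. gtilde tau M y xb l u (mu (k+2))) (w (k+1)) + real n *\<^sub>R s
                             | s. s \<in> frechet_subdiff (penalty g i0) (w (k+1))})
         \<and> (\<lambda>k. norm (kappa k)) \<in> o(\<lambda>k. real k powr (-1/2 + d/2))"
proof -
  define S where "S = {(l, i). l < L \<and> i < M l}"
  define b where "b = (\<lambda>(l, i). xb l i)"
  define yy where "yy = (\<lambda>(l, i). y l i)"
  have S_Sigma: "S = Sigma {..<L} (\<lambda>l. {..<M l})" by (auto simp: S_def)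
  have finS: "finite S" unfolding S_Sigma by auto
  have cardS: "card S = n" unfolding S_Sigma n_def by simp
  obtain T where T: "penalty_pieces g T"
    using pen mcp_pieces[OF lam] scad_pieces[OF lam] by blast
  have gram: "(\<Sum>s\<in>S. (b s \<bullet> z)\<^sup>2) \<le> 2 * (beta * c) * (norm z)\<^sup>2" for z
  \<comment> \<open>Without samples \<open>lambda_max_gram\<close> is the \<open>Max\<close> of an
    empty set and carries no information, but the sum is empty too.\<close>
  proof (cases "S = {}")
    case True
    then show ?thesis using params by simp
  next
    case False
    have "(\<Sum>s\<in>S. (b s \<bullet> z)\<^sup>2) \<le> lambda_max_gram S b * (norm z)\<^sup>2"
      by (rule lambda_max_gram_bound[OF finS False])
    also have "\<dots> \<le> 2 * (beta * c) * (norm z)\<^sup>2"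
      using step unfolding S_def b_def by (intro mult_right_mono) auto
    finally show ?thesis .
  qed
  interpret Q: quantile_data S b yy tau "2 * (beta * c)"
    using finS tau gram params by unfold_locales auto
  have loss_eq: "(\<Sum>l<L. gtilde tau M y xb l u m) = Q.loss u m" for u m
  proof -
    have "(\<Sum>l<L. gtilde tau M y xb l u m)
        = (\<Sum>l<L. \<Sum>i<M l. fsmooth (y l i - xb l i \<bullet> u) m / 2 + (tau - 1/2) * (y l i - xb l i \<bullet> u))"
      by (simp add: gtilde_def sum.distrib sum_distrib_left)
    also have "\<dots> = (\<Sum>(l, i)\<in>S. fsmooth (y l i - xb l i \<bullet> u) m / 2 + (tau - 1/2) * (y l i - xb l i \<bullet> u))"
      unfolding S_Sigma by (rule sum.Sigma) auto
    also have "\<dots> = Q.loss u m"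
      unfolding Q.loss_def by (rule sum.cong) (auto simp: b_def yy_def)
    finally show ?thesis .
  qed
  have grad_loss: "grad (\<lambda>u. \<Sum>l<L. gtilde tau M y xb l u m) x = Q.dloss x m" if "m > 0" for m x
    unfolding loss_eq by (rule grad_eqI[OF Q.loss_gderiv[OF that]])
  have grad_sum: "(\<Sum>l<L. grad (\<lambda>u. gtilde tau M y xb l u m) x) = Q.dloss x m" if m: "m > 0" for m x
  proof -
    have "grad (\<lambda>u. gtilde tau M y xb l u m) x
        = - (\<Sum>i<M l. (huber_slope (y l i - xb l i \<bullet> x) m / 2 + (tau - 1/2)) *\<^sub>R xb l i)" for l
    proof -
      \<comment> \<open>The iteration sums the gradients of the clients, while the residual uses the
        gradient of the sum. Each client is an instance by itself; a crude \<open>Lam\<close> is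
        enough, as only the formula for the gradient is wanted.\<close>
      interpret Ql: quantile_data "{..<M l}" "xb l" "y l" tau "\<Sum>i<M l. (norm (xb l i))\<^sup>2"
      proof unfold_locales
        fix z :: "real^'n"
        have "(xb l i \<bullet> z)\<^sup>2 \<le> (norm (xb l i))\<^sup>2 * (norm z)\<^sup>2" for i
          using Cauchy_Schwarz_ineq[of "xb l i" z] by (simp add: power2_norm_eq_inner)
        then show "(\<Sum>i<M l. (xb l i \<bullet> z)\<^sup>2) \<le> (\<Sum>i<M l. (norm (xb l i))\<^sup>2) * (norm z)\<^sup>2"
          unfolding sum_distrib_right by (intro sum_mono)
      qed (use tau in \<open>auto intro: sum_nonneg\<close>)
      have "(\<lambda>u. gtilde tau M y xb l u m) = (\<lambda>u. Ql.loss u m)"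
        by (simp add: fun_eq_iff gtilde_def Ql.loss_def sum.distrib sum_distrib_left)
      then show ?thesis using grad_eqI[OF Ql.loss_gderiv[OF m, of x]] by (simp add: Ql.dloss_def)
    qed
    then have "(\<Sum>l<L. grad (\<lambda>u. gtilde tau M y xb l u m) x)
        = - (\<Sum>l<L. \<Sum>i<M l. (huber_slope (y l i - xb l i \<bullet> x) m / 2 + (tau - 1/2)) *\<^sub>R xb l i)"
      by (simp add: sum_negf)
    also have "(\<Sum>l<L. \<Sum>i<M l. (huber_slope (y l i - xb l i \<bullet> x) m / 2 + (tau - 1/2)) *\<^sub>R xb l i)
        = (\<Sum>(l, i)\<in>S. (huber_slope (y l i - xb l i \<bullet> x) m / 2 + (tau - 1/2)) *\<^sub>R xb l i)"
      unfolding S_Sigma by (rule sum.Sigma) auto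
    also have "- \<dots> = Q.dloss x m"
      unfolding Q.dloss_def neg_equal_iff_equal by (rule sum.cong) (auto simp: b_def yy_def)
    finally show ?thesis .
  qed
  define m where "m k = beta / (real k + 1) powr d" for k :: nat
  define sg where "sg k = c * (real k + 1) powr d" for k :: nat
  have m_pos: "m k > 0" for k using params by (simp add: m_def)
  have mu1: "mu (k + 1) = m k" and mu2: "mu (k + 2) = m (Suc k)" and sg1: "sigma (k + 1) = sg k" for k
    using mu_def sigma_def by (simp_all add: m_def sg_def add.commute)
  have prox: "real n * penalty g i0 (w (Suc k))
        - (Q.dloss (w k) (m k) + sg k *\<^sub>R (w (Suc k) - w k)) \<bullet> (u - w (Suc k))
        - real n * rho / 2 * (norm (u - w (Suc k)))\<^sup>2 \<le> real n * penalty g i0 u" for k u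
  proof -
    have "(\<Sum>l<L. grad (\<lambda>u. gtilde tau M y xb l u (mu (k+1))) (w k) \<bullet> z) = Q.dloss (w k) (m k) \<bullet> z" for k z
      by (simp only: inner_sum_left[symmetric] mu1 grad_sum[OF m_pos])
    note min = iter[unfolded this sg1, rule_format]
    show ?thesis
      unfolding Suc_eq_plus1 by (rule prox_minimizer_inequality[OF weakcvx(2) of_nat_0_le_iff min])
  qed
  show ?thesis
  proof (cases "n = 0")
    \<comment> \<open>The locale \<open>fspg\<close> requires a positive weight \<open>N\<close>.
      Here the loss is constantly 0 and the zero residual works for every subgradient.\<close>
    case True
    then have "S = {}" using cardS finS by simp
    have "\<forall>k. \<exists>s. s \<in> frechet_subdiff (penalty g i0) (w (k + 1))"
      using penalty_frechet_subdiff_nonempty[OF T] by blast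
    moreover have "grad (\<lambda>u. \<Sum>l<L. gtilde tau M y xb l u (mu (k+2))) (w (k+1)) = 0" for k
      unfolding mu2 grad_loss[OF m_pos] Q.dloss_def unfolding \<open>S = {}\<close> by simp
    ultimately show ?thesis using True by (intro exI[of _ "\<lambda>_. 0"]) auto
  next
    case False
    interpret fspg S b yy tau beta c i0 "real n" g T d rho w m sg
      by unfold_locales (use False T params weakcvx(1) prox in \<open>auto simp: m_def sg_def\<close>)
    have "kap k \<in> {grad (\<lambda>u. \<Sum>l<L. gtilde tau M y xb l u (mu (k+2))) (w (k+1)) + real n *\<^sub>R s
        | s. s \<in> frechet_subdiff (penalty g i0) (w (k+1))}" for k
    proof -
      let ?x = "w (Suc k)"
      define a where "a = Q.dloss (w k) (m k) + sg k *\<^sub>R (?x - w k)"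
      \<comment> \<open>The subgradient in the optimality condition, freed from the weight
        \<open>n\<close>; the slack \<open>n * rho / 2\<close> becomes
        \<open>rho / 2\<close>.\<close>
      let ?s = "- (a /\<^sub>R real n)"
      have "?s \<in> frechet_subdiff (penalty g i0) ?x"
      proof (rule frechet_subdiffI_quadratic[where C = "rho / 2"])
        fix u
        have "real n * (penalty g i0 ?x + ?s \<bullet> (u - ?x) - rho / 2 * (norm (u - ?x))\<^sup>2) \<le> real n * penalty g i0 u"
        proof -
          have e: "real n * (?s \<bullet> z) = - (a \<bullet> z)" for z using False by simp
          show ?thesis using prox[of k u] unfolding a_def[symmetric] right_diff_distrib distrib_left e by simp
        qed
        then show "penalty g i0 ?x + ?s \<bullet> (u - ?x) - rho / 2 * (norm (u - ?x))\<^sup>2 \<le> penalty g i0 u"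
          using False by (simp add: mult_le_cancel_left_pos)
      qed
      moreover have "kap k = Q.dloss ?x (m (Suc k)) + real n *\<^sub>R ?s"
        using False by (simp add: kap_def a_def[symmetric])
      ultimately show ?thesis
        unfolding mu2 grad_loss[OF m_pos] Suc_eq_plus1[symmetric] by blast
    qed
    moreover have "(\<lambda>k. norm (kap k)) \<in> o(\<lambda>k. real k powr (-1/2 + d/2))"
      using kap_rate params(4) by (intro smallo_of_weighted_square) auto
    ultimately show ?thesis by blast
  qed
qed

end
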